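(* Let $k$ be a field, $n\ge 1$, and let $P=k((x_1))\dots((x_n))((\partial_1^{-1}))\dots((\partial_n^{-1}))$ and $E=k[[x_1,\dots,x_n]]((\partial_1^{-1}))\dots((\partial_n^{-1}))\subset P$ be the rings of formal pseudo-differential operators defined in the context. Then: i) $P$ is an associative skew-field. A nonzero operator $L\in E$ is invertible in the ring $E$ if and only if the coefficient $f$ in the highest term of $L$ is invertible in the ring $k[[x_1,\dots,x_n]]$. ii) For all nonzero $L,M\in P$: $\mathrm{ord}(LM)=\mathrm{ord}(L)+\mathrm{ord}(M)$, and, if $L+M\neq 0$, $\mathrm{ord}(L+M)\le\max(\mathrm{ord}(L),\mathrm{ord}(M))$. iii) For all nonzero $L,M\in P$: $\nu(LM)=\nu(L)+\nu(M)$, and, if $L+M\ne 0$, $\nu(L+M)\le\max(\nu(L),\nu(M))$ for the lexicographical order on $\mathbf{Z}^n$ in which the last coordinate is compared first, then the next-to-last, and so on. iv) Let $m\in\mathbf{N}$ be a positive integer with $(m,\mathrm{char}(k))=1$ (no condition on $m$ if $\mathrm{char}(k)=0$), and let $L\in P$ (respectively $L\in E$) be nonzero with $\nu(L)$ divisible by $m$. If the coefficient $f$ in the highest term of $L$ is an $m$-th power in $k((x_1))\dots((x_n))$ (respectively in $k[[x_1,\dots,x_n]]$), then there exists an operator $M\in P$ (respectively $M\in E$), unique up to multiplication by an $m$-th root of unity, such that $L=M^m$.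
   Context: For an associative (not necessarily commutative) ring $A$ with a derivation $d:A\to A$, $A((\partial^{-1}))$ is the left $A$-module of formal expressions $L=\sum_{i\le N}a_i\partial^i$ ($a_i\in A$, $N\in\mathbf{Z}$), with multiplication $$\Big(\sum_i a_i\partial^i\Big)\Big(\sum_j b_j\partial^j\Big)=\sum_{i,j;\,l\ge 0}\binom{i}{l}a_i\,d^l(b_j)\,\partial^{i+j-l},\qquad \binom{i}{l}=\frac{i(i-1)\cdots(i-l+1)}{l!},\ \binom{i}{0}=1 .$$ The rings $P$ and $E$ are obtained by iterating this construction $n$ times, starting from the field of iterated Laurent series $k((x_1))\dots((x_n))$ (respectively from the ring of power series $k[[x_1,\dots,x_n]]$) in commuting variables; at the $i$-th step $\partial_i^{-1}$ is adjoined using the derivation $\partial/\partial x_i$ acting on coefficients (and killing $\partial_1,\dots,\partial_{i-1}$). Write a nonzero $L\in P$ as $L=\sum_{i\le m}a_i\partial_n^i$ with $a_m\ne0$, where the $a_i$ lie in $k((x_1))\dots((x_n))((\partial_1^{-1}))\dots((\partial_{n-1}^{-1}))$. Then $\mathrm{ord}(L)=m$ is the order of $L$, and the highest term of $L$ is defined inductively by: highest term$(L)$ = (highest term$(a_m))\,\partial_n^m$, the highest term of an element of $k((x_1))\dots((x_n))$ being the element itself. Thus the highest term has the form $f\,\partial_1^{m_1}\cdots\partial_n^{m_n}$ with $0\neq f\in k((x_1))\dots((x_n))$, and one puts $\nu(L)=(m_1,\dots,m_n)\in\mathbf{Z}^n$. Divisibility of $\nu(L)$ by $m$ means divisibility of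 every coordinate.
   Formalization: In iv) for E, existence of M is proved only when the highest coefficient f is invertible in k[[x_1,...,x_n]]; without this it fails: x^2∂^2+∂ (n=1, m=2, char k≠2) has no square root in E. Uniqueness in E needs no such condition. *)

theory Defs
  imports
    "HOL-Algebra.Algebra"
    "HOL-Library.List_Lexorder"
begin

(* The number of iterations n is a variable, so all rings of the towers are HOL-Algebra rings
   over one type: Const embeds k, and Ser a stands for a formal series with coefficients a i,
   which may themselves be series. *)

datatype 'k ser = Const (base: 'k) | Ser (cf: "int \<Rightarrow> 'k ser")

definition coeffwise :: "('k ser \<Rightarrow> 'k ser) \<Rightarrow> 'k ser \<Rightarrow> 'k ser" where
  "coeffwise f a = Ser (\<lambda>i. f (cf a i))"

definition const_series :: "'k ser ring \<Rightarrow> 'k ser \<Rightarrow> 'k ser" where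
  "const_series R c = Ser (\<lambda>i. if i = 0 then c else \<zero>\<^bsub>R\<^esub>)"

definition const_ring :: "'k::field ser ring" where
  "const_ring =
     \<lparr>carrier = range Const,
      monoid.mult = (\<lambda>a b. Const (base a * base b)),
      one = Const 1,
      ring.zero = Const 0,
      ring.add = (\<lambda>a b. Const (base a + base b))\<rparr>"

(* Laurent series R((x)): the coefficient a i belongs to x^i.  Omitting the vanishing products
   makes the index set of the sum finite; finsum over an infinite set would be zero. *)

definition laurent :: "'k ser ring \<Rightarrow> 'k ser ring" where
  "laurent R =
     \<lparr>carrier = {Ser a | a. (\<forall>i. a i \<in> carrier R) \<and> (\<exists>N. \<forall>i<N. a i = \<zero>\<^bsub>R\<^esub>)},
      monoid.mult = (\<lambda>a b. Ser (\<lambda>s.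
        finsum R (\<lambda>(i, j). cf a i \<otimes>\<^bsub>R\<^esub> cf b j)
          {(i, j). i + j = s \<and> cf a i \<noteq> \<zero>\<^bsub>R\<^esub> \<and> cf b j \<noteq> \<zero>\<^bsub>R\<^esub>})),
      one = const_series R \<one>\<^bsub>R\<^esub>,
      ring.zero = Ser (\<lambda>i. \<zero>\<^bsub>R\<^esub>),
      ring.add = (\<lambda>a b. Ser (\<lambda>i. cf a i \<oplus>\<^bsub>R\<^esub> cf b i))\<rparr>"

definition powser :: "'k ser ring \<Rightarrow> 'k ser ring" where
  "powser R = (laurent R)
     \<lparr>carrier := {Ser a | a. (\<forall>i. a i \<in> carrier R) \<and> (\<forall>i<0. a i = \<zero>\<^bsub>R\<^esub>)}\<rparr>"

definition xderiv :: "'k ser ring \<Rightarrow> 'k ser \<Rightarrow> 'k ser" where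
  "xderiv R a = Ser (\<lambda>i. add_pow R (i + 1) (cf a (i + 1)))"

(* The division is exact.  (The syntax of gchoose admits no int here: it would coerce to real.) *)

definition int_binomial :: "int \<Rightarrow> nat \<Rightarrow> int" where
  "int_binomial i l = (\<Prod>r<l. i - int r) div fact l"

(* R((\<partial>^-1)) for a derivation d of R: the coefficient a i belongs to \<partial>^i. *)

definition psdo :: "'k ser ring \<Rightarrow> ('k ser \<Rightarrow> 'k ser) \<Rightarrow> 'k ser ring" where
  "psdo R d =
     \<lparr>carrier = {Ser a | a. (\<forall>i. a i \<in> carrier R) \<and> (\<exists>N. \<forall>i>N. a i = \<zero>\<^bsub>R\<^esub>)},
      monoid.mult = (\<lambda>a b. Ser (\<lambda>s.
        finsum R (\<lambda>(i, j, l). add_pow R (int_binomial i l) (cf a i \<otimes>\<^bsub>R\<^esub> (d ^^ l) (cf b j)))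
          {(i, j, l). i + j - int l = s \<and> cf a i \<noteq> \<zero>\<^bsub>R\<^esub> \<and> cf b j \<noteq> \<zero>\<^bsub>R\<^esub>})),
      one = const_series R \<one>\<^bsub>R\<^esub>,
      ring.zero = Ser (\<lambda>i. \<zero>\<^bsub>R\<^esub>),
      ring.add = (\<lambda>a b. Ser (\<lambda>i. cf a i \<oplus>\<^bsub>R\<^esub> cf b i))\<rparr>"

(* k((x_1))...((x_n)) and k[[x_1,...,x_n]] = k[[x_1]]...[[x_n]] *)

primrec laurent_field :: "nat \<Rightarrow> 'k::field ser ring" where
  "laurent_field 0 = const_ring"
| "laurent_field (Suc n) = laurent (laurent_field n)"

primrec power_series_ring :: "nat \<Rightarrow> 'k::field ser ring" where
  "power_series_ring 0 = const_ring"
| "power_series_ring (Suc n) = powser (power_series_ring n)"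

(* The derivation d/dx_i of B((\<partial>_1^-1))...((\<partial>_(i-1)^-1)), where B is one of the two rings above:
   x_i lies below the layers of \<partial>_(i-1), ..., \<partial>_1 and then of x_n, ..., x_(i+1). *)

definition partial_deriv :: "nat \<Rightarrow> nat \<Rightarrow> 'k::field ser \<Rightarrow> 'k ser" where
  "partial_deriv n i =
     (coeffwise ^^ (i - 1)) ((coeffwise ^^ (n - i)) (xderiv (laurent_field (i - 1))))"

primrec psdo_tower :: "nat \<Rightarrow> 'k::field ser ring \<Rightarrow> nat \<Rightarrow> 'k ser ring" where
  "psdo_tower n B 0 = B"
| "psdo_tower n B (Suc i) = psdo (psdo_tower n B i) (partial_deriv n (Suc i))"

definition P_ring :: "nat \<Rightarrow> 'k::field ser ring" where
  "P_ring n = psdo_tower n (laurent_field n) n"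

(* Roots in E: L = x^2 \<partial>^2 + \<partial> in k[[x]]((\<partial>^-1)) has no square root there, although its highest coefficient
   x^2 is a square in k[[x]].  A root would be b_1 \<partial> + b_0 + ... with b_1^2 = x^2, and comparing
   coefficients of \<partial> gives b_1 b_1' + 2 b_1 b_0 = 1, where the left side vanishes at x = 0.  The
   existence of roots in E therefore needs a highest coefficient that is a unit. *)

definition E_ring :: "nat \<Rightarrow> 'k::field ser ring" where
  "E_ring n = psdo_tower n (power_series_ring n) n"

(* ord_at n i L is the order in \<partial>_i of L in k((x_1))...((x_n))((\<partial>_1^-1))...((\<partial>_i^-1)); the highest
   term of L is lead_coeff_at n i L * \<partial>_1^(m_1)...\<partial>_i^(m_i) with nu_at n i L = [m_1, ..., m_i]. *)

definition ord_at :: "nat \<Rightarrow> nat \<Rightarrow> 'k::field ser \<Rightarrow> int" where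
  "ord_at n i L = (GREATEST m. cf L m \<noteq> \<zero>\<^bsub>psdo_tower n (laurent_field n) (i - 1)\<^esub>)"

primrec lead_coeff_at :: "nat \<Rightarrow> nat \<Rightarrow> 'k::field ser \<Rightarrow> 'k ser" where
  "lead_coeff_at n 0 L = L"
| "lead_coeff_at n (Suc i) L = lead_coeff_at n i (cf L (ord_at n (Suc i) L))"

primrec nu_at :: "nat \<Rightarrow> nat \<Rightarrow> 'k::field ser \<Rightarrow> int list" where
  "nu_at n 0 L = []"
| "nu_at n (Suc i) L = nu_at n i (cf L (ord_at n (Suc i) L)) @ [ord_at n (Suc i) L]"

definition op_ord :: "nat \<Rightarrow> 'k::field ser \<Rightarrow> int" where
  "op_ord n = ord_at n n"

definition op_lead :: "nat \<Rightarrow> 'k::field ser \<Rightarrow> 'k ser" where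
  "op_lead n = lead_coeff_at n n"

definition op_nu :: "nat \<Rightarrow> 'k::field ser \<Rightarrow> int list" where
  "op_nu n = nu_at n n"

(* The embedding of k into P (its image lies in E). *)

primrec laurent_const :: "nat \<Rightarrow> 'k::field \<Rightarrow> 'k ser" where
  "laurent_const 0 c = Const c"
| "laurent_const (Suc n) c = const_series (laurent_field n) (laurent_const n c)"

primrec tower_const :: "nat \<Rightarrow> nat \<Rightarrow> 'k::field \<Rightarrow> 'k ser" where
  "tower_const n 0 c = laurent_const n c"
| "tower_const n (Suc i) c = const_series (psdo_tower n (laurent_field n) i) (tower_const n i c)"

definition scalar :: "nat \<Rightarrow> 'k::field \<Rightarrow> 'k ser" where
  "scalar n = tower_const n n"

locale skew_field = ring +
  assumes Units_eq: "Units R = carrier R - {\<zero>}"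

end

theory Submission
  imports Defs "HOL-Computational_Algebra.Formal_Power_Series"
begin

text \<open>
  Every ring in the two towers is a ring of series over the previous one, and everything is read off
  from leading coefficients. In a product of monomials only the term without derivatives has the full
  order, so orders add and leading coefficients multiply. By induction through the layers, where the
  leading coefficient of a series is an element of the layer below, the tower has no zero divisors,
  the highest terms multiply, and \<open>\<nu>\<close> is additive.

  That the product is associative is checked on monomials. After the Leibniz rule both sides have the
  same shape, and their coefficients agree by a trinomial revision followed by Vandermonde's
  convolution (\<open>int_binomial_convolution\<close>, \<open>psdo_term_assoc\<close>). Laurent series are the case of the zero
  derivation, read backwards. A derivation of the coefficients extends to the series because it
  commutes with the derivation that defines their product. The derivations with respect to the
  variables commute with each other, so each of them survives until its own layer is built.

  Inverses and roots come from one lemma, \<open>successive_approximation\<close>: an equation \<open>\<Phi> x = L\<close> between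
  series is solved coefficient by coefficient from the top, if a perturbation of \<open>x\<close> changes the
  leading coefficient of \<open>\<Phi> x\<close> by a surjective map \<open>\<tau>\<close> of the coefficient ring. For left multiplication
  by \<open>x\<close>, the map \<open>\<tau>\<close> is left multiplication by a leading coefficient, so that a series is invertible if its
  leading coefficient is. For the \<open>m\<close>-th power, \<open>\<tau>\<close> is the differential
  \<open>y \<mapsto> \<Sum>j<m. b\<^sup>j y b\<^bsup>m-1-j\<^esup>\<close> of the power map at the leading coefficient \<open>b\<close> of the root. It lives in a
  noncommutative ring, but its own leading coefficient is the same expression one layer below, and in
  the commutative coefficient ring it is \<open>y \<mapsto> m b\<^bsup>m-1\<^esup> y\<close>. Hence it is bijective as soon as \<open>m\<close> and
  the coefficient of the highest term of \<open>b\<close> are units; in \<open>P\<close> this coefficient lies in a field.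

  Roots are unique up to roots of unity of \<open>k\<close>, by induction from \<open>k\<close> through the layers of variables
  and of derivations alike. If \<open>f\<close> and \<open>g\<close> have the same \<open>m\<close>-th power, then so have their leading
  coefficients; after multiplication by a root of unity these agree. A remaining difference \<open>D\<close> of
  the two would show in the difference of the powers, whose leading coefficient is the differential
  applied to that of \<open>D\<close>, and the differential is injective.
\<close>

section \<open>Finite sums and additive maps\<close>

definition additive_map :: "('a, 'b) ring_scheme \<Rightarrow> ('a \<Rightarrow> 'a) \<Rightarrow> bool" where
  "additive_map R h \<longleftrightarrow> (\<forall>x \<in> carrier R. h x \<in> carrier R) \<and>
     (\<forall>x \<in> carrier R. \<forall>y \<in> carrier R. h (x \<oplus>\<^bsub>R\<^esub> y) = h x \<oplus>\<^bsub>R\<^esub> h y)"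

context ring
begin

lemma finsum_closed_on: "(\<And>i. i \<in> A \<Longrightarrow> f i \<in> carrier R) \<Longrightarrow> finsum R f A \<in> carrier R"
  by (intro finsum_closed) auto

lemma finsum_cong_on:
  "A = B \<Longrightarrow> (\<And>i. i \<in> B \<Longrightarrow> f i = g i) \<Longrightarrow> (\<And>i. i \<in> B \<Longrightarrow> g i \<in> carrier R)
    \<Longrightarrow> finsum R f A = finsum R g B"
  by (intro finsum_cong') auto

lemma finsum_extend:
  "finite B \<Longrightarrow> A \<subseteq> B \<Longrightarrow> (\<And>i. i \<in> B - A \<Longrightarrow> f i = \<zero>) \<Longrightarrow> (\<And>i. i \<in> A \<Longrightarrow> f i \<in> carrier R)
    \<Longrightarrow> finsum R f A = finsum R f B"
  by (intro add.finprod_mono_neutral_cong_left) (auto, metis zero_closed)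

lemma finsum_eq_single:
  assumes "finite A" "a \<in> A" "\<And>i. i \<in> A \<Longrightarrow> i \<noteq> a \<Longrightarrow> f i = \<zero>" "f a \<in> carrier R"
  shows "finsum R f A = f a"
proof -
  have "finsum R f {a} = finsum R f A"
    by (rule finsum_extend) (use assms in auto)
  then show ?thesis using assms by (simp add: finsum_insert)
qed

lemma finsum_swap:
  assumes "finite A" "finite B" "\<And>i j. i \<in> A \<Longrightarrow> j \<in> B \<Longrightarrow> f i j \<in> carrier R"
  shows "(\<Oplus>i\<in>A. \<Oplus>j\<in>B. f i j) = (\<Oplus>j\<in>B. \<Oplus>i\<in>A. f i j)"
  using assms(1,3)
proof (induction A rule: finite_induct)
  case empty
  then show ?case by (simp add: add.finprod_one_eqI)
next
  case (insert a A)
  have "(\<Oplus>i\<in>insert a A. \<Oplus>j\<in>B. f i j) = (\<Oplus>j\<in>B. f a j) \<oplus> (\<Oplus>i\<in>A. \<Oplus>j\<in>B. f i j)"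
    using insert by (intro finsum_insert) (auto intro!: finsum_closed_on)
  also have "\<dots> = (\<Oplus>j\<in>B. f a j \<oplus> (\<Oplus>i\<in>A. f i j))"
    using insert by (subst finsum_addf) (auto intro!: finsum_closed_on)
  also have "\<dots> = (\<Oplus>j\<in>B. \<Oplus>i\<in>insert a A. f i j)"
    using insert
    by (intro finsum_cong_on) (auto intro!: finsum_closed_on finsum_insert[symmetric])
  finally show ?case .
qed

lemma finsum_Times:
  assumes "finite A" "finite B" "\<And>i j. i \<in> A \<Longrightarrow> j \<in> B \<Longrightarrow> f (i, j) \<in> carrier R"
  shows "finsum R f (A \<times> B) = (\<Oplus>i\<in>A. \<Oplus>j\<in>B. f (i, j))"
  using assms(1,3)
proof (induction A rule: finite_induct)
  case (insert a A)
  have "finsum R f (insert a A \<times> B) = finsum R f ({a} \<times> B \<union> A \<times> B)"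
    by (rule arg_cong[where f = "finsum R f"]) auto
  also have "\<dots> = finsum R f ({a} \<times> B) \<oplus> finsum R f (A \<times> B)"
    using insert assms by (intro finsum_Un_disjoint) auto
  also have "finsum R f ({a} \<times> B) = finsum R f (Pair a ` B)"
    by (rule arg_cong[where f = "finsum R f"]) auto
  also have "\<dots> = (\<Oplus>j\<in>B. f (a, j))"
    using insert by (intro finsum_reindex) (auto simp: inj_on_def)
  finally show ?case
    using insert by (auto simp: finsum_insert finsum_closed_on)
qed auto

lemma additive_map_zero: "additive_map R h \<Longrightarrow> h \<zero> = \<zero>"
  unfolding additive_map_def by (metis add.l_cancel_one' l_zero zero_closed)

lemma additive_map_finsum:
  assumes "additive_map R h" "finite A" "\<And>i. i \<in> A \<Longrightarrow> f i \<in> carrier R"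
  shows "h (finsum R f A) = (\<Oplus>i\<in>A. h (f i))"
  using assms(2,3)
proof (induction A rule: finite_induct)
  case empty
  then show ?case using assms(1) by (simp add: additive_map_zero)
next
  case (insert a A)
  then have "h (finsum R f (insert a A)) = h (f a) \<oplus> h (finsum R f A)"
    using assms(1) by (simp add: additive_map_def Pi_iff finsum_insert)
  also have "\<dots> = (\<Oplus>i\<in>insert a A. h (f i))"
    using insert assms(1)
    by (subst finsum_insert) (auto simp: additive_map_def)
  finally show ?case .
qed

lemma additive_map_add_pow:
  fixes k :: int
  assumes "additive_map R h" "x \<in> carrier R"
  shows "h ([k] \<cdot> x) = [k] \<cdot> h x"
proof -
  have "group_hom (add_monoid R) (add_monoid R) h"
    using assms(1) unfolding additive_map_def
    by (intro group_hom.intro group_hom_axioms.intro a_group) (auto simp: hom_def)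
  then show ?thesis
    using group_hom.hom_int_pow[of "add_monoid R" "add_monoid R" h x k] assms
    by (simp add: add_pow_def)
qed

lemma additive_map_funpow: "additive_map R h \<Longrightarrow> additive_map R (h ^^ k)"
  unfolding additive_map_def by (induction k) auto

lemma additive_map_int_mult: "additive_map R (\<lambda>x. [(k :: int)] \<cdot> x)"
  unfolding additive_map_def by (auto simp: add.int_pow_distrib)

lemma additive_map_lmult: "a \<in> carrier R \<Longrightarrow> additive_map R (\<lambda>x. a \<otimes> x)"
  unfolding additive_map_def by (auto simp: r_distr)

lemma add_pow_int_0: "x \<in> carrier R \<Longrightarrow> [(0 :: int)] \<cdot> x = \<zero>"
  by (simp add: add_pow_def int_pow_def)

lemma finsum_int_mult:
  fixes k :: "'i \<Rightarrow> int"
  assumes "finite A" "x \<in> carrier R"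
  shows "(\<Oplus>i\<in>A. [k i] \<cdot> x) = [sum k A] \<cdot> x"
  using assms
proof (induction A rule: finite_induct)
  case (insert a A)
  then show ?case
    by (subst finsum_insert) (auto simp: add.int_pow_mult)
qed (simp add: add_pow_int_0)

end

section \<open>Derivations\<close>

definition derivation :: "('a, 'b) ring_scheme \<Rightarrow> ('a \<Rightarrow> 'a) \<Rightarrow> bool" where
  "derivation R d \<longleftrightarrow> additive_map R d \<and>
     (\<forall>x \<in> carrier R. \<forall>y \<in> carrier R. d (x \<otimes>\<^bsub>R\<^esub> y) = d x \<otimes>\<^bsub>R\<^esub> y \<oplus>\<^bsub>R\<^esub> x \<otimes>\<^bsub>R\<^esub> d y)"

locale differential_ring = ring R for R (structure) +
  fixes d
  assumes derivation: "derivation R d"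
begin

lemma additive: "additive_map R d"
  using derivation by (simp add: derivation_def)

lemma funpow_closed [simp, intro]: "x \<in> carrier R \<Longrightarrow> (d ^^ l) x \<in> carrier R"
  using additive_map_funpow[OF additive, of l] by (simp add: additive_map_def)

lemma d_closed [simp, intro]: "x \<in> carrier R \<Longrightarrow> d x \<in> carrier R"
  using funpow_closed[of x 1] by simp

lemma funpow_zero [simp]: "(d ^^ l) \<zero> = \<zero>"
  by (intro additive_map_zero additive_map_funpow additive)

lemma d_one [simp]: "d \<one> = \<zero>"
proof -
  have "d \<one> \<oplus> d \<one> = d \<one>"
    using derivation unfolding derivation_def by (metis d_closed l_one one_closed r_one)
  then show ?thesis by (metis add.l_cancel_one' d_closed one_closed)
qed

text \<open>The upper limit may exceed the order, since the superfluous binomial coefficients vanish.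
  This makes the sums of different Leibniz formulas range over the same index set.\<close>

lemma Leibniz:
  assumes xy: "x \<in> carrier R" "y \<in> carrier R" and "l \<le> t"
  shows "(d ^^ l) (x \<otimes> y) = (\<Oplus>r\<in>{..t}. [int (l choose r)] \<cdot> ((d ^^ r) x \<otimes> (d ^^ (l - r)) y))"
proof -
  have *: "(d ^^ l) (x \<otimes> y) = (\<Oplus>r\<in>{..l}. [int (l choose r)] \<cdot> ((d ^^ r) x \<otimes> (d ^^ (l - r)) y))"
  proof (induction l)
    case 0
    then show ?case using xy by simp
  next
    case (Suc l)
    let ?X = "\<lambda>r. (d ^^ r) x \<otimes> (d ^^ (Suc l - r)) y"
    have "(d ^^ Suc l) (x \<otimes> y) = (\<Oplus>r\<in>{..l}. d ([int (l choose r)] \<cdot> ((d ^^ r) x \<otimes> (d ^^ (l - r)) y)))"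
      using xy by (simp add: Suc additive_map_finsum[OF additive])
    also have "\<dots> = (\<Oplus>r\<in>{..l}. [int (l choose r)] \<cdot> ?X (Suc r) \<oplus> [int (l choose r)] \<cdot> ?X r)"
    proof (rule finsum_cong_on)
      fix r assume "r \<in> {..l}"
      then have "Suc l - r = Suc (l - r)" by auto
      then show "d ([int (l choose r)] \<cdot> ((d ^^ r) x \<otimes> (d ^^ (l - r)) y))
          = [int (l choose r)] \<cdot> ?X (Suc r) \<oplus> [int (l choose r)] \<cdot> ?X r"
        using derivation xy
        by (simp add: additive_map_add_pow[OF additive] derivation_def add.int_pow_distrib)
    qed (use xy in auto)
    also have "\<dots> = (\<Oplus>r\<in>{..l}. [int (l choose r)] \<cdot> ?X (Suc r)) \<oplus> (\<Oplus>r\<in>{..l}. [int (l choose r)] \<cdot> ?X r)"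
      using xy by (intro finsum_addf) auto
    also have "(\<Oplus>r\<in>{..l}. [int (l choose r)] \<cdot> ?X r) = (\<Oplus>r\<in>{..Suc l}. [int (l choose r)] \<cdot> ?X r)"
      using xy by (intro finsum_extend) (auto simp: not_le binomial_eq_0 add_pow_int_0)
    also have "(\<Oplus>r\<in>{..l}. [int (l choose r)] \<cdot> ?X (Suc r))
        = (\<Oplus>r\<in>Suc ` {..l}. [int (if r = 0 then 0 else l choose (r - 1))] \<cdot> ?X r)"
      using xy by (subst finsum_reindex) auto
    also have "\<dots> = (\<Oplus>r\<in>{..Suc l}. [int (if r = 0 then 0 else l choose (r - 1))] \<cdot> ?X r)"
    proof (rule finsum_extend)
      fix r assume "r \<in> {..Suc l} - Suc ` {..l}"
      then have "r = 0" by (cases r) auto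
      then show "[int (if r = 0 then 0 else l choose (r - 1))] \<cdot> ?X r = \<zero>"
        using xy by (simp add: add_pow_int_0 del: funpow.simps)
    qed (use xy in \<open>auto simp del: funpow.simps\<close>)
    also have "\<dots> \<oplus> (\<Oplus>r\<in>{..Suc l}. [int (l choose r)] \<cdot> ?X r)
        = (\<Oplus>r\<in>{..Suc l}. [int (if r = 0 then 0 else l choose (r - 1))] \<cdot> ?X r \<oplus> [int (l choose r)] \<cdot> ?X r)"
      using xy by (intro finsum_addf[symmetric]) auto
    also have "\<dots> = (\<Oplus>r\<in>{..Suc l}. [int (Suc l choose r)] \<cdot> ?X r)"
    proof (rule finsum_cong_on)
      fix r
      have "int (if r = 0 then 0 else l choose (r - 1)) + int (l choose r) = int (Suc l choose r)"
        by (cases r) auto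
      then show "[int (if r = 0 then 0 else l choose (r - 1))] \<cdot> ?X r \<oplus> [int (l choose r)] \<cdot> ?X r
          = [int (Suc l choose r)] \<cdot> ?X r"
        using xy add.int_pow_mult[of "?X r"] by (metis funpow_closed m_closed)
    qed (use xy in \<open>auto simp del: funpow.simps\<close>)
    finally show ?case .
  qed
  also have "\<dots> = (\<Oplus>r\<in>{..t}. [int (l choose r)] \<cdot> ((d ^^ r) x \<otimes> (d ^^ (l - r)) y))"
    using xy \<open>l \<le> t\<close> by (intro finsum_extend) (auto simp: not_le binomial_eq_0 add_pow_int_0)
  finally show ?thesis .
qed

end

section \<open>Binomial coefficients\<close>

lemma int_binomial_eq_gbinomial: "of_int (int_binomial i l) = (of_int i gchoose l :: rat)"
  using of_int_gbinomial[where 'a = rat, of i l]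
  by (simp only: int_binomial_def gbinomial_prod_rev[where a = i] atLeast0LessThan)

lemma int_binomial_0 [simp]: "int_binomial i 0 = 1"
  by (simp add: int_binomial_def)

lemma int_binomial_zero: "l > 0 \<Longrightarrow> int_binomial 0 l = 0"
  using int_binomial_eq_gbinomial[of 0 l] by (cases l) auto

text \<open>Each product \<^term>\<open>(i gchoose (t - q)) * ((t - q) choose r)\<close> is
  \<^term>\<open>(i gchoose r) * ((i - r) gchoose (t - r - q))\<close>, and what remains is the Vandermonde
  convolution.\<close>

lemma int_binomial_convolution:
  assumes "r \<le> t"
  shows "(\<Sum>q\<le>t. int_binomial i (t - q) * int_binomial j q * int ((t - q) choose r))
      = int_binomial i r * int_binomial (i + j - int r) (t - r)"
proof -
  let ?i = "of_int i :: rat" and ?j = "of_int j :: rat"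
  have "(\<Sum>q\<le>t. (?i gchoose (t - q)) * (?j gchoose q) * of_nat ((t - q) choose r))
      = (\<Sum>q\<le>t - r. (?i gchoose (t - q)) * (?j gchoose q) * of_nat ((t - q) choose r))"
    by (rule sum.mono_neutral_right) (auto simp: binomial_eq_0 not_le)
  also have "\<dots> = (\<Sum>q\<le>t - r. (?i gchoose r) * ((?j gchoose q) * (?i - of_nat r gchoose (t - r - q))))"
  proof (rule sum.cong)
    fix q assume "q \<in> {..t - r}"
    then have "r \<le> t - q" using assms by auto
    then have "(?i gchoose (t - q)) * (of_nat (t - q) gchoose r)
        = (?i gchoose r) * (?i - of_nat r gchoose (t - q - r))"
      by (rule gbinomial_trinomial_revision)
    then show "(?i gchoose (t - q)) * (?j gchoose q) * of_nat ((t - q) choose r)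
        = (?i gchoose r) * ((?j gchoose q) * (?i - of_nat r gchoose (t - r - q)))"
      by (simp add: binomial_gbinomial algebra_simps diff_commute)
  qed simp
  also have "\<dots> = (?i gchoose r) * (?j + (?i - of_nat r) gchoose (t - r))"
    by (simp only: gbinomial_Vandermonde[symmetric] sum_distrib_left atLeast0AtMost)
  finally have "of_int (\<Sum>q\<le>t. int_binomial i (t - q) * int_binomial j q * int ((t - q) choose r))
      = (of_int (int_binomial i r * int_binomial (i + j - int r) (t - r)) :: rat)"
    by (simp add: int_binomial_eq_gbinomial algebra_simps)
  then show ?thesis by (simp only: of_int_eq_iff)
qed

section \<open>Pseudo-differential series\<close>

locale psdo_coeffs = differential_ring R d for R :: "'k ser ring" (structure) and d
begin

abbreviation S where "S \<equiv> psdo R d"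

text \<open>The contribution of \<open>x \<partial>\<^sup>i\<close> and \<open>y \<partial>\<^sup>j\<close> to the coefficient at \<open>s\<close> of their product. The number of
  derivatives is determined by \<open>i\<close>, \<open>j\<close> and \<open>s\<close>, so that sums over triples become sums over pairs.\<close>

definition psdo_term :: "int \<Rightarrow> int \<Rightarrow> int \<Rightarrow> 'k ser \<Rightarrow> 'k ser \<Rightarrow> 'k ser" where
  "psdo_term s i j x y =
     (if s \<le> i + j then [int_binomial i (nat (i + j - s))] \<cdot> (x \<otimes> (d ^^ nat (i + j - s)) y) else \<zero>)"

lemma psdo_term_closed [simp, intro]:
  "x \<in> carrier R \<Longrightarrow> y \<in> carrier R \<Longrightarrow> psdo_term s i j x y \<in> carrier R"
  by (simp add: psdo_term_def)

lemma psdo_term_zero [simp]: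
  "x \<in> carrier R \<Longrightarrow> psdo_term s i j x \<zero> = \<zero>" "y \<in> carrier R \<Longrightarrow> psdo_term s i j \<zero> y = \<zero>"
  by (simp_all add: psdo_term_def)

lemma psdo_term_additive:
  "x \<in> carrier R \<Longrightarrow> additive_map R (\<lambda>y. psdo_term s i j x y)"
  "y \<in> carrier R \<Longrightarrow> additive_map R (\<lambda>x. psdo_term s i j x y)"
proof -
  show "additive_map R (\<lambda>x. psdo_term s i j x y)" if "y \<in> carrier R"
    using that unfolding additive_map_def
    by (auto simp: psdo_term_def l_distr add.int_pow_distrib)
  have *: "(d ^^ l) (y \<oplus> z) = (d ^^ l) y \<oplus> (d ^^ l) z" if "y \<in> carrier R" "z \<in> carrier R" for l y z
    using that additive_map_funpow[OF additive, of l] by (simp add: additive_map_def)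
  show "additive_map R (\<lambda>y. psdo_term s i j x y)" if "x \<in> carrier R"
    using that unfolding additive_map_def
    by (auto simp: psdo_term_def * r_distr add.int_pow_distrib)
qed

lemma psdo_carrier_iff:
  "a \<in> carrier S \<longleftrightarrow> \<not> is_Const a \<and> (\<forall>i. cf a i \<in> carrier R) \<and> (\<exists>N. \<forall>i>N. cf a i = \<zero>)"
  unfolding psdo_def by (cases a) simp_all

lemma psdo_cf_closed [simp]: "a \<in> carrier S \<Longrightarrow> cf a i \<in> carrier R"
  by (simp add: psdo_carrier_iff)

lemma psdo_boundE:
  assumes "a \<in> carrier S"
  obtains N where "\<And>i. i > N \<Longrightarrow> cf a i = \<zero>"
  using assms unfolding psdo_carrier_iff by blast

lemma psdo_eqI:
  assumes "a \<in> carrier S" "b \<in> carrier S" "\<And>i. cf a i = cf b i"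
  shows "a = b"
  using assms unfolding psdo_carrier_iff by (intro ser.expand) auto

text \<open>Any finite rectangle that contains the nonvanishing contributions may serve as the range of
  summation. This is what makes it possible to exchange sums.\<close>

lemma psdo_mult_coeff:
  assumes ab: "a \<in> carrier S" "b \<in> carrier S" and fin: "finite I" "finite J"
    and IJ: "\<And>i j. s \<le> i + j \<Longrightarrow> cf a i \<noteq> \<zero> \<Longrightarrow> cf b j \<noteq> \<zero> \<Longrightarrow> i \<in> I \<and> j \<in> J"
  shows "cf (a \<otimes>\<^bsub>S\<^esub> b) s = (\<Oplus>i\<in>I. \<Oplus>j\<in>J. psdo_term s i j (cf a i) (cf b j))"
proof -
  let ?g = "\<lambda>(i, j, l). [int_binomial i l] \<cdot> (cf a i \<otimes> (d ^^ l) (cf b j))"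
  let ?h = "\<lambda>(i, j). (i, j, nat (i + j - s))"
  let ?Y = "{(i, j). s \<le> i + j \<and> cf a i \<noteq> \<zero> \<and> cf b j \<noteq> \<zero>}"
  let ?t = "\<lambda>(i, j). psdo_term s i j (cf a i) (cf b j)"
  have img: "{(i, j, l). i + j - int l = s \<and> cf a i \<noteq> \<zero> \<and> cf b j \<noteq> \<zero>} = ?h ` ?Y"
    by (auto simp: image_iff)
  have "cf (a \<otimes>\<^bsub>S\<^esub> b) s = finsum R ?g (?h ` ?Y)"
    by (simp add: psdo_def img)
  also have "\<dots> = (\<Oplus>p\<in>?Y. ?g (?h p))"
    using ab by (intro finsum_reindex) (auto simp: inj_on_def)
  also have "\<dots> = finsum R ?t ?Y"
    using ab by (intro finsum_cong_on) (auto simp: psdo_term_def)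
  also have "\<dots> = finsum R ?t (I \<times> J)"
  proof (rule finsum_extend)
    fix p assume "p \<in> I \<times> J - ?Y"
    then show "?t p = \<zero>" using ab by (cases p) (auto simp: psdo_term_def)
  qed (use ab fin IJ in auto)
  also have "\<dots> = (\<Oplus>i\<in>I. \<Oplus>j\<in>J. psdo_term s i j (cf a i) (cf b j))"
    using ab fin by (subst finsum_Times) auto
  finally show ?thesis .
qed

lemma psdo_mult_coeff_bounded:
  assumes "a \<in> carrier S" "b \<in> carrier S" "finite I" "finite J"
    and "\<And>i. i > M \<Longrightarrow> cf a i = \<zero>" "\<And>j. j > N \<Longrightarrow> cf b j = \<zero>"
    and "{s - N..M} \<subseteq> I" "{s - M..N} \<subseteq> J"
  shows "cf (a \<otimes>\<^bsub>S\<^esub> b) s = (\<Oplus>i\<in>I. \<Oplus>j\<in>J. psdo_term s i j (cf a i) (cf b j))"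
proof (rule psdo_mult_coeff)
  fix i j assume *: "s \<le> i + j" "cf a i \<noteq> \<zero>" "cf b j \<noteq> \<zero>"
  then have "i \<le> M" "j \<le> N" using assms(5,6) by (meson not_le)+
  then have "i \<in> {s - N..M}" "j \<in> {s - M..N}" using * by auto
  then show "i \<in> I \<and> j \<in> J" using assms(7,8) by blast
qed (use assms in auto)

lemma psdo_mult_closed:
  assumes ab: "a \<in> carrier S" "b \<in> carrier S"
  shows "a \<otimes>\<^bsub>S\<^esub> b \<in> carrier S"
proof -
  obtain M where M: "\<And>i. i > M \<Longrightarrow> cf a i = \<zero>" using psdo_boundE ab by metis
  obtain N where N: "\<And>i. i > N \<Longrightarrow> cf b i = \<zero>" using psdo_boundE ab by metis
  have eq: "cf (a \<otimes>\<^bsub>S\<^esub> b) s = (\<Oplus>i\<in>{s - N..M}. \<Oplus>j\<in>{s - M..N}. psdo_term s i j (cf a i) (cf b j))" for s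
    using ab M N by (intro psdo_mult_coeff_bounded) auto
  have "cf (a \<otimes>\<^bsub>S\<^esub> b) s \<in> carrier R" for s
    unfolding eq using ab by (auto intro!: finsum_closed_on)
  moreover have "cf (a \<otimes>\<^bsub>S\<^esub> b) s = \<zero>" if "s > M + N" for s
    using that by (auto simp: eq add.finprod_one_eqI)
  moreover have "\<not> is_Const (a \<otimes>\<^bsub>S\<^esub> b)"
    by (simp add: psdo_def)
  ultimately show ?thesis unfolding psdo_carrier_iff by blast
qed

lemma psdo_mult_bound:
  assumes ab: "a \<in> carrier S" "b \<in> carrier S"
    and M: "\<And>i. i > M \<Longrightarrow> cf a i = \<zero>" and N: "\<And>i. i > N \<Longrightarrow> cf b i = \<zero>" and "s > M + N"
  shows "cf (a \<otimes>\<^bsub>S\<^esub> b) s = \<zero>"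
proof -
  have "cf (a \<otimes>\<^bsub>S\<^esub> b) s = (\<Oplus>i\<in>{}. \<Oplus>j\<in>{}. psdo_term s i j (cf a i) (cf b j))"
    using assms by (intro psdo_mult_coeff_bounded) auto
  then show ?thesis by simp
qed

lemma psdo_mult_top:
  assumes ab: "a \<in> carrier S" "b \<in> carrier S"
    and M: "\<And>i. i > M \<Longrightarrow> cf a i = \<zero>" and N: "\<And>i. i > N \<Longrightarrow> cf b i = \<zero>"
  shows "cf (a \<otimes>\<^bsub>S\<^esub> b) (M + N) = cf a M \<otimes> cf b N"
proof -
  have "cf (a \<otimes>\<^bsub>S\<^esub> b) (M + N) = (\<Oplus>i\<in>{M}. \<Oplus>j\<in>{N}. psdo_term (M + N) i j (cf a i) (cf b j))"
    using assms by (intro psdo_mult_coeff_bounded) auto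
  then show ?thesis using ab by (simp add: finsum_insert psdo_term_def)
qed

lemma psdo_add_coeff: "cf (a \<oplus>\<^bsub>S\<^esub> b) i = cf a i \<oplus> cf b i"
  by (simp add: psdo_def)

lemma psdo_zero_coeff: "cf \<zero>\<^bsub>S\<^esub> i = \<zero>"
  by (simp add: psdo_def)

lemma psdo_add_closed:
  assumes "a \<in> carrier S" "b \<in> carrier S"
  shows "a \<oplus>\<^bsub>S\<^esub> b \<in> carrier S"
proof -
  obtain M where M: "\<And>i. i > M \<Longrightarrow> cf a i = \<zero>" using psdo_boundE assms by metis
  obtain N where N: "\<And>i. i > N \<Longrightarrow> cf b i = \<zero>" using psdo_boundE assms by metis
  have "\<forall>i > max M N. cf (a \<oplus>\<^bsub>S\<^esub> b) i = \<zero>" using M N by (simp add: psdo_add_coeff)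
  moreover have "\<not> is_Const (a \<oplus>\<^bsub>S\<^esub> b)" by (simp add: psdo_def)
  moreover have "\<forall>i. cf (a \<oplus>\<^bsub>S\<^esub> b) i \<in> carrier R" using assms by (simp add: psdo_add_coeff)
  ultimately show ?thesis unfolding psdo_carrier_iff by blast
qed

lemma psdo_const_series_closed: "c \<in> carrier R \<Longrightarrow> const_series R c \<in> carrier S"
  unfolding psdo_carrier_iff const_series_def by (auto intro!: exI[of _ 0])

lemma psdo_const_mult:
  assumes c: "c \<in> carrier R" and a: "a \<in> carrier S"
  shows "cf (const_series R c \<otimes>\<^bsub>S\<^esub> a) s = c \<otimes> cf a s"
proof -
  obtain N where N: "\<And>i. i > N \<Longrightarrow> cf a i = \<zero>" using psdo_boundE a by metis
  have "cf (const_series R c \<otimes>\<^bsub>S\<^esub> a) s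
      = (\<Oplus>i\<in>{0}. \<Oplus>j\<in>insert s {s..N}. psdo_term s i j (cf (const_series R c) i) (cf a j))"
  proof (rule psdo_mult_coeff)
    fix i j assume *: "s \<le> i + j" "cf (const_series R c) i \<noteq> \<zero>" "cf a j \<noteq> \<zero>"
    then have "i = 0" by (auto simp: const_series_def split: if_splits)
    moreover have "j \<le> N" using * N by (meson not_le)
    ultimately show "i \<in> {0} \<and> j \<in> insert s {s..N}" using * by auto
  qed (use c a psdo_const_series_closed in auto)
  also have "\<dots> = (\<Oplus>j\<in>insert s {s..N}. psdo_term s 0 j c (cf a j))"
    using a c by (subst finsum_insert) (auto simp: const_series_def intro!: finsum_closed_on)
  also have "\<dots> = psdo_term s 0 s c (cf a s)"
    using a c by (intro finsum_eq_single) (auto simp: psdo_term_def int_binomial_zero add_pow_int_0)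
  finally show ?thesis using a c by (simp add: psdo_term_def)
qed

lemma psdo_mult_const:
  assumes c: "c \<in> carrier R" "d c = \<zero>" and a: "a \<in> carrier S"
  shows "cf (a \<otimes>\<^bsub>S\<^esub> const_series R c) s = cf a s \<otimes> c"
proof -
  have dc: "(d ^^ l) c = \<zero>" if "l > 0" for l
    using that c by (cases l) (simp_all only: funpow_Suc_right o_apply funpow_zero less_irrefl)
  obtain N where N: "\<And>i. i > N \<Longrightarrow> cf a i = \<zero>" using psdo_boundE a by metis
  have "cf (a \<otimes>\<^bsub>S\<^esub> const_series R c) s
      = (\<Oplus>i\<in>insert s {s..N}. \<Oplus>j\<in>{0}. psdo_term s i j (cf a i) (cf (const_series R c) j))"
  proof (rule psdo_mult_coeff)
    fix i j assume *: "s \<le> i + j" "cf (const_series R c) j \<noteq> \<zero>" "cf a i \<noteq> \<zero>"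
    then have "j = 0" by (auto simp: const_series_def split: if_splits)
    moreover have "i \<le> N" using * N by (meson not_le)
    ultimately show "i \<in> insert s {s..N} \<and> j \<in> {0}" using * by auto
  qed (use c a psdo_const_series_closed in auto)
  also have "\<dots> = (\<Oplus>i\<in>insert s {s..N}. psdo_term s i 0 (cf a i) c)"
    using a c by (intro finsum_cong_on) (auto simp: const_series_def finsum_insert)
  also have "\<dots> = psdo_term s s 0 (cf a s) c"
    using a c by (intro finsum_eq_single) (auto simp: psdo_term_def dc)
  finally show ?thesis using a c by (simp add: psdo_term_def)
qed

text \<open>Associativity for the monomials \<^term>\<open>x\<close>, \<^term>\<open>y\<close>, \<^term>\<open>z\<close> in front of powers of the
  derivation symbol: after the Leibniz rule both sides are sums of
  \<^term>\<open>x \<otimes> (d ^^ r) y \<otimes> (d ^^ (t - r)) z\<close>, with the coefficients of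
  \<open>int_binomial_convolution\<close>.\<close>

lemma psdo_term_assoc:
  assumes xyz: "x \<in> carrier R" "y \<in> carrier R" "z \<in> carrier R"
    and fin: "finite U" "finite V" and U: "{s - k..i + j} \<subseteq> U" and V: "{s - i..j + k} \<subseteq> V"
  shows "(\<Oplus>u\<in>U. psdo_term s u k (psdo_term u i j x y) z)
       = (\<Oplus>v\<in>V. psdo_term s i v x (psdo_term v j k y z))"
proof (cases "s \<le> i + j + k")
  case False
  have "psdo_term s u k (psdo_term u i j x y) z = \<zero>" for u
    using False xyz by (cases "u \<le> i + j") (auto simp: psdo_term_def)
  moreover have "psdo_term s i v x (psdo_term v j k y z) = \<zero>" for v
    using False xyz by (cases "v \<le> j + k") (auto simp: psdo_term_def)
  ultimately show ?thesis by (simp add: add.finprod_one_eqI)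
next
  case True
  define t where "t = nat (i + j + k - s)"
  have t: "int t = i + j + k - s" using True by (simp add: t_def)
  let ?X = "\<lambda>r. x \<otimes> ((d ^^ r) y \<otimes> (d ^^ (t - r)) z)"
  let ?B = int_binomial
  have "(\<Oplus>u\<in>U. psdo_term s u k (psdo_term u i j x y) z)
      = (\<Oplus>u\<in>(\<lambda>r. i + j - int r) ` {..t}. psdo_term s u k (psdo_term u i j x y) z)"
  proof (rule finsum_extend[symmetric])
    show "(\<lambda>r. i + j - int r) ` {..t} \<subseteq> U" using U t by auto
    fix u assume "u \<in> U - (\<lambda>r. i + j - int r) ` {..t}"
    then have *: "u \<notin> (\<lambda>r. i + j - int r) ` {..t}" by blast
    show "psdo_term s u k (psdo_term u i j x y) z = \<zero>"
    proof (cases "u \<le> i + j \<and> s \<le> u + k")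
      case True
      then have "u = i + j - int (nat (i + j - u))" "nat (i + j - u) \<le> t" using t by auto
      then show ?thesis using * by blast
    qed (use xyz in \<open>auto simp: psdo_term_def\<close>)
  qed (use xyz fin in auto)
  also have "\<dots> = (\<Oplus>r\<in>{..t}. psdo_term s (i + j - int r) k (psdo_term (i + j - int r) i j x y) z)"
    using xyz by (intro finsum_reindex) (auto simp: inj_on_def)
  also have "\<dots> = (\<Oplus>r\<in>{..t}. [(?B i r * ?B (i + j - int r) (t - r))] \<cdot> ?X r)"
  proof (rule finsum_cong_on)
    fix r assume r: "r \<in> {..t}"
    then have "nat (i + j - int r + k - s) = t - r" "s \<le> i + j - int r + k" using t by auto
    then show "psdo_term s (i + j - int r) k (psdo_term (i + j - int r) i j x y) z
        = [(?B i r * ?B (i + j - int r) (t - r))] \<cdot> ?X r"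
      using xyz r
      by (simp add: psdo_term_def add_pow_ldistr_int add.int_pow_pow m_assoc)
  qed (use xyz in auto)
  also have "\<dots> = (\<Oplus>r\<in>{..t}. [(\<Sum>q\<le>t. ?B i (t - q) * ?B j q * int ((t - q) choose r))] \<cdot> ?X r)"
    using xyz by (intro finsum_cong_on) (auto simp: int_binomial_convolution)
  also have "\<dots> = (\<Oplus>r\<in>{..t}. \<Oplus>q\<in>{..t}. [(?B i (t - q) * ?B j q * int ((t - q) choose r))] \<cdot> ?X r)"
    using xyz by (intro finsum_cong_on) (auto simp: finsum_int_mult)
  also have "\<dots> = (\<Oplus>q\<in>{..t}. \<Oplus>r\<in>{..t}. [(?B i (t - q) * ?B j q * int ((t - q) choose r))] \<cdot> ?X r)"
    using xyz by (intro finsum_swap) auto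
  also have "\<dots> = (\<Oplus>q\<in>{..t}. psdo_term s i (j + k - int q) x (psdo_term (j + k - int q) j k y z))"
  proof (rule finsum_cong_on)
    fix q assume q: "q \<in> {..t}"
    let ?m = "t - q"
    have *: "nat (i + (j + k - int q) - s) = ?m" "s \<le> i + (j + k - int q)" using q t by auto
    have X: "(d ^^ r) y \<otimes> (d ^^ (?m - r)) ((d ^^ q) z) = (d ^^ r) y \<otimes> (d ^^ (t - r)) z"
      if "r \<le> ?m" for r
    proof -
      have "t - r = ?m - r + q" using that q by auto
      then show ?thesis by (simp only: funpow_add o_apply)
    qed
    have "psdo_term s i (j + k - int q) x (psdo_term (j + k - int q) j k y z)
        = [?B i ?m] \<cdot> (x \<otimes> (d ^^ ?m) ([?B j q] \<cdot> (y \<otimes> (d ^^ q) z)))"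
      using * by (simp add: psdo_term_def)
    also have "\<dots> = [(?B i ?m * ?B j q)] \<cdot> (x \<otimes> (d ^^ ?m) (y \<otimes> (d ^^ q) z))"
      using xyz by (simp add: additive_map_add_pow[OF additive_map_funpow[OF additive]]
          add_pow_rdistr_int add.int_pow_pow mult.commute)
    also have "\<dots> = [(?B i ?m * ?B j q)] \<cdot> (x \<otimes>
        (\<Oplus>r\<in>{..t}. [int (?m choose r)] \<cdot> ((d ^^ r) y \<otimes> (d ^^ (?m - r)) ((d ^^ q) z))))"
      using xyz Leibniz[of y "(d ^^ q) z" ?m t] by simp
    also have "\<dots> = [(?B i ?m * ?B j q)] \<cdot> (x \<otimes>
        (\<Oplus>r\<in>{..t}. [int (?m choose r)] \<cdot> ((d ^^ r) y \<otimes> (d ^^ (t - r)) z)))"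
    proof -
      have "[int (?m choose r)] \<cdot> ((d ^^ r) y \<otimes> (d ^^ (?m - r)) ((d ^^ q) z))
          = [int (?m choose r)] \<cdot> ((d ^^ r) y \<otimes> (d ^^ (t - r)) z)" for r
        using X[of r] xyz by (cases "r \<le> ?m") (auto simp: binomial_eq_0 add_pow_int_0)
      then show ?thesis by simp
    qed
    also have "\<dots> = (\<Oplus>r\<in>{..t}. [(?B i ?m * ?B j q)] \<cdot> (x \<otimes> ([int (?m choose r)] \<cdot> ((d ^^ r) y \<otimes> (d ^^ (t - r)) z))))"
      using xyz by (simp add: finsum_rdistr additive_map_finsum[OF additive_map_int_mult])
    also have "\<dots> = (\<Oplus>r\<in>{..t}. [(?B i ?m * ?B j q * int (?m choose r))] \<cdot> ?X r)"
      using xyz by (intro finsum_cong_on) (auto simp: add_pow_rdistr_int add.int_pow_pow mult.commute)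
    finally show "(\<Oplus>r\<in>{..t}. [(?B i ?m * ?B j q * int (?m choose r))] \<cdot> ?X r)
        = psdo_term s i (j + k - int q) x (psdo_term (j + k - int q) j k y z)" ..
  qed (use xyz in auto)
  also have "\<dots> = (\<Oplus>v\<in>(\<lambda>q. j + k - int q) ` {..t}. psdo_term s i v x (psdo_term v j k y z))"
    using xyz by (intro finsum_reindex[symmetric]) (auto simp: inj_on_def)
  also have "\<dots> = (\<Oplus>v\<in>V. psdo_term s i v x (psdo_term v j k y z))"
  proof (rule finsum_extend)
    show "(\<lambda>r. j + k - int r) ` {..t} \<subseteq> V" using V t by auto
    fix v assume "v \<in> V - (\<lambda>r. j + k - int r) ` {..t}"
    then have *: "v \<notin> (\<lambda>r. j + k - int r) ` {..t}" by blast
    show "psdo_term s i v x (psdo_term v j k y z) = \<zero>"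
    proof (cases "v \<le> j + k \<and> s \<le> i + v")
      case True
      then have "v = j + k - int (nat (j + k - v))" "nat (j + k - v) \<le> t" using t by auto
      then show ?thesis using * by blast
    qed (use xyz in \<open>auto simp: psdo_term_def\<close>)
  qed (use xyz fin in auto)
  finally show ?thesis .
qed

lemma finsum_psdo_term_left:
  assumes "finite A" "y \<in> carrier R" "\<And>i. i \<in> A \<Longrightarrow> f i \<in> carrier R"
  shows "psdo_term s u k (finsum R f A) y = (\<Oplus>i\<in>A. psdo_term s u k (f i) y)"
  by (rule additive_map_finsum[OF psdo_term_additive(2)[OF assms(2)] assms(1,3)])

lemma finsum_psdo_term_right:
  assumes "finite A" "x \<in> carrier R" "\<And>i. i \<in> A \<Longrightarrow> f i \<in> carrier R"
  shows "psdo_term s u k x (finsum R f A) = (\<Oplus>i\<in>A. psdo_term s u k x (f i))"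
  by (rule additive_map_finsum[OF psdo_term_additive(1)[OF assms(2)] assms(1,3)])

text \<open>Both triple products are sums over one fourfold box, chosen large enough for all coefficients
  that contribute at \<open>s\<close>; the sums over the inner exponent are compared by \<open>psdo_term_assoc\<close>.\<close>

lemma psdo_mult_assoc:
  assumes abc: "a \<in> carrier S" "b \<in> carrier S" "c \<in> carrier S"
  shows "(a \<otimes>\<^bsub>S\<^esub> b) \<otimes>\<^bsub>S\<^esub> c = a \<otimes>\<^bsub>S\<^esub> (b \<otimes>\<^bsub>S\<^esub> c)"
proof (rule psdo_eqI)
  fix s
  obtain A where A: "\<And>i. i > A \<Longrightarrow> cf a i = \<zero>" using psdo_boundE abc by metis
  obtain B where B: "\<And>i. i > B \<Longrightarrow> cf b i = \<zero>" using psdo_boundE abc by metis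
  obtain C where C: "\<And>i. i > C \<Longrightarrow> cf c i = \<zero>" using psdo_boundE abc by metis
  \<comment> \<open>a coefficient contributes at \<open>s\<close> only if the other two exponents can make up for its own\<close>
  define I where "I = {s - B - C..A}"
  define J where "J = {s - A - C..B}"
  define K where "K = {s - A - B..C}"
  define U where "U = {s - C..A + B}"
  define V where "V = {s - A..B + C}"
  have fin: "finite I" "finite J" "finite K" "finite U" "finite V"
    by (auto simp: I_def J_def K_def U_def V_def)
  have ab: "cf (a \<otimes>\<^bsub>S\<^esub> b) u = (\<Oplus>i\<in>I. \<Oplus>j\<in>J. psdo_term u i j (cf a i) (cf b j))" if "u \<in> U" for u
    using abc A B that by (intro psdo_mult_coeff_bounded) (auto simp: I_def J_def U_def)
  have bc: "cf (b \<otimes>\<^bsub>S\<^esub> c) v = (\<Oplus>j\<in>J. \<Oplus>k\<in>K. psdo_term v j k (cf b j) (cf c k))" if "v \<in> V" for v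
    using abc B C that by (intro psdo_mult_coeff_bounded) (auto simp: K_def J_def V_def)
  have "cf ((a \<otimes>\<^bsub>S\<^esub> b) \<otimes>\<^bsub>S\<^esub> c) s = (\<Oplus>u\<in>U. \<Oplus>k\<in>K. psdo_term s u k (cf (a \<otimes>\<^bsub>S\<^esub> b) u) (cf c k))"
    using abc C psdo_mult_bound[OF abc(1,2) A B] psdo_mult_closed
    by (intro psdo_mult_coeff_bounded[where M = "A + B" and N = C]) (auto simp: U_def K_def)
  also have "\<dots> = (\<Oplus>u\<in>U. \<Oplus>k\<in>K. \<Oplus>i\<in>I. \<Oplus>j\<in>J. psdo_term s u k (psdo_term u i j (cf a i) (cf b j)) (cf c k))"
    using abc fin
    by (intro finsum_cong_on) (auto simp: ab finsum_psdo_term_left intro!: finsum_closed_on)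
  also have "\<dots> = (\<Oplus>k\<in>K. \<Oplus>u\<in>U. \<Oplus>i\<in>I. \<Oplus>j\<in>J. psdo_term s u k (psdo_term u i j (cf a i) (cf b j)) (cf c k))"
    using abc fin by (intro finsum_swap) (auto intro!: finsum_closed_on)
  also have "\<dots> = (\<Oplus>k\<in>K. \<Oplus>i\<in>I. \<Oplus>u\<in>U. \<Oplus>j\<in>J. psdo_term s u k (psdo_term u i j (cf a i) (cf b j)) (cf c k))"
    using abc fin by (intro finsum_cong_on finsum_swap) (auto intro!: finsum_closed_on)
  also have "\<dots> = (\<Oplus>i\<in>I. \<Oplus>k\<in>K. \<Oplus>u\<in>U. \<Oplus>j\<in>J. psdo_term s u k (psdo_term u i j (cf a i) (cf b j)) (cf c k))"
    using abc fin by (intro finsum_swap) (auto intro!: finsum_closed_on)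
  also have "\<dots> = (\<Oplus>i\<in>I. \<Oplus>k\<in>K. \<Oplus>j\<in>J. \<Oplus>u\<in>U. psdo_term s u k (psdo_term u i j (cf a i) (cf b j)) (cf c k))"
    using abc fin by (intro finsum_cong_on finsum_swap) (auto intro!: finsum_closed_on)
  also have "\<dots> = (\<Oplus>i\<in>I. \<Oplus>k\<in>K. \<Oplus>j\<in>J. \<Oplus>v\<in>V. psdo_term s i v (cf a i) (psdo_term v j k (cf b j) (cf c k)))"
    using abc fin
    by (intro finsum_cong_on psdo_term_assoc)
       (auto intro!: finsum_closed_on simp: I_def J_def K_def U_def V_def)
  also have "\<dots> = (\<Oplus>i\<in>I. \<Oplus>k\<in>K. \<Oplus>v\<in>V. \<Oplus>j\<in>J. psdo_term s i v (cf a i) (psdo_term v j k (cf b j) (cf c k)))"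
    using abc fin by (intro finsum_cong_on finsum_swap) (auto intro!: finsum_closed_on)
  also have "\<dots> = (\<Oplus>i\<in>I. \<Oplus>v\<in>V. \<Oplus>k\<in>K. \<Oplus>j\<in>J. psdo_term s i v (cf a i) (psdo_term v j k (cf b j) (cf c k)))"
    using abc fin by (intro finsum_cong_on finsum_swap) (auto intro!: finsum_closed_on)
  also have "\<dots> = (\<Oplus>i\<in>I. \<Oplus>v\<in>V. \<Oplus>j\<in>J. \<Oplus>k\<in>K. psdo_term s i v (cf a i) (psdo_term v j k (cf b j) (cf c k)))"
    using abc fin by (intro finsum_cong_on finsum_swap) (auto intro!: finsum_closed_on)
  also have "\<dots> = (\<Oplus>i\<in>I. \<Oplus>v\<in>V. psdo_term s i v (cf a i) (cf (b \<otimes>\<^bsub>S\<^esub> c) v))"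
    using abc fin
    by (intro finsum_cong_on) (auto simp: bc finsum_psdo_term_right intro!: finsum_closed_on)
  also have "\<dots> = cf (a \<otimes>\<^bsub>S\<^esub> (b \<otimes>\<^bsub>S\<^esub> c)) s"
    using abc A psdo_mult_bound[OF abc(2,3) B C] psdo_mult_closed
    by (intro psdo_mult_coeff_bounded[symmetric, where M = A and N = "B + C"]) (auto simp: I_def V_def)
  finally show "cf ((a \<otimes>\<^bsub>S\<^esub> b) \<otimes>\<^bsub>S\<^esub> c) s = cf (a \<otimes>\<^bsub>S\<^esub> (b \<otimes>\<^bsub>S\<^esub> c)) s" .
qed (use abc psdo_mult_closed in auto)

lemma psdo_distrib:
  assumes abc: "a \<in> carrier S" "b \<in> carrier S" "c \<in> carrier S"
  shows "(a \<oplus>\<^bsub>S\<^esub> b) \<otimes>\<^bsub>S\<^esub> c = a \<otimes>\<^bsub>S\<^esub> c \<oplus>\<^bsub>S\<^esub> b \<otimes>\<^bsub>S\<^esub> c"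
    and "c \<otimes>\<^bsub>S\<^esub> (a \<oplus>\<^bsub>S\<^esub> b) = c \<otimes>\<^bsub>S\<^esub> a \<oplus>\<^bsub>S\<^esub> c \<otimes>\<^bsub>S\<^esub> b"
proof -
  obtain A where A: "\<And>i. i > A \<Longrightarrow> cf a i = \<zero>" using psdo_boundE abc by metis
  obtain B where B: "\<And>i. i > B \<Longrightarrow> cf b i = \<zero>" using psdo_boundE abc by metis
  obtain C where C: "\<And>i. i > C \<Longrightarrow> cf c i = \<zero>" using psdo_boundE abc by metis
  define M where "M = max A B"
  have M: "cf a i = \<zero>" "cf b i = \<zero>" "cf (a \<oplus>\<^bsub>S\<^esub> b) i = \<zero>" if "i > M" for i
    using that A B by (auto simp: M_def psdo_add_coeff)
  show "(a \<oplus>\<^bsub>S\<^esub> b) \<otimes>\<^bsub>S\<^esub> c = a \<otimes>\<^bsub>S\<^esub> c \<oplus>\<^bsub>S\<^esub> b \<otimes>\<^bsub>S\<^esub> c"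
  proof (rule psdo_eqI)
    fix s
    let ?I = "{s - C..M}" and ?J = "{s - M..C}"
    have *: "cf (x \<otimes>\<^bsub>S\<^esub> c) s = (\<Oplus>i\<in>?I. \<Oplus>j\<in>?J. psdo_term s i j (cf x i) (cf c j))"
      if "x \<in> {a, b, a \<oplus>\<^bsub>S\<^esub> b}" for x
      using that M C abc psdo_add_closed by (intro psdo_mult_coeff_bounded) auto
    have "cf ((a \<oplus>\<^bsub>S\<^esub> b) \<otimes>\<^bsub>S\<^esub> c) s
        = (\<Oplus>i\<in>?I. \<Oplus>j\<in>?J. psdo_term s i j (cf a i) (cf c j) \<oplus> psdo_term s i j (cf b i) (cf c j))"
      using psdo_term_additive(2) abc
      by (subst *) (auto simp: psdo_add_coeff additive_map_def intro!: finsum_cong_on finsum_closed_on)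
    also have "\<dots> = cf (a \<otimes>\<^bsub>S\<^esub> c \<oplus>\<^bsub>S\<^esub> b \<otimes>\<^bsub>S\<^esub> c) s"
      using abc by (simp add: * psdo_add_coeff finsum_addf finsum_closed_on Pi_iff)
    finally show "cf ((a \<oplus>\<^bsub>S\<^esub> b) \<otimes>\<^bsub>S\<^esub> c) s = cf (a \<otimes>\<^bsub>S\<^esub> c \<oplus>\<^bsub>S\<^esub> b \<otimes>\<^bsub>S\<^esub> c) s" .
  qed (use abc psdo_mult_closed psdo_add_closed in auto)
  show "c \<otimes>\<^bsub>S\<^esub> (a \<oplus>\<^bsub>S\<^esub> b) = c \<otimes>\<^bsub>S\<^esub> a \<oplus>\<^bsub>S\<^esub> c \<otimes>\<^bsub>S\<^esub> b"
  proof (rule psdo_eqI)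
    fix s
    let ?I = "{s - M..C}" and ?J = "{s - C..M}"
    have *: "cf (c \<otimes>\<^bsub>S\<^esub> x) s = (\<Oplus>i\<in>?I. \<Oplus>j\<in>?J. psdo_term s i j (cf c i) (cf x j))"
      if "x \<in> {a, b, a \<oplus>\<^bsub>S\<^esub> b}" for x
      using that M C abc psdo_add_closed by (intro psdo_mult_coeff_bounded) auto
    have "cf (c \<otimes>\<^bsub>S\<^esub> (a \<oplus>\<^bsub>S\<^esub> b)) s
        = (\<Oplus>i\<in>?I. \<Oplus>j\<in>?J. psdo_term s i j (cf c i) (cf a j) \<oplus> psdo_term s i j (cf c i) (cf b j))"
      using psdo_term_additive(1) abc
      by (subst *) (auto simp: psdo_add_coeff additive_map_def intro!: finsum_cong_on finsum_closed_on)
    also have "\<dots> = cf (c \<otimes>\<^bsub>S\<^esub> a \<oplus>\<^bsub>S\<^esub> c \<otimes>\<^bsub>S\<^esub> b) s"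
      using abc by (simp add: * psdo_add_coeff finsum_addf finsum_closed_on Pi_iff)
    finally show "cf (c \<otimes>\<^bsub>S\<^esub> (a \<oplus>\<^bsub>S\<^esub> b)) s = cf (c \<otimes>\<^bsub>S\<^esub> a \<oplus>\<^bsub>S\<^esub> c \<otimes>\<^bsub>S\<^esub> b) s" .
  qed (use abc psdo_mult_closed psdo_add_closed in auto)
qed

lemma psdo_one: "\<one>\<^bsub>S\<^esub> = const_series R \<one>"
  by (simp add: psdo_def)

lemma psdo_zero_closed: "\<zero>\<^bsub>S\<^esub> \<in> carrier S"
  unfolding psdo_carrier_iff by (simp add: psdo_def)

lemma psdo_ring: "ring S"
proof (rule ringI)
  show "abelian_group S"
  proof (rule abelian_groupI)
    fix a b c assume abc: "a \<in> carrier S" "b \<in> carrier S" "c \<in> carrier S"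
    show "a \<oplus>\<^bsub>S\<^esub> b \<oplus>\<^bsub>S\<^esub> c = a \<oplus>\<^bsub>S\<^esub> (b \<oplus>\<^bsub>S\<^esub> c)"
      by (rule psdo_eqI) (use abc in \<open>auto simp: psdo_add_closed psdo_add_coeff a_assoc\<close>)
  next
    fix a b assume ab: "a \<in> carrier S" "b \<in> carrier S"
    show "a \<oplus>\<^bsub>S\<^esub> b = b \<oplus>\<^bsub>S\<^esub> a"
      by (rule psdo_eqI) (use ab in \<open>auto simp: psdo_add_closed psdo_add_coeff a_comm\<close>)
  next
    fix a assume a: "a \<in> carrier S"
    show "\<zero>\<^bsub>S\<^esub> \<oplus>\<^bsub>S\<^esub> a = a"
      by (rule psdo_eqI)
        (use a psdo_zero_closed in \<open>auto simp: psdo_add_closed psdo_add_coeff psdo_zero_coeff\<close>)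
    let ?m = "Ser (\<lambda>i. \<ominus> cf a i)"
    obtain N where "\<And>i. i > N \<Longrightarrow> cf a i = \<zero>" using psdo_boundE a by metis
    then have m: "?m \<in> carrier S"
      unfolding psdo_carrier_iff using a by (auto intro!: exI[of _ N])
    have "?m \<oplus>\<^bsub>S\<^esub> a = \<zero>\<^bsub>S\<^esub>"
      by (rule psdo_eqI)
        (use a psdo_zero_closed m in
          \<open>auto simp: psdo_add_closed psdo_add_coeff psdo_zero_coeff l_neg\<close>)
    then show "\<exists>b \<in> carrier S. b \<oplus>\<^bsub>S\<^esub> a = \<zero>\<^bsub>S\<^esub>" using m by blast
  qed (auto simp: psdo_add_closed psdo_zero_closed)
  show "monoid S"
  proof (rule monoidI)
    fix a assume a: "a \<in> carrier S"
    show "\<one>\<^bsub>S\<^esub> \<otimes>\<^bsub>S\<^esub> a = a"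
      by (rule psdo_eqI)
        (use a in \<open>auto simp: psdo_one psdo_mult_closed psdo_const_series_closed psdo_const_mult\<close>)
    show "a \<otimes>\<^bsub>S\<^esub> \<one>\<^bsub>S\<^esub> = a"
      by (rule psdo_eqI)
        (use a in \<open>auto simp: psdo_one psdo_mult_closed psdo_const_series_closed psdo_mult_const\<close>)
  qed (auto simp: psdo_mult_closed psdo_mult_assoc psdo_one psdo_const_series_closed)
qed (auto simp: psdo_distrib)

text \<open>Commutation with \<open>d\<close> is needed because the product differentiates the right factor with \<open>d\<close>;
  through the integer factors \<open>D\<close> passes because it is additive.\<close>

lemma psdo_coeffwise_derivation:
  assumes D: "derivation R D" and comm: "\<And>x. x \<in> carrier R \<Longrightarrow> D (d x) = d (D x)"
  shows "derivation S (coeffwise D)"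
proof -
  interpret D: differential_ring R D using D by unfold_locales
  have commpow: "D ((d ^^ l) x) = (d ^^ l) (D x)" if "x \<in> carrier R" for l x
    using that comm by (induction l) auto
  have D0: "D \<zero> = \<zero>" by (rule additive_map_zero[OF D.additive])
  have cf: "cf (coeffwise D a) i = D (cf a i)" for a i by (simp add: coeffwise_def)
  have closed: "coeffwise D a \<in> carrier S" if "a \<in> carrier S" for a
  proof -
    obtain N where N: "\<And>i. i > N \<Longrightarrow> cf a i = \<zero>" using \<open>a \<in> carrier S\<close> by (rule psdo_boundE) blast
    have "\<forall>i>N. cf (coeffwise D a) i = \<zero>" by (simp add: cf N D0)
    moreover have "\<forall>i. cf (coeffwise D a) i \<in> carrier R" using that by (simp add: cf)
    moreover have "\<not> is_Const (coeffwise D a)" by (simp add: coeffwise_def)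
    ultimately show ?thesis unfolding psdo_carrier_iff by blast
  qed
  have "coeffwise D (a \<oplus>\<^bsub>S\<^esub> b) = coeffwise D a \<oplus>\<^bsub>S\<^esub> coeffwise D b"
    if "a \<in> carrier S" "b \<in> carrier S" for a b
    by (rule psdo_eqI)
      (use that D.additive in \<open>auto simp: cf closed psdo_add_closed psdo_add_coeff additive_map_def\<close>)
  then have "additive_map S (coeffwise D)"
    unfolding additive_map_def using closed by blast
  moreover have "coeffwise D (a \<otimes>\<^bsub>S\<^esub> b) = coeffwise D a \<otimes>\<^bsub>S\<^esub> b \<oplus>\<^bsub>S\<^esub> a \<otimes>\<^bsub>S\<^esub> coeffwise D b"
    if ab: "a \<in> carrier S" "b \<in> carrier S" for a b
  proof (rule psdo_eqI)
    fix s
    obtain M where M: "\<And>i. i > M \<Longrightarrow> cf a i = \<zero>" using psdo_boundE ab by metis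
    obtain N where N: "\<And>i. i > N \<Longrightarrow> cf b i = \<zero>" using psdo_boundE ab by metis
    let ?I = "{s - N..M}" and ?J = "{s - M..N}"
    have *: "cf (x \<otimes>\<^bsub>S\<^esub> y) s = (\<Oplus>i\<in>?I. \<Oplus>j\<in>?J. psdo_term s i j (cf x i) (cf y j))"
      if "x \<in> {a, coeffwise D a}" "y \<in> {b, coeffwise D b}" for x y
      using that M N ab closed
      by (intro psdo_mult_coeff_bounded) (auto simp: cf D0)
    have D_term: "D (psdo_term s i j x y) = psdo_term s i j (D x) y \<oplus> psdo_term s i j x (D y)"
      if "x \<in> carrier R" "y \<in> carrier R" for i j x y
      using that D unfolding psdo_term_def derivation_def
      by (simp add: D0 additive_map_add_pow[OF D.additive] add.int_pow_distrib commpow)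
    have "cf (coeffwise D (a \<otimes>\<^bsub>S\<^esub> b)) s
        = (\<Oplus>i\<in>?I. \<Oplus>j\<in>?J. psdo_term s i j (D (cf a i)) (cf b j) \<oplus> psdo_term s i j (cf a i) (D (cf b j)))"
      using ab
      by (simp add: cf * additive_map_finsum[OF D.additive] finsum_closed_on D_term)
    also have "\<dots> = cf (coeffwise D a \<otimes>\<^bsub>S\<^esub> b \<oplus>\<^bsub>S\<^esub> a \<otimes>\<^bsub>S\<^esub> coeffwise D b) s"
      using ab by (simp add: * psdo_add_coeff finsum_addf finsum_closed_on Pi_iff cf)
    finally show "cf (coeffwise D (a \<otimes>\<^bsub>S\<^esub> b)) s
        = cf (coeffwise D a \<otimes>\<^bsub>S\<^esub> b \<oplus>\<^bsub>S\<^esub> a \<otimes>\<^bsub>S\<^esub> coeffwise D b) s" .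
  qed (use ab closed psdo_mult_closed psdo_add_closed in auto)
  ultimately show ?thesis by (simp add: derivation_def)
qed

end

section \<open>Laurent and power series\<close>

text \<open>Laurent series are bounded below and pseudo-differential series above; replacing \<open>i\<close> by \<open>-i\<close>
  turns the former into the latter for the zero derivation.\<close>

definition reflect :: "'k ser \<Rightarrow> 'k ser" where
  "reflect a = Ser (\<lambda>i. cf a (- i))"

lemma cf_reflect [simp]: "cf (reflect a) i = cf a (- i)"
  by (simp add: reflect_def)

lemma coeffwise_reflect: "coeffwise D (reflect a) = reflect (coeffwise D a)"
  by (simp add: coeffwise_def reflect_def)

lemma derivation_restrict:
  assumes "derivation R d" "H \<subseteq> carrier R" "\<And>x. x \<in> H \<Longrightarrow> d x \<in> H"
  shows "derivation (R\<lparr>carrier := H\<rparr>) d"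
  using assms unfolding derivation_def additive_map_def by (simp add: subset_iff)

locale laurent_coeffs = ring R for R :: "'k ser ring" (structure)
begin

abbreviation L where "L \<equiv> laurent R"
text \<open>A constant of its own: for an abstraction, the closure rules of derivations would apply to every
  occurrence of \<open>\<zero>\<close>.\<close>

definition zero_deriv :: "'k ser \<Rightarrow> 'k ser" where "zero_deriv x = \<zero>"

abbreviation S where "S \<equiv> psdo R zero_deriv"

sublocale flat: psdo_coeffs R zero_deriv
  by unfold_locales (simp add: derivation_def additive_map_def zero_deriv_def)

lemma laurent_carrier_iff:
  "a \<in> carrier L \<longleftrightarrow> \<not> is_Const a \<and> (\<forall>i. cf a i \<in> carrier R) \<and> (\<exists>N. \<forall>i<N. cf a i = \<zero>)"
  unfolding laurent_def by (cases a) simp_all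

lemma reflect_carrier_psdo:
  assumes "a \<in> carrier L"
  shows "reflect a \<in> carrier S"
proof -
  obtain N where N: "\<forall>i<N. cf a i = \<zero>" using assms unfolding laurent_carrier_iff by blast
  have "\<forall>i>- N. cf (reflect a) i = \<zero>" using N by simp
  moreover have "\<forall>i. cf (reflect a) i \<in> carrier R" using assms by (simp add: laurent_carrier_iff)
  moreover have "\<not> is_Const (reflect a)" by (simp add: reflect_def)
  ultimately show ?thesis unfolding flat.psdo_carrier_iff by blast
qed

lemma reflect_carrier_laurent:
  assumes "a \<in> carrier S"
  shows "reflect a \<in> carrier L"
proof -
  obtain N where N: "\<forall>i>N. cf a i = \<zero>" using assms unfolding flat.psdo_carrier_iff by blast
  have "\<forall>i. i < - N \<longrightarrow> cf (reflect a) i = \<zero>" using N by simp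
  moreover have "\<forall>i. cf (reflect a) i \<in> carrier R" using assms by simp
  moreover have "\<not> is_Const (reflect a)" by (simp add: reflect_def)
  ultimately show ?thesis unfolding laurent_carrier_iff by blast
qed

lemma reflect_reflect:
  "a \<in> carrier L \<Longrightarrow> reflect (reflect a) = a" "a \<in> carrier S \<Longrightarrow> reflect (reflect a) = a"
  unfolding laurent_carrier_iff flat.psdo_carrier_iff reflect_def by (cases a; simp)+

lemma laurent_cf_closed [simp]: "a \<in> carrier L \<Longrightarrow> cf a i \<in> carrier R"
  by (simp add: laurent_carrier_iff)

lemma laurent_boundE:
  assumes "a \<in> carrier L"
  obtains N where "\<And>i. i < N \<Longrightarrow> cf a i = \<zero>"
  using assms unfolding laurent_carrier_iff by blast

lemma laurent_eqI:
  assumes "a \<in> carrier L" "b \<in> carrier L" "\<And>i. cf a i = cf b i"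
  shows "a = b"
  using assms unfolding laurent_carrier_iff by (intro ser.expand) auto

text \<open>As for pseudo-differential series, the range of summation may be any finite set that
  contains the nonvanishing products.\<close>

lemma laurent_mult_coeff:
  assumes ab: "a \<in> carrier L" "b \<in> carrier L" and "finite I"
    and I: "\<And>i. cf a i \<noteq> \<zero> \<Longrightarrow> cf b (s - i) \<noteq> \<zero> \<Longrightarrow> i \<in> I"
  shows "cf (a \<otimes>\<^bsub>L\<^esub> b) s = (\<Oplus>i\<in>I. cf a i \<otimes> cf b (s - i))"
proof -
  let ?g = "\<lambda>(i, j). cf a i \<otimes> cf b j" and ?h = "\<lambda>i. (i, s - i)"
  let ?Y = "{i. cf a i \<noteq> \<zero> \<and> cf b (s - i) \<noteq> \<zero>}"
  have img: "{(i, j). i + j = s \<and> cf a i \<noteq> \<zero> \<and> cf b j \<noteq> \<zero>} = ?h ` ?Y"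
    by (auto simp: image_iff)
  have "cf (a \<otimes>\<^bsub>L\<^esub> b) s = finsum R ?g (?h ` ?Y)"
    by (simp add: laurent_def img)
  also have "\<dots> = (\<Oplus>i\<in>?Y. ?g (?h i))"
    using ab by (intro finsum_reindex) (auto simp: inj_on_def)
  also have "\<dots> = (\<Oplus>i\<in>?Y. cf a i \<otimes> cf b (s - i))" by simp
  also have "\<dots> = (\<Oplus>i\<in>I. cf a i \<otimes> cf b (s - i))"
  proof (rule finsum_extend)
    show "?Y \<subseteq> I" using I by auto
  qed (use ab \<open>finite I\<close> in auto)
  finally show ?thesis .
qed

lemma laurent_mult_coeff_bounded:
  assumes "a \<in> carrier L" "b \<in> carrier L" "finite I"
    and "\<And>i. i < M \<Longrightarrow> cf a i = \<zero>" "\<And>j. j < N \<Longrightarrow> cf b j = \<zero>" "{M..s - N} \<subseteq> I"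
  shows "cf (a \<otimes>\<^bsub>L\<^esub> b) s = (\<Oplus>i\<in>I. cf a i \<otimes> cf b (s - i))"
proof (rule laurent_mult_coeff)
  fix i assume "cf a i \<noteq> \<zero>" "cf b (s - i) \<noteq> \<zero>"
  then have "M \<le> i" "N \<le> s - i" using assms(4,5) by (meson not_le)+
  then have "i \<in> {M..s - N}" by auto
  then show "i \<in> I" using assms(6) by blast
qed (use assms in auto)

text \<open>With the zero derivation every contribution with \<open>i + j \<noteq> s\<close> vanishes, and the double sum
  collapses to the convolution of Laurent series.\<close>

lemma reflect_mult:
  assumes ab: "a \<in> carrier S" "b \<in> carrier S"
  shows "reflect (a \<otimes>\<^bsub>S\<^esub> b) = reflect a \<otimes>\<^bsub>L\<^esub> reflect b"
proof -
  obtain M where M: "\<And>i. i > M \<Longrightarrow> cf a i = \<zero>" using ab(1) by (rule flat.psdo_boundE) blast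
  obtain N where N: "\<And>i. i > N \<Longrightarrow> cf b i = \<zero>" using ab(2) by (rule flat.psdo_boundE) blast
  have "cf (a \<otimes>\<^bsub>S\<^esub> b) (- s) = cf (reflect a \<otimes>\<^bsub>L\<^esub> reflect b) s" for s
  proof -
    let ?I = "{- s - N..M}" and ?J = "{- s - M..N}"
    have "cf (a \<otimes>\<^bsub>S\<^esub> b) (- s) = (\<Oplus>i\<in>?I. \<Oplus>j\<in>?J. flat.psdo_term (- s) i j (cf a i) (cf b j))"
      using ab M N by (intro flat.psdo_mult_coeff_bounded) auto
    also have "\<dots> = (\<Oplus>i\<in>?I. cf a i \<otimes> cf b (- s - i))"
    proof (rule finsum_cong_on)
      fix i assume i: "i \<in> ?I"
      have "(\<Oplus>j\<in>?J. flat.psdo_term (- s) i j (cf a i) (cf b j))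
          = flat.psdo_term (- s) i (- s - i) (cf a i) (cf b (- s - i))"
      proof (rule finsum_eq_single)
        fix j assume "j \<noteq> - s - i"
        then show "flat.psdo_term (- s) i j (cf a i) (cf b j) = \<zero>"
          using ab by (cases "nat (i + j + s)") (auto simp: flat.psdo_term_def zero_deriv_def)
      qed (use ab i in auto)
      then show "(\<Oplus>j\<in>?J. flat.psdo_term (- s) i j (cf a i) (cf b j)) = cf a i \<otimes> cf b (- s - i)"
        using ab by (simp add: flat.psdo_term_def)
    qed (use ab in auto)
    also have "\<dots> = (\<Oplus>i\<in>?I. cf (reflect a) (- i) \<otimes> cf (reflect b) (s - (- i)))"
    proof -
      have "- (s - - i) = - s - i" for i :: int by simp
      then show ?thesis by (simp only: cf_reflect) simp
    qed
    also have "\<dots> = (\<Oplus>i\<in>uminus ` ?I. cf (reflect a) i \<otimes> cf (reflect b) (s - i))"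
      using ab by (intro finsum_reindex[symmetric]) auto
    also have "\<dots> = cf (reflect a \<otimes>\<^bsub>L\<^esub> reflect b) s"
      using ab M N
      by (intro laurent_mult_coeff_bounded[symmetric, where M = "- M" and N = "- N"])
         (auto simp: reflect_carrier_laurent)
    finally show ?thesis .
  qed
  then show ?thesis unfolding reflect_def by (simp add: laurent_def)
qed

lemma laurent_mult_reflect:
  assumes "a \<in> carrier L" "b \<in> carrier L"
  shows "a \<otimes>\<^bsub>L\<^esub> b = reflect (reflect a \<otimes>\<^bsub>S\<^esub> reflect b)"
  using reflect_mult[of "reflect a" "reflect b"] assms
  by (simp add: reflect_carrier_psdo reflect_reflect)

lemma laurent_ring: "ring L"
proof -
  interpret S: ring S by (rule flat.psdo_ring)
  have "reflect \<in> ring_iso S L"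
  proof (rule ring_iso_memI)
    show "bij_betw reflect (carrier S) (carrier L)"
      by (rule bij_betwI[where g = reflect])
         (auto simp: reflect_carrier_laurent reflect_carrier_psdo reflect_reflect)
    show "reflect \<one>\<^bsub>S\<^esub> = \<one>\<^bsub>L\<^esub>"
      by (auto simp: reflect_def psdo_def laurent_def const_series_def)
    show "reflect (a \<oplus>\<^bsub>S\<^esub> b) = reflect a \<oplus>\<^bsub>L\<^esub> reflect b" for a b
      by (simp add: reflect_def psdo_def laurent_def)
  qed (auto simp: reflect_carrier_laurent reflect_mult)
  then have "ring (L\<lparr>zero := reflect \<zero>\<^bsub>S\<^esub>\<rparr>)"
    by (rule S.ring_iso_imp_img_ring)
  moreover have "L\<lparr>zero := reflect \<zero>\<^bsub>S\<^esub>\<rparr> = L"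
    by (simp add: laurent_def psdo_def reflect_def)
  ultimately show ?thesis by simp
qed

lemma laurent_add_coeff: "cf (a \<oplus>\<^bsub>L\<^esub> b) i = cf a i \<oplus> cf b i"
  by (simp add: laurent_def)

lemma laurent_zero_coeff: "cf \<zero>\<^bsub>L\<^esub> i = \<zero>"
  by (simp add: laurent_def)

lemma laurent_one: "\<one>\<^bsub>L\<^esub> = const_series R \<one>"
  by (simp add: laurent_def)

lemma laurent_mult_top:
  assumes ab: "a \<in> carrier L" "b \<in> carrier L"
    and M: "\<And>i. i < M \<Longrightarrow> cf a i = \<zero>" and N: "\<And>i. i < N \<Longrightarrow> cf b i = \<zero>"
  shows "cf (a \<otimes>\<^bsub>L\<^esub> b) (M + N) = cf a M \<otimes> cf b N"
    and "s < M + N \<Longrightarrow> cf (a \<otimes>\<^bsub>L\<^esub> b) s = \<zero>"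
proof -
  have "cf (a \<otimes>\<^bsub>L\<^esub> b) (M + N) = (\<Oplus>i\<in>{M}. cf a i \<otimes> cf b (M + N - i))"
    using assms by (intro laurent_mult_coeff_bounded) auto
  then show "cf (a \<otimes>\<^bsub>L\<^esub> b) (M + N) = cf a M \<otimes> cf b N"
    using ab by (simp add: finsum_insert)
  show "cf (a \<otimes>\<^bsub>L\<^esub> b) s = \<zero>" if "s < M + N"
  proof -
    have "cf (a \<otimes>\<^bsub>L\<^esub> b) s = (\<Oplus>i\<in>{}. cf a i \<otimes> cf b (s - i))"
      using assms that by (intro laurent_mult_coeff_bounded) auto
    then show ?thesis by simp
  qed
qed

lemma laurent_const_series_closed: "c \<in> carrier R \<Longrightarrow> const_series R c \<in> carrier L"
  unfolding laurent_carrier_iff const_series_def by (auto intro!: exI[of _ 0])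

lemma laurent_const_mult:
  assumes "c \<in> carrier R" "a \<in> carrier L"
  shows "cf (const_series R c \<otimes>\<^bsub>L\<^esub> a) s = c \<otimes> cf a s"
proof -
  have "cf (const_series R c \<otimes>\<^bsub>L\<^esub> a) s = (\<Oplus>i\<in>{0}. cf (const_series R c) i \<otimes> cf a (s - i))"
    using assms laurent_const_series_closed
    by (intro laurent_mult_coeff) (auto simp: const_series_def split: if_splits)
  then show ?thesis using assms by (simp add: finsum_insert const_series_def)
qed

lemma laurent_mult_const:
  assumes "c \<in> carrier R" "a \<in> carrier L"
  shows "cf (a \<otimes>\<^bsub>L\<^esub> const_series R c) s = cf a s \<otimes> c"
proof -
  have "cf (a \<otimes>\<^bsub>L\<^esub> const_series R c) s = (\<Oplus>i\<in>{s}. cf a i \<otimes> cf (const_series R c) (s - i))"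
    using assms laurent_const_series_closed
    by (intro laurent_mult_coeff) (auto simp: const_series_def split: if_splits)
  then show ?thesis using assms by (simp add: finsum_insert const_series_def)
qed

lemma laurent_commutative:
  assumes comm: "\<And>x y. x \<in> carrier R \<Longrightarrow> y \<in> carrier R \<Longrightarrow> x \<otimes> y = y \<otimes> x"
    and ab: "a \<in> carrier L" "b \<in> carrier L"
  shows "a \<otimes>\<^bsub>L\<^esub> b = b \<otimes>\<^bsub>L\<^esub> a"
proof (rule laurent_eqI)
  interpret L: ring L by (rule laurent_ring)
  show "a \<otimes>\<^bsub>L\<^esub> b \<in> carrier L" "b \<otimes>\<^bsub>L\<^esub> a \<in> carrier L" using ab by auto
  fix s
  obtain M where M: "\<And>i. i < M \<Longrightarrow> cf a i = \<zero>" using ab(1) by (rule laurent_boundE) blast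
  obtain N where N: "\<And>i. i < N \<Longrightarrow> cf b i = \<zero>" using ab(2) by (rule laurent_boundE) blast
  have "cf (a \<otimes>\<^bsub>L\<^esub> b) s = (\<Oplus>i\<in>{M..s - N}. cf a i \<otimes> cf b (s - i))"
    using ab M N by (intro laurent_mult_coeff_bounded) auto
  also have "\<dots> = (\<Oplus>i\<in>{M..s - N}. cf b (s - i) \<otimes> cf a (s - (s - i)))"
    using ab by (intro finsum_cong_on) (auto simp: comm)
  also have "\<dots> = (\<Oplus>i\<in>(\<lambda>i. s - i) ` {M..s - N}. cf b i \<otimes> cf a (s - i))"
    using ab by (intro finsum_reindex[symmetric]) (auto simp: inj_on_def)
  also have "\<dots> = cf (b \<otimes>\<^bsub>L\<^esub> a) s"
    using ab M N
    by (intro laurent_mult_coeff_bounded[symmetric, where M = N and N = M])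
       (auto simp: image_iff intro!: bexI[of _ "s - _"])
  finally show "cf (a \<otimes>\<^bsub>L\<^esub> b) s = cf (b \<otimes>\<^bsub>L\<^esub> a) s" .
qed

lemma laurent_coeffwise_derivation:
  assumes D: "derivation R D"
  shows "derivation L (coeffwise D)"
proof -
  interpret S: ring S by (rule flat.psdo_ring)
  have D0: "D \<zero> = \<zero>" using D by (auto simp: derivation_def intro: additive_map_zero)
  have der: "derivation S (coeffwise D)"
    using D D0 by (intro flat.psdo_coeffwise_derivation) (auto simp: zero_deriv_def)
  have cw: "coeffwise D a = reflect (coeffwise D (reflect a))" if "a \<in> carrier L" for a
    using that by (metis coeffwise_reflect reflect_reflect(1))
  have closed: "coeffwise D (reflect a) \<in> carrier S" if "a \<in> carrier L" for a
    using that der reflect_carrier_psdo by (simp add: derivation_def additive_map_def)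
  have add: "reflect (x \<oplus>\<^bsub>S\<^esub> y) = reflect x \<oplus>\<^bsub>L\<^esub> reflect y"
    and add': "reflect (x \<oplus>\<^bsub>L\<^esub> y) = reflect x \<oplus>\<^bsub>S\<^esub> reflect y" for x y
    by (simp_all add: reflect_def psdo_def laurent_def)
  interpret L: ring L by (rule laurent_ring)
  show ?thesis
    unfolding derivation_def additive_map_def
  proof (intro conjI ballI)
    fix a assume a: "a \<in> carrier L"
    show "coeffwise D a \<in> carrier L"
      using cw[OF a] closed[OF a] reflect_carrier_laurent by metis
    fix b assume b: "b \<in> carrier L"
    show "coeffwise D (a \<oplus>\<^bsub>L\<^esub> b) = coeffwise D a \<oplus>\<^bsub>L\<^esub> coeffwise D b"
      using D a b by (simp add: coeffwise_def laurent_def derivation_def additive_map_def laurent_cf_closed[unfolded laurent_def])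
    have "coeffwise D (a \<otimes>\<^bsub>L\<^esub> b) = reflect (coeffwise D (reflect a \<otimes>\<^bsub>S\<^esub> reflect b))"
      using a b by (simp add: laurent_mult_reflect coeffwise_reflect)
    also have "\<dots> = reflect (coeffwise D (reflect a) \<otimes>\<^bsub>S\<^esub> reflect b \<oplus>\<^bsub>S\<^esub> reflect a \<otimes>\<^bsub>S\<^esub> coeffwise D (reflect b))"
      using der a b reflect_carrier_psdo by (simp add: derivation_def)
    also have "\<dots> = coeffwise D a \<otimes>\<^bsub>L\<^esub> b \<oplus>\<^bsub>L\<^esub> a \<otimes>\<^bsub>L\<^esub> coeffwise D b"
      using a b closed reflect_carrier_psdo
      by (simp add: add reflect_mult cw[symmetric] reflect_reflect)
    finally show "coeffwise D (a \<otimes>\<^bsub>L\<^esub> b) = coeffwise D a \<otimes>\<^bsub>L\<^esub> b \<oplus>\<^bsub>L\<^esub> a \<otimes>\<^bsub>L\<^esub> coeffwise D b" .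
  qed
qed

lemma cf_xderiv: "cf (xderiv R a) i = [(i + 1)] \<cdot> cf a (i + 1)"
  by (simp add: xderiv_def)

lemma xderiv_vanishes:
  assumes "a \<in> carrier L" "\<And>i. i < N \<Longrightarrow> cf a i = \<zero>" "i < N - 1"
  shows "cf (xderiv R a) i = \<zero>"
  using assms by (simp add: cf_xderiv)

lemma xderiv_closed: "a \<in> carrier L \<Longrightarrow> xderiv R a \<in> carrier L"
proof -
  assume a: "a \<in> carrier L"
  then obtain N where "\<And>i. i < N \<Longrightarrow> cf a i = \<zero>" by (rule laurent_boundE) blast
  then have "\<forall>i < N - 1. cf (xderiv R a) i = \<zero>" using xderiv_vanishes[OF a] by blast
  moreover have "\<forall>i. cf (xderiv R a) i \<in> carrier R" using a by (simp add: cf_xderiv)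
  moreover have "\<not> is_Const (xderiv R a)" by (simp add: xderiv_def)
  ultimately show ?thesis unfolding laurent_carrier_iff by blast
qed

text \<open>The coefficient at \<open>s\<close> of each product is a sum of \<open>cf a i \<otimes> cf b (s + 1 - i)\<close> with integer
  factors, and \<open>s + 1 = i + (s + 1 - i)\<close>.\<close>

lemma xderiv_derivation: "derivation L (xderiv R)"
proof -
  interpret L: ring L by (rule laurent_ring)
  show ?thesis
    unfolding derivation_def additive_map_def
  proof (intro conjI ballI)
    fix a assume a: "a \<in> carrier L"
    show "xderiv R a \<in> carrier L" using a by (rule xderiv_closed)
    fix b assume b: "b \<in> carrier L"
    show "xderiv R (a \<oplus>\<^bsub>L\<^esub> b) = xderiv R a \<oplus>\<^bsub>L\<^esub> xderiv R b"
      by (rule laurent_eqI)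
        (use a b in \<open>auto simp: xderiv_closed cf_xderiv laurent_add_coeff add.int_pow_distrib\<close>)
    show "xderiv R (a \<otimes>\<^bsub>L\<^esub> b) = xderiv R a \<otimes>\<^bsub>L\<^esub> b \<oplus>\<^bsub>L\<^esub> a \<otimes>\<^bsub>L\<^esub> xderiv R b"
    proof (rule laurent_eqI)
      fix s
      obtain M where M: "\<And>i. i < M \<Longrightarrow> cf a i = \<zero>" using a by (rule laurent_boundE) blast
      obtain N where N: "\<And>i. i < N \<Longrightarrow> cf b i = \<zero>" using b by (rule laurent_boundE) blast
      let ?I = "{M..s + 1 - N}" and ?t = "\<lambda>i. cf a i \<otimes> cf b (s + 1 - i)"
      have "cf (xderiv R a \<otimes>\<^bsub>L\<^esub> b) s = (\<Oplus>i\<in>{M - 1..s - N}. cf (xderiv R a) i \<otimes> cf b (s - i))"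
        using a b M N xderiv_closed xderiv_vanishes[OF a M]
        by (intro laurent_mult_coeff_bounded[where M = "M - 1" and N = N]) auto
      also have "\<dots> = (\<Oplus>i\<in>{M - 1..s - N}. [(i + 1)] \<cdot> ?t (i + 1))"
        using a b by (intro finsum_cong_on) (auto simp: cf_xderiv add_pow_ldistr_int)
      also have "\<dots> = (\<Oplus>i\<in>(\<lambda>i. i + 1) ` {M - 1..s - N}. [i] \<cdot> ?t i)"
        using a b by (intro finsum_reindex[symmetric]) auto
      also have "(\<lambda>i. i + 1) ` {M - 1..s - N} = ?I"
        by (subst image_add_atLeastAtMost') (simp add: algebra_simps)
      finally have 1: "cf (xderiv R a \<otimes>\<^bsub>L\<^esub> b) s = (\<Oplus>i\<in>?I. [i] \<cdot> ?t i)" .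
      have "cf (a \<otimes>\<^bsub>L\<^esub> xderiv R b) s = (\<Oplus>i\<in>?I. cf a i \<otimes> cf (xderiv R b) (s - i))"
        using a b M N xderiv_closed xderiv_vanishes[OF b N]
        by (intro laurent_mult_coeff_bounded[where M = M and N = "N - 1"]) auto
      also have "\<dots> = (\<Oplus>i\<in>?I. [(s + 1 - i)] \<cdot> ?t i)"
        using a b by (intro finsum_cong_on) (auto simp: cf_xderiv add_pow_rdistr_int algebra_simps)
      finally have 2: "cf (a \<otimes>\<^bsub>L\<^esub> xderiv R b) s = (\<Oplus>i\<in>?I. [(s + 1 - i)] \<cdot> ?t i)" .
      have "cf (xderiv R (a \<otimes>\<^bsub>L\<^esub> b)) s = [(s + 1)] \<cdot> (\<Oplus>i\<in>?I. ?t i)"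
        using a b M N by (simp add: cf_xderiv laurent_mult_coeff_bounded[where M = M and N = N and I = ?I])
      also have "\<dots> = (\<Oplus>i\<in>?I. [(s + 1)] \<cdot> ?t i)"
        using a b by (intro additive_map_finsum[OF additive_map_int_mult]) auto
      also have "\<dots> = (\<Oplus>i\<in>?I. [i] \<cdot> ?t i \<oplus> [(s + 1 - i)] \<cdot> ?t i)"
        using a b by (intro finsum_cong_on) (auto simp: add.int_pow_mult[symmetric])
      also have "\<dots> = (\<Oplus>i\<in>?I. [i] \<cdot> ?t i) \<oplus> (\<Oplus>i\<in>?I. [(s + 1 - i)] \<cdot> ?t i)"
        using a b by (intro finsum_addf) auto
      finally show "cf (xderiv R (a \<otimes>\<^bsub>L\<^esub> b)) s = cf (xderiv R a \<otimes>\<^bsub>L\<^esub> b \<oplus>\<^bsub>L\<^esub> a \<otimes>\<^bsub>L\<^esub> xderiv R b) s"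
        by (simp add: laurent_add_coeff 1 2)
    qed (use a b xderiv_closed in auto)
  qed
qed

lemma xderiv_coeffwise_commute:
  assumes "additive_map R D" "a \<in> carrier L"
  shows "xderiv R (coeffwise D a) = coeffwise D (xderiv R a)"
  using assms by (simp add: xderiv_def coeffwise_def additive_map_add_pow)

lemma powser_carrier_iff:
  "a \<in> carrier (powser R) \<longleftrightarrow> a \<in> carrier L \<and> (\<forall>i<0. cf a i = \<zero>)"
  unfolding powser_def laurent_def by auto

lemma powser_eq: "powser R = L\<lparr>carrier := carrier (powser R)\<rparr>"
  by (simp add: powser_def)

lemma powser_subset: "carrier (powser R) \<subseteq> carrier L"
  using powser_carrier_iff by blast

lemma powser_ring: "ring (powser R)"
proof -
  interpret L: ring L by (rule laurent_ring)
  have "subring (carrier (powser R)) L"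
  proof (rule L.subringI)
    show "\<one>\<^bsub>L\<^esub> \<in> carrier (powser R)"
      unfolding powser_carrier_iff by (auto simp: laurent_one const_series_def[of R] intro: laurent_const_series_closed[unfolded const_series_def])
    fix a assume "a \<in> carrier (powser R)"
    then have a: "a \<in> carrier L" "\<And>i. i < 0 \<Longrightarrow> cf a i = \<zero>" by (auto simp: powser_carrier_iff)
    have "cf (\<ominus>\<^bsub>L\<^esub> a) i = \<zero>" if "i < 0" for i
      using laurent_add_coeff[of "\<ominus>\<^bsub>L\<^esub> a" a i] a that L.l_neg[OF a(1)]
      by (simp add: laurent_zero_coeff)
    then show "\<ominus>\<^bsub>L\<^esub> a \<in> carrier (powser R)" using a by (simp add: powser_carrier_iff)
    fix b assume "b \<in> carrier (powser R)"
    then have b: "b \<in> carrier L" "\<And>i. i < 0 \<Longrightarrow> cf b i = \<zero>" by (auto simp: powser_carrier_iff)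
    show "a \<oplus>\<^bsub>L\<^esub> b \<in> carrier (powser R)"
      using a b by (simp add: powser_carrier_iff laurent_add_coeff)
    show "a \<otimes>\<^bsub>L\<^esub> b \<in> carrier (powser R)"
      using a b laurent_mult_top(2)[of a b 0 0] by (simp add: powser_carrier_iff)
  qed (rule powser_subset)
  then have "ring (L\<lparr>carrier := carrier (powser R)\<rparr>)" by (rule L.subring_is_ring)
  then show ?thesis by (simp only: powser_eq[symmetric])
qed

lemma powser_coeffwise_derivation:
  assumes D: "derivation R D"
  shows "derivation (powser R) (coeffwise D)"
proof (subst powser_eq, rule derivation_restrict)
  show der: "derivation L (coeffwise D)" using D by (rule laurent_coeffwise_derivation)
  fix a assume a: "a \<in> carrier (powser R)"
  have D0: "D \<zero> = \<zero>" using D by (auto simp: derivation_def intro: additive_map_zero)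
  have "cf (coeffwise D a) i = \<zero>" if "i < 0" for i
    using a that D0 by (simp add: powser_carrier_iff coeffwise_def)
  then show "coeffwise D a \<in> carrier (powser R)"
    using a der unfolding powser_carrier_iff by (simp add: derivation_def additive_map_def)
qed (rule powser_subset)

lemma powser_xderiv_derivation: "derivation (powser R) (xderiv R)"
proof (subst powser_eq, rule derivation_restrict)
  fix a assume a: "a \<in> carrier (powser R)"
  have "cf (xderiv R a) i = \<zero>" if "i < 0" for i
  proof (cases "i = - 1")
    case True
    then show ?thesis using a by (simp add: powser_carrier_iff cf_xderiv add_pow_int_0)
  next
    case False
    then show ?thesis using a that by (simp add: powser_carrier_iff cf_xderiv)
  qed
  then show "xderiv R a \<in> carrier (powser R)"
    using a xderiv_closed unfolding powser_carrier_iff by simp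
qed (rule xderiv_derivation powser_subset)+

end

section \<open>Leading coefficients\<close>

definition zero_divisor_free :: "('a, 'm) ring_scheme \<Rightarrow> bool" where
  "zero_divisor_free R \<longleftrightarrow> \<one>\<^bsub>R\<^esub> \<noteq> \<zero>\<^bsub>R\<^esub> \<and>
     (\<forall>x \<in> carrier R - {\<zero>\<^bsub>R\<^esub>}. \<forall>y \<in> carrier R - {\<zero>\<^bsub>R\<^esub>}. x \<otimes>\<^bsub>R\<^esub> y \<noteq> \<zero>\<^bsub>R\<^esub>)"

text \<open>The sum of \<open>b\<^sup>j y b\<^bsup>m-1-j\<^esup>\<close> over \<open>j < m\<close>, the linear part in \<open>y\<close> of \<open>(b + y)\<^sup>m\<close>.\<close>

primrec power_differential :: "('a, 'm) ring_scheme \<Rightarrow> nat \<Rightarrow> 'a \<Rightarrow> 'a \<Rightarrow> 'a" where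
  "power_differential R 0 b y = \<zero>\<^bsub>R\<^esub>"
| "power_differential R (Suc m) b y = power_differential R m b y \<otimes>\<^bsub>R\<^esub> b \<oplus>\<^bsub>R\<^esub> b [^]\<^bsub>R\<^esub> m \<otimes>\<^bsub>R\<^esub> y"

context ring
begin

lemma power_differential_closed [simp]:
  "b \<in> carrier R \<Longrightarrow> y \<in> carrier R \<Longrightarrow> power_differential R m b y \<in> carrier R"
  by (induction m) auto

lemma power_differential_add:
  assumes "b \<in> carrier R" "y \<in> carrier R" "z \<in> carrier R"
  shows "power_differential R m b (y \<oplus> z) = power_differential R m b y \<oplus> power_differential R m b z"
proof (induction m)
  case (Suc m)
  have "power_differential R (Suc m) b (y \<oplus> z)
      = (power_differential R m b y \<otimes> b \<oplus> power_differential R m b z \<otimes> b) \<oplus> (b [^] m \<otimes> y \<oplus> b [^] m \<otimes> z)"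
    using assms Suc by (simp add: l_distr r_distr)
  also have "\<dots> = power_differential R (Suc m) b y \<oplus> power_differential R (Suc m) b z"
    using assms by (simp add: a_ac)
  finally show ?case .
qed simp

lemma zero_divisor_free_pow:
  assumes "zero_divisor_free R" "x \<in> carrier R" "x \<noteq> \<zero>"
  shows "x [^] (m :: nat) \<noteq> \<zero>"
  using assms by (induction m) (auto simp: zero_divisor_free_def)

lemma add_minus_cancel_left:
  "a \<in> carrier R \<Longrightarrow> b \<in> carrier R \<Longrightarrow> (a \<oplus> b) \<ominus> a = b"
  by (simp add: minus_eq a_comm[of a] a_assoc r_neg)

lemma add_minus_same:
  "a \<in> carrier R \<Longrightarrow> b \<in> carrier R \<Longrightarrow> a \<oplus> (b \<ominus> a) = b"
  by (simp add: minus_eq a_comm[of b] r_neg2)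

lemma minus_trans:
  assumes "x \<in> carrier R" "y \<in> carrier R" "z \<in> carrier R"
  shows "x \<ominus> z = (x \<ominus> y) \<oplus> (y \<ominus> z)"
proof -
  have "(x \<ominus> y) \<oplus> (y \<ominus> z) = x \<oplus> (\<ominus> y \<oplus> y) \<oplus> \<ominus> z"
    using assms by (simp only: minus_eq a_assoc a_closed a_inv_closed)
  then show ?thesis using assms by (simp add: l_neg minus_eq)
qed

end

text \<open>A ring \<open>S\<close> of series over \<open>R\<close>, known only through its coefficient functions and the leading
  coefficients of products. The index grows towards the leading term: for Laurent and power series
  in \<open>x\<close> it is the negated exponent of \<open>x\<close>.\<close>

locale leading_coeff = R: ring R + S: ring S
  for R :: "('a, 'm) ring_scheme" and S :: "('b, 'n) ring_scheme" +
  fixes c :: "'b \<Rightarrow> int \<Rightarrow> 'a"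
  assumes c_closed [simp]: "x \<in> carrier S \<Longrightarrow> c x i \<in> carrier R"
    and c_bounded: "x \<in> carrier S \<Longrightarrow> \<exists>N. \<forall>i>N. c x i = \<zero>\<^bsub>R\<^esub>"
    and c_inject: "x \<in> carrier S \<Longrightarrow> y \<in> carrier S \<Longrightarrow> (\<And>i. c x i = c y i) \<Longrightarrow> x = y"
    and c_add: "x \<in> carrier S \<Longrightarrow> y \<in> carrier S \<Longrightarrow> c (x \<oplus>\<^bsub>S\<^esub> y) i = c x i \<oplus>\<^bsub>R\<^esub> c y i"
    and c_one: "c \<one>\<^bsub>S\<^esub> i = (if i = 0 then \<one>\<^bsub>R\<^esub> else \<zero>\<^bsub>R\<^esub>)"
    and c_mult_bound: "x \<in> carrier S \<Longrightarrow> y \<in> carrier S \<Longrightarrow> \<forall>i>M. c x i = \<zero>\<^bsub>R\<^esub> \<Longrightarrow> \<forall>i>N. c y i = \<zero>\<^bsub>R\<^esub>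
        \<Longrightarrow> i > M + N \<Longrightarrow> c (x \<otimes>\<^bsub>S\<^esub> y) i = \<zero>\<^bsub>R\<^esub>"
    and c_mult_top: "x \<in> carrier S \<Longrightarrow> y \<in> carrier S \<Longrightarrow> \<forall>i>M. c x i = \<zero>\<^bsub>R\<^esub> \<Longrightarrow> \<forall>i>N. c y i = \<zero>\<^bsub>R\<^esub>
        \<Longrightarrow> c (x \<otimes>\<^bsub>S\<^esub> y) (M + N) = c x M \<otimes>\<^bsub>R\<^esub> c y N"
begin

definition below :: "'b \<Rightarrow> int \<Rightarrow> bool" where
  "below x N \<longleftrightarrow> x \<in> carrier S \<and> (\<forall>i>N. c x i = \<zero>\<^bsub>R\<^esub>)"

definition deg :: "'b \<Rightarrow> int" where
  "deg x = (GREATEST i. c x i \<noteq> \<zero>\<^bsub>R\<^esub>)"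

lemma below_carrier: "below x N \<Longrightarrow> x \<in> carrier S"
  by (simp add: below_def)

lemma c_zero [simp]: "c \<zero>\<^bsub>S\<^esub> i = \<zero>\<^bsub>R\<^esub>"
  by (metis R.add.l_cancel_one' S.l_zero S.zero_closed c_add c_closed)

lemma c_uminus: "x \<in> carrier S \<Longrightarrow> c (\<ominus>\<^bsub>S\<^esub> x) i = \<ominus>\<^bsub>R\<^esub> c x i"
  by (metis R.minus_equality S.a_inv_closed S.l_neg c_add c_closed c_zero)

lemma c_minus: "x \<in> carrier S \<Longrightarrow> y \<in> carrier S \<Longrightarrow> c (x \<ominus>\<^bsub>S\<^esub> y) i = c x i \<ominus>\<^bsub>R\<^esub> c y i"
  by (simp add: S.minus_eq R.minus_eq c_add c_uminus)

lemma c_eq_0: "x \<in> carrier S \<Longrightarrow> (\<And>i. c x i = \<zero>\<^bsub>R\<^esub>) \<Longrightarrow> x = \<zero>\<^bsub>S\<^esub>"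
  by (rule c_inject) auto

lemma below_mono: "below x N \<Longrightarrow> N \<le> M \<Longrightarrow> below x M"
  by (simp add: below_def)

lemma below_zero [simp]: "below \<zero>\<^bsub>S\<^esub> N"
  by (simp add: below_def)

lemma below_one [simp]: "below \<one>\<^bsub>S\<^esub> 0"
  by (simp add: below_def c_one)

lemma below_add: "below x N \<Longrightarrow> below y N \<Longrightarrow> below (x \<oplus>\<^bsub>S\<^esub> y) N"
  by (simp add: below_def c_add)

lemma below_minus: "below x N \<Longrightarrow> below y N \<Longrightarrow> below (x \<ominus>\<^bsub>S\<^esub> y) N"
  by (simp add: below_def c_minus)

lemma below_mult: "below x M \<Longrightarrow> below y N \<Longrightarrow> below (x \<otimes>\<^bsub>S\<^esub> y) (M + N)"
  using c_mult_bound[of x y M N] by (simp add: below_def)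

lemma c_mult_below: "below x M \<Longrightarrow> below y N \<Longrightarrow> c (x \<otimes>\<^bsub>S\<^esub> y) (M + N) = c x M \<otimes>\<^bsub>R\<^esub> c y N"
  by (simp add: below_def c_mult_top)

lemma below_strict: "below x N \<Longrightarrow> c x N = \<zero>\<^bsub>R\<^esub> \<Longrightarrow> below x (N - 1)"
  unfolding below_def by (metis add.commute add_le_cancel_right diff_add_cancel le_less zless_imp_add1_zle)

lemma below_pow:
  assumes "below x N"
  shows "below (x [^]\<^bsub>S\<^esub> m) (int m * N)" "c (x [^]\<^bsub>S\<^esub> m) (int m * N) = c x N [^]\<^bsub>R\<^esub> m"
proof (induction m)
  case 0
  show "below (x [^]\<^bsub>S\<^esub> (0 :: nat)) (int 0 * N)" "c (x [^]\<^bsub>S\<^esub> (0 :: nat)) (int 0 * N) = c x N [^]\<^bsub>R\<^esub> (0 :: nat)"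
    by (simp_all add: c_one)
next
  case (Suc m)
  have *: "int (Suc m) * N = int m * N + N" by (simp add: algebra_simps)
  show "below (x [^]\<^bsub>S\<^esub> Suc m) (int (Suc m) * N)"
    unfolding * using below_mult[OF Suc(1) assms] by simp
  show "c (x [^]\<^bsub>S\<^esub> Suc m) (int (Suc m) * N) = c x N [^]\<^bsub>R\<^esub> Suc m"
    unfolding * using c_mult_below[OF Suc(1) assms] Suc(2) by simp
qed

lemma deg_eq:
  assumes "below x N" "c x N \<noteq> \<zero>\<^bsub>R\<^esub>"
  shows "deg x = N"
  unfolding deg_def using assms by (intro Greatest_equality) (auto simp: below_def not_less[symmetric])

lemma deg:
  assumes "x \<in> carrier S" "x \<noteq> \<zero>\<^bsub>S\<^esub>"
  shows "below x (deg x)" "c x (deg x) \<noteq> \<zero>\<^bsub>R\<^esub>"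
proof -
  obtain B where B: "\<forall>i>B. c x i = \<zero>\<^bsub>R\<^esub>" using assms(1) c_bounded by blast
  obtain j where j: "c x j \<noteq> \<zero>\<^bsub>R\<^esub>" using c_eq_0 assms by blast
  define I where "I = {i \<in> {j..B}. c x i \<noteq> \<zero>\<^bsub>R\<^esub>}"
  have "j \<in> I" using j B by (auto simp: I_def not_less[symmetric])
  have "finite I" by (rule finite_subset[of _ "{j..B}"]) (auto simp: I_def)
  moreover have "I \<noteq> {}" using \<open>j \<in> I\<close> by blast
  ultimately have "Max I \<in> I" by (rule Max_in)
  have "c x i = \<zero>\<^bsub>R\<^esub>" if "i > Max I" for i
  proof (rule ccontr)
    assume "c x i \<noteq> \<zero>\<^bsub>R\<^esub>"
    moreover from this have "i \<le> B" using B by (meson not_le)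
    moreover have "j \<le> i" using Max_ge[OF \<open>finite I\<close> \<open>j \<in> I\<close>] that by simp
    ultimately have "i \<in> I" by (simp add: I_def)
    then show False using Max_ge[OF \<open>finite I\<close>, of i] that by simp
  qed
  then have "below x (Max I)" using assms by (simp add: below_def)
  moreover have "c x (Max I) \<noteq> \<zero>\<^bsub>R\<^esub>" using \<open>Max I \<in> I\<close> by (simp add: I_def)
  ultimately show "below x (deg x)" "c x (deg x) \<noteq> \<zero>\<^bsub>R\<^esub>" using deg_eq by auto
qed

lemma deg_le: "below x N \<Longrightarrow> x \<noteq> \<zero>\<^bsub>S\<^esub> \<Longrightarrow> deg x \<le> N"
  using deg(2)[of x] by (auto simp: below_def not_less[symmetric])

lemma deg_mult:
  assumes "zero_divisor_free R" "x \<in> carrier S - {\<zero>\<^bsub>S\<^esub>}" "y \<in> carrier S - {\<zero>\<^bsub>S\<^esub>}"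
  shows "deg (x \<otimes>\<^bsub>S\<^esub> y) = deg x + deg y"
    and "c (x \<otimes>\<^bsub>S\<^esub> y) (deg x + deg y) = c x (deg x) \<otimes>\<^bsub>R\<^esub> c y (deg y)"
    and "x \<otimes>\<^bsub>S\<^esub> y \<noteq> \<zero>\<^bsub>S\<^esub>"
proof -
  have x: "below x (deg x)" "c x (deg x) \<noteq> \<zero>\<^bsub>R\<^esub>" and y: "below y (deg y)" "c y (deg y) \<noteq> \<zero>\<^bsub>R\<^esub>"
    using deg assms by auto
  show *: "c (x \<otimes>\<^bsub>S\<^esub> y) (deg x + deg y) = c x (deg x) \<otimes>\<^bsub>R\<^esub> c y (deg y)"
    by (rule c_mult_below[OF x(1) y(1)])
  have "c x (deg x) \<otimes>\<^bsub>R\<^esub> c y (deg y) \<noteq> \<zero>\<^bsub>R\<^esub>"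
    using assms x y unfolding zero_divisor_free_def by auto
  then show "deg (x \<otimes>\<^bsub>S\<^esub> y) = deg x + deg y" "x \<otimes>\<^bsub>S\<^esub> y \<noteq> \<zero>\<^bsub>S\<^esub>"
    using * by (auto intro: deg_eq below_mult[OF x(1) y(1)])
qed

lemma one_nonzero: "\<one>\<^bsub>R\<^esub> \<noteq> \<zero>\<^bsub>R\<^esub> \<Longrightarrow> \<one>\<^bsub>S\<^esub> \<noteq> \<zero>\<^bsub>S\<^esub>"
  using c_one[of 0] by auto

lemma zero_divisor_free_lift: "zero_divisor_free R \<Longrightarrow> zero_divisor_free S"
  using deg_mult(3) one_nonzero unfolding zero_divisor_free_def by auto

text \<open>The differential of the power map of \<open>S\<close> has that of \<open>R\<close> as its leading part, so that
  injectivity passes from \<open>R\<close> to \<open>S\<close>, and so does surjectivity if \<open>S\<close> is complete.\<close>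

lemma below_power_differential:
  assumes b: "below b N" and y: "below y i"
  shows "below (power_differential S m b y) ((int m - 1) * N + i)"
    and "c (power_differential S m b y) ((int m - 1) * N + i) = power_differential R m (c b N) (c y i)"
proof (induction m)
  case 0
  show "below (power_differential S 0 b y) ((int 0 - 1) * N + i)"
    "c (power_differential S 0 b y) ((int 0 - 1) * N + i) = power_differential R 0 (c b N) (c y i)"
    by simp_all
next
  case (Suc m)
  have e: "(int (Suc m) - 1) * N + i = ((int m - 1) * N + i) + N"
    "(int (Suc m) - 1) * N + i = int m * N + i" by (simp_all add: algebra_simps)
  have 1: "below (power_differential S m b y \<otimes>\<^bsub>S\<^esub> b) ((int (Suc m) - 1) * N + i)"
    unfolding e(1) by (rule below_mult[OF Suc(1) b])
  have 2: "below (b [^]\<^bsub>S\<^esub> m \<otimes>\<^bsub>S\<^esub> y) ((int (Suc m) - 1) * N + i)"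
    unfolding e(2) by (rule below_mult[OF below_pow(1)[OF b] y])
  have 3: "c (power_differential S m b y \<otimes>\<^bsub>S\<^esub> b) ((int (Suc m) - 1) * N + i)
      = power_differential R m (c b N) (c y i) \<otimes>\<^bsub>R\<^esub> c b N"
    unfolding e(1) using c_mult_below[OF Suc(1) b] Suc(2) by simp
  have 4: "c (b [^]\<^bsub>S\<^esub> m \<otimes>\<^bsub>S\<^esub> y) ((int (Suc m) - 1) * N + i) = (c b N) [^]\<^bsub>R\<^esub> m \<otimes>\<^bsub>R\<^esub> c y i"
    unfolding e(2) using c_mult_below[OF below_pow(1)[OF b] y] below_pow(2)[OF b] by simp
  show "below (power_differential S (Suc m) b y) ((int (Suc m) - 1) * N + i)"
    using below_add[OF 1 2] by simp
  show "c (power_differential S (Suc m) b y) ((int (Suc m) - 1) * N + i)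
      = power_differential R (Suc m) (c b N) (c y i)"
    using c_add[OF below_carrier[OF 1] below_carrier[OF 2]] 3 4 by simp
qed

text \<open>All terms of \<open>(x + D)\<^sup>m - x\<^sup>m\<close> with more than one factor \<open>D\<close> are of lower order, since \<open>D\<close> is of
  lower order than \<open>x\<close>. The induction peels off one factor:
  \<open>(x + D)\<^bsup>m+1\<^esup> - x\<^bsup>m+1\<^esup> = ((x + D)\<^sup>m - x\<^sup>m) (x + D) + x\<^sup>m D\<close>.\<close>

lemma below_pow_perturbed:
  assumes x: "below x N" and D: "below D i" and "i < N"
  shows "below ((x \<oplus>\<^bsub>S\<^esub> D) [^]\<^bsub>S\<^esub> m \<ominus>\<^bsub>S\<^esub> x [^]\<^bsub>S\<^esub> m) ((int m - 1) * N + i)"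
    and "c ((x \<oplus>\<^bsub>S\<^esub> D) [^]\<^bsub>S\<^esub> m \<ominus>\<^bsub>S\<^esub> x [^]\<^bsub>S\<^esub> m) ((int m - 1) * N + i)
      = power_differential R m (c x N) (c D i)"
proof (induction m)
  case 0
  show "below ((x \<oplus>\<^bsub>S\<^esub> D) [^]\<^bsub>S\<^esub> (0 :: nat) \<ominus>\<^bsub>S\<^esub> x [^]\<^bsub>S\<^esub> (0 :: nat)) ((int 0 - 1) * N + i)"
    "c ((x \<oplus>\<^bsub>S\<^esub> D) [^]\<^bsub>S\<^esub> (0 :: nat) \<ominus>\<^bsub>S\<^esub> x [^]\<^bsub>S\<^esub> (0 :: nat)) ((int 0 - 1) * N + i)
      = power_differential R 0 (c x N) (c D i)"
    by (simp_all add: S.minus_eq S.r_neg)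
next
  case (Suc m)
  let ?y = "x \<oplus>\<^bsub>S\<^esub> D" and ?k = "(int (Suc m) - 1) * N + i"
  have xD: "x \<in> carrier S" "D \<in> carrier S" using x D by (auto simp: below_def)
  have e: "?k = ((int m - 1) * N + i) + N" "?k = int m * N + i" by (simp_all add: algebra_simps)
  have y: "below ?y N" using x D \<open>i < N\<close> by (intro below_add) (auto intro: below_mono)
  have cy: "c ?y N = c x N" using x D \<open>i < N\<close> by (simp add: below_def c_add)
  have split: "?y [^]\<^bsub>S\<^esub> Suc m \<ominus>\<^bsub>S\<^esub> x [^]\<^bsub>S\<^esub> Suc m
      = (?y [^]\<^bsub>S\<^esub> m \<ominus>\<^bsub>S\<^esub> x [^]\<^bsub>S\<^esub> m) \<otimes>\<^bsub>S\<^esub> ?y \<oplus>\<^bsub>S\<^esub> x [^]\<^bsub>S\<^esub> m \<otimes>\<^bsub>S\<^esub> D"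
  proof -
    have "x [^]\<^bsub>S\<^esub> m \<otimes>\<^bsub>S\<^esub> D = x [^]\<^bsub>S\<^esub> m \<otimes>\<^bsub>S\<^esub> ?y \<ominus>\<^bsub>S\<^esub> x [^]\<^bsub>S\<^esub> m \<otimes>\<^bsub>S\<^esub> x"
      using xD by (simp add: S.r_distr S.add_minus_cancel_left)
    moreover have "(?y [^]\<^bsub>S\<^esub> m \<ominus>\<^bsub>S\<^esub> x [^]\<^bsub>S\<^esub> m) \<otimes>\<^bsub>S\<^esub> ?y = ?y [^]\<^bsub>S\<^esub> m \<otimes>\<^bsub>S\<^esub> ?y \<ominus>\<^bsub>S\<^esub> x [^]\<^bsub>S\<^esub> m \<otimes>\<^bsub>S\<^esub> ?y"
      using xD by (simp only: S.minus_eq S.l_distr S.l_minus S.a_closed S.nat_pow_closed S.a_inv_closed)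
    ultimately show ?thesis
      using S.minus_trans[of "?y [^]\<^bsub>S\<^esub> m \<otimes>\<^bsub>S\<^esub> ?y" "x [^]\<^bsub>S\<^esub> m \<otimes>\<^bsub>S\<^esub> ?y" "x [^]\<^bsub>S\<^esub> m \<otimes>\<^bsub>S\<^esub> x"] xD by simp
  qed
  have 1: "below ((?y [^]\<^bsub>S\<^esub> m \<ominus>\<^bsub>S\<^esub> x [^]\<^bsub>S\<^esub> m) \<otimes>\<^bsub>S\<^esub> ?y) ?k"
    unfolding e(1) by (rule below_mult[OF Suc(1) y])
  have 2: "below (x [^]\<^bsub>S\<^esub> m \<otimes>\<^bsub>S\<^esub> D) ?k"
    unfolding e(2) by (rule below_mult[OF below_pow(1)[OF x] D])
  have 3: "c ((?y [^]\<^bsub>S\<^esub> m \<ominus>\<^bsub>S\<^esub> x [^]\<^bsub>S\<^esub> m) \<otimes>\<^bsub>S\<^esub> ?y) ?k = power_differential R m (c x N) (c D i) \<otimes>\<^bsub>R\<^esub> c x N"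
    unfolding e(1) using c_mult_below[OF Suc(1) y] Suc(2) cy by simp
  have 4: "c (x [^]\<^bsub>S\<^esub> m \<otimes>\<^bsub>S\<^esub> D) ?k = (c x N) [^]\<^bsub>R\<^esub> m \<otimes>\<^bsub>R\<^esub> c D i"
    unfolding e(2) using c_mult_below[OF below_pow(1)[OF x] D] below_pow(2)[OF x] by simp
  show "below (?y [^]\<^bsub>S\<^esub> Suc m \<ominus>\<^bsub>S\<^esub> x [^]\<^bsub>S\<^esub> Suc m) ?k"
    unfolding split by (rule below_add[OF 1 2])
  show "c (?y [^]\<^bsub>S\<^esub> Suc m \<ominus>\<^bsub>S\<^esub> x [^]\<^bsub>S\<^esub> Suc m) ?k = power_differential R (Suc m) (c x N) (c D i)"
    unfolding split using c_add[OF below_carrier[OF 1] below_carrier[OF 2]] 3 4 by simp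
qed

end

section \<open>Uniqueness of roots\<close>

text \<open>The embedding of the ground field. Its image must be central for \<open>\<kappa> z\<close> to leave an \<open>m\<close>-th power
  unchanged when \<open>z\<close> is an \<open>m\<close>-th root of unity.\<close>

definition central_scalars :: "('k :: field \<Rightarrow> 'a) \<Rightarrow> ('a, 'm) ring_scheme \<Rightarrow> bool" where
  "central_scalars \<kappa> R \<longleftrightarrow> (\<forall>z. \<kappa> z \<in> carrier R) \<and> \<kappa> 1 = \<one>\<^bsub>R\<^esub> \<and>
     (\<forall>z w. \<kappa> (z + w) = \<kappa> z \<oplus>\<^bsub>R\<^esub> \<kappa> w) \<and> (\<forall>z w. \<kappa> (z * w) = \<kappa> z \<otimes>\<^bsub>R\<^esub> \<kappa> w) \<and>
     (\<forall>z. \<forall>x \<in> carrier R. \<kappa> z \<otimes>\<^bsub>R\<^esub> x = x \<otimes>\<^bsub>R\<^esub> \<kappa> z)"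

definition power_differential_inj :: "nat \<Rightarrow> ('a, 'm) ring_scheme \<Rightarrow> bool" where
  "power_differential_inj m R \<longleftrightarrow> (\<forall>b \<in> carrier R - {\<zero>\<^bsub>R\<^esub>}. \<forall>y \<in> carrier R - {\<zero>\<^bsub>R\<^esub>}.
     power_differential R m b y \<noteq> \<zero>\<^bsub>R\<^esub>)"

definition roots_unique :: "nat \<Rightarrow> ('k :: field \<Rightarrow> 'a) \<Rightarrow> ('a, 'm) ring_scheme \<Rightarrow> bool" where
  "roots_unique m \<kappa> R \<longleftrightarrow> (\<forall>f \<in> carrier R - {\<zero>\<^bsub>R\<^esub>}. \<forall>g \<in> carrier R.
     g [^]\<^bsub>R\<^esub> m = f [^]\<^bsub>R\<^esub> m \<longrightarrow> (\<exists>z. z ^ m = 1 \<and> g = \<kappa> z \<otimes>\<^bsub>R\<^esub> f))"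

lemma central_scalarsD:
  assumes "central_scalars \<kappa> R"
  shows "\<kappa> z \<in> carrier R" "\<kappa> 1 = \<one>\<^bsub>R\<^esub>"
    and "\<kappa> (z + w) = \<kappa> z \<oplus>\<^bsub>R\<^esub> \<kappa> w" "\<kappa> (z * w) = \<kappa> z \<otimes>\<^bsub>R\<^esub> \<kappa> w"
    and "x \<in> carrier R \<Longrightarrow> \<kappa> z \<otimes>\<^bsub>R\<^esub> x = x \<otimes>\<^bsub>R\<^esub> \<kappa> z"
  using assms unfolding central_scalars_def by blast+

lemma (in ring) central_scalars_pow:
  assumes "central_scalars \<kappa> R"
  shows "\<kappa> z [^] (m :: nat) = \<kappa> (z ^ m)"
proof (induction m)
  case (Suc m)
  have "\<kappa> (z ^ Suc m) = \<kappa> (z ^ m * z)" by (simp add: mult.commute)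
  then show ?case using Suc by (simp only: nat_pow_Suc central_scalarsD(4)[OF assms])
qed (use central_scalarsD(2)[OF assms] in simp)

lemma (in ring) scalar_mult_pow:
  assumes "central_scalars \<kappa> R" "x \<in> carrier R"
  shows "(\<kappa> z \<otimes> x) [^] (m :: nat) = \<kappa> (z ^ m) \<otimes> x [^] m"
proof -
  have "(\<kappa> z \<otimes> x) [^] m = \<kappa> z [^] m \<otimes> x [^] m"
    using central_scalarsD(1,5)[OF assms(1)] assms(2) by (intro pow_mult_distrib)
  then show ?thesis by (simp add: central_scalars_pow[OF assms(1)])
qed

context leading_coeff
begin

lemma power_differential_inj_lift:
  assumes "power_differential_inj m R"
  shows "power_differential_inj m S"
  unfolding power_differential_inj_def
proof (intro ballI)
  fix b y assume b: "b \<in> carrier S - {\<zero>\<^bsub>S\<^esub>}" and y: "y \<in> carrier S - {\<zero>\<^bsub>S\<^esub>}"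
  have *: "below b (deg b)" "c b (deg b) \<noteq> \<zero>\<^bsub>R\<^esub>" "below y (deg y)" "c y (deg y) \<noteq> \<zero>\<^bsub>R\<^esub>"
    using b y deg by auto
  then have "power_differential R m (c b (deg b)) (c y (deg y)) \<noteq> \<zero>\<^bsub>R\<^esub>"
    using assms b y unfolding power_differential_inj_def by auto
  then show "power_differential S m b y \<noteq> \<zero>\<^bsub>S\<^esub>"
    using below_power_differential(2)[OF *(1,3), of m] by auto
qed

lemma central_scalars_lift:
  assumes \<kappa>: "central_scalars \<kappa> R"
    and closed: "\<And>z. \<kappa>' z \<in> carrier S"
    and coeff: "\<And>z i. c (\<kappa>' z) i = (if i = 0 then \<kappa> z else \<zero>\<^bsub>R\<^esub>)"
    and mult: "\<And>z x i. x \<in> carrier S \<Longrightarrow> c (\<kappa>' z \<otimes>\<^bsub>S\<^esub> x) i = \<kappa> z \<otimes>\<^bsub>R\<^esub> c x i"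
      "\<And>z x i. x \<in> carrier S \<Longrightarrow> c (x \<otimes>\<^bsub>S\<^esub> \<kappa>' z) i = c x i \<otimes>\<^bsub>R\<^esub> \<kappa> z"
  shows "central_scalars \<kappa>' S"
  unfolding central_scalars_def
proof (intro conjI allI ballI)
  show "\<kappa>' z \<in> carrier S" for z by (rule closed)
  note \<kappa>D = central_scalarsD[OF \<kappa>]
  show "\<kappa>' 1 = \<one>\<^bsub>S\<^esub>"
    by (rule c_inject) (simp_all add: closed coeff c_one \<kappa>D(2))
  show "\<kappa>' (z + w) = \<kappa>' z \<oplus>\<^bsub>S\<^esub> \<kappa>' w" for z w
    by (rule c_inject) (simp_all add: closed coeff c_add \<kappa>D(3))
  show "\<kappa>' (z * w) = \<kappa>' z \<otimes>\<^bsub>S\<^esub> \<kappa>' w" for z w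
    by (rule c_inject) (simp_all add: closed coeff mult(1) \<kappa>D(1,4))
  show "\<kappa>' z \<otimes>\<^bsub>S\<^esub> x = x \<otimes>\<^bsub>S\<^esub> \<kappa>' z" if "x \<in> carrier S" for z x
    by (rule c_inject) (simp_all add: that closed mult, simp add: that \<kappa>D(5))
qed

text \<open>After scaling by a root of unity, \<open>f\<close> and \<open>g\<close> have the same leading coefficient. If they
  still differed, their difference \<open>D\<close> would be of lower order, and the powers would differ by a series
  whose leading coefficient is \<open>power_differential\<close> at nonzero arguments.\<close>

lemma roots_unique_lift:
  assumes "m > 0" and zdf: "zero_divisor_free R" and inj: "power_differential_inj m R"
    and \<kappa>': "central_scalars \<kappa>' S" and uniq: "roots_unique m \<kappa> R"
    and mult: "\<And>z x i. x \<in> carrier S \<Longrightarrow> c (\<kappa>' z \<otimes>\<^bsub>S\<^esub> x) i = \<kappa> z \<otimes>\<^bsub>R\<^esub> c x i"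
  shows "roots_unique m \<kappa>' S"
  unfolding roots_unique_def
proof (intro ballI impI)
  fix f g assume f: "f \<in> carrier S - {\<zero>\<^bsub>S\<^esub>}" and g: "g \<in> carrier S" and eq: "g [^]\<^bsub>S\<^esub> m = f [^]\<^bsub>S\<^esub> m"
  have "f [^]\<^bsub>S\<^esub> m \<noteq> \<zero>\<^bsub>S\<^esub>"
    using S.zero_divisor_free_pow zero_divisor_free_lift[OF zdf] f by blast
  then have g0: "g \<noteq> \<zero>\<^bsub>S\<^esub>" using eq \<open>m > 0\<close> by (auto simp: S.nat_pow_zero)
  let ?N = "deg f"
  have f': "below f ?N" "c f ?N \<noteq> \<zero>\<^bsub>R\<^esub>" using f deg by auto
  have g': "below g (deg g)" "c g (deg g) \<noteq> \<zero>\<^bsub>R\<^esub>" using g g0 deg by auto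
  have degpow: "deg (x [^]\<^bsub>S\<^esub> m) = int m * deg x" if "below x (deg x)" "c x (deg x) \<noteq> \<zero>\<^bsub>R\<^esub>" for x
    using that below_pow[OF that(1), of m] R.zero_divisor_free_pow[OF zdf]
    by (intro deg_eq) (auto simp: below_def)
  have "int m * deg g = int m * deg f" using degpow[OF f'] degpow[OF g'] eq by metis
  then have degs: "deg g = ?N" using \<open>m > 0\<close> by simp
  have "c g ?N [^]\<^bsub>R\<^esub> m = c f ?N [^]\<^bsub>R\<^esub> m"
    using below_pow(2)[OF f'(1), of m] below_pow(2)[OF g'(1), of m] degs eq by simp
  then obtain z where z: "z ^ m = 1" "c g ?N = \<kappa> z \<otimes>\<^bsub>R\<^esub> c f ?N"
    using uniq f f' g unfolding roots_unique_def by fastforce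
  define h where "h = \<kappa>' z \<otimes>\<^bsub>S\<^esub> f"
  have hS: "h \<in> carrier S" using central_scalarsD(1)[OF \<kappa>'] f by (simp add: h_def)
  have hm: "h [^]\<^bsub>S\<^esub> m = f [^]\<^bsub>S\<^esub> m"
    using S.scalar_mult_pow[OF \<kappa>', of f z m] f z(1) central_scalarsD(2)[OF \<kappa>']
    by (simp add: h_def)
  have \<kappa>R: "\<kappa> z \<otimes>\<^bsub>R\<^esub> \<zero>\<^bsub>R\<^esub> = \<zero>\<^bsub>R\<^esub>"
    using mult[of "\<zero>\<^bsub>S\<^esub>" z 0] central_scalarsD(1)[OF \<kappa>'] by simp
  have hN: "below h ?N" "c h ?N = c g ?N"
    using f' z f by (auto simp: below_def hS) (auto simp: h_def mult \<kappa>R)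
  define D where "D = g \<ominus>\<^bsub>S\<^esub> h"
  have DS: "D \<in> carrier S" using g hS by (simp add: D_def)
  have gD: "g = h \<oplus>\<^bsub>S\<^esub> D"
    using g hS by (simp add: D_def S.add_minus_same)
  have "D = \<zero>\<^bsub>S\<^esub>"
  proof (rule ccontr)
    assume D0: "D \<noteq> \<zero>\<^bsub>S\<^esub>"
    have "below D ?N" unfolding D_def using g' degs hN by (auto intro: below_minus)
    moreover have "c D ?N = \<zero>\<^bsub>R\<^esub>" using hN g hS by (simp add: D_def c_minus R.minus_eq R.r_neg)
    ultimately have "deg D < ?N" using deg_le[of D "?N - 1"] D0 below_strict by fastforce
    have D': "below D (deg D)" "c D (deg D) \<noteq> \<zero>\<^bsub>R\<^esub>" using DS D0 deg by auto
    have "power_differential R m (c h ?N) (c D (deg D)) \<noteq> \<zero>\<^bsub>R\<^esub>"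
      using inj g' degs hN D' g DS unfolding power_differential_inj_def by auto
    moreover have "(h \<oplus>\<^bsub>S\<^esub> D) [^]\<^bsub>S\<^esub> m \<ominus>\<^bsub>S\<^esub> h [^]\<^bsub>S\<^esub> m = \<zero>\<^bsub>S\<^esub>"
      using gD eq hm f by (simp add: S.minus_eq S.r_neg)
    ultimately show False
      using below_pow_perturbed(2)[OF hN(1) D'(1) \<open>deg D < ?N\<close>, of m] by simp
  qed
  then have "g = \<kappa>' z \<otimes>\<^bsub>S\<^esub> f" using gD hS by (simp add: h_def)
  then show "\<exists>z. z ^ m = 1 \<and> g = \<kappa>' z \<otimes>\<^bsub>S\<^esub> f" using z by blast
qed

end

section \<open>Successive approximation\<close>

text \<open>Completeness: every family of coefficients that is bounded above belongs to a series. It holds for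
  Laurent and pseudo-differential series, but not for power series.\<close>

locale complete_leading_coeff = leading_coeff +
  assumes c_surj: "(\<And>i. f i \<in> carrier R) \<Longrightarrow> \<forall>i>N. f i = \<zero>\<^bsub>R\<^esub> \<Longrightarrow> \<exists>x \<in> carrier S. \<forall>i. c x i = f i"
begin

lemma monomial_exists:
  assumes "y \<in> carrier R"
  shows "\<exists>D. below D i \<and> c D i = y \<and> (\<forall>j. j \<noteq> i \<longrightarrow> c D j = \<zero>\<^bsub>R\<^esub>)"
proof -
  have "\<exists>D \<in> carrier S. \<forall>j. c D j = (if j = i then y else \<zero>\<^bsub>R\<^esub>)"
    by (rule c_surj[where N = i]) (use assms in auto)
  then show ?thesis by (auto simp: below_def)
qed

text \<open>The error \<open>\<Phi> x - L\<close> is pushed down one order at a time by adding a monomial, whose coefficient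
  solves an equation for \<open>\<tau>\<close>. The approximations stabilize in every order and so define a series, for
  which the error is below every order. The hypothesis on perturbations is restricted to series near the
  starting point \<open>x0\<close>, because for the power map \<open>\<tau>\<close> depends on the leading coefficient of \<open>x0\<close>.\<close>

lemma successive_approximation:
  assumes \<Phi>: "\<And>x. x \<in> carrier S \<Longrightarrow> \<Phi> x \<in> carrier S"
    and L: "L \<in> carrier S" and x0: "x0 \<in> carrier S"
    and start: "below (\<Phi> x0 \<ominus>\<^bsub>S\<^esub> L) (K + i0)"
    and step: "\<And>x D i. below (x \<ominus>\<^bsub>S\<^esub> x0) i0 \<Longrightarrow> x \<in> carrier S \<Longrightarrow> i \<le> i0 \<Longrightarrow> below D i \<Longrightarrow>
        below (\<Phi> (x \<oplus>\<^bsub>S\<^esub> D) \<ominus>\<^bsub>S\<^esub> \<Phi> x) (K + i) \<and> c (\<Phi> (x \<oplus>\<^bsub>S\<^esub> D) \<ominus>\<^bsub>S\<^esub> \<Phi> x) (K + i) = \<tau> (c D i)"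
    and surj: "\<And>r. r \<in> carrier R \<Longrightarrow> \<exists>y \<in> carrier R. \<tau> y = r"
  shows "\<exists>x \<in> carrier S. below (x \<ominus>\<^bsub>S\<^esub> x0) i0 \<and> \<Phi> x = L"
proof -
  define P where "P t x \<longleftrightarrow> x \<in> carrier S \<and> below (x \<ominus>\<^bsub>S\<^esub> x0) i0 \<and> below (\<Phi> x \<ominus>\<^bsub>S\<^esub> L) (K + (i0 - int t))" for t x
  have "\<exists>u. \<forall>t. P t (u t) \<and> below (u (Suc t) \<ominus>\<^bsub>S\<^esub> u t) (i0 - int t)"
  proof (rule dependent_nat_choice)
    show "\<exists>x. P 0 x"
      using x0 start by (auto simp: P_def S.minus_eq S.r_neg)
  next
    fix x t assume "P t x"
    then have x: "x \<in> carrier S" "below (x \<ominus>\<^bsub>S\<^esub> x0) i0" "below (\<Phi> x \<ominus>\<^bsub>S\<^esub> L) (K + (i0 - int t))"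
      by (auto simp: P_def)
    let ?i = "i0 - int t"
    obtain y where y: "y \<in> carrier R" "\<tau> y = \<ominus>\<^bsub>R\<^esub> c (\<Phi> x \<ominus>\<^bsub>S\<^esub> L) (K + ?i)"
      using surj x L \<Phi> by (metis R.a_inv_closed S.minus_closed c_closed)
    obtain D where D: "below D ?i" "c D ?i = y" using monomial_exists[OF y(1)] by blast
    have DS: "D \<in> carrier S" using D by (simp add: below_def)
    let ?x = "x \<oplus>\<^bsub>S\<^esub> D"
    have xx: "?x \<ominus>\<^bsub>S\<^esub> x = D"
      using x DS by (simp add: S.add_minus_cancel_left)
    have x0': "?x \<ominus>\<^bsub>S\<^esub> x0 = D \<oplus>\<^bsub>S\<^esub> (x \<ominus>\<^bsub>S\<^esub> x0)"
      using x DS x0 S.minus_trans[of ?x x x0] by (simp add: xx)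
    have s: "below (\<Phi> ?x \<ominus>\<^bsub>S\<^esub> \<Phi> x) (K + ?i)" "c (\<Phi> ?x \<ominus>\<^bsub>S\<^esub> \<Phi> x) (K + ?i) = \<tau> y"
      using step[of x ?i D] x D by auto
    have split: "\<Phi> ?x \<ominus>\<^bsub>S\<^esub> L = (\<Phi> ?x \<ominus>\<^bsub>S\<^esub> \<Phi> x) \<oplus>\<^bsub>S\<^esub> (\<Phi> x \<ominus>\<^bsub>S\<^esub> L)"
      using \<Phi> x DS L by (intro S.minus_trans) auto
    have "below (\<Phi> ?x \<ominus>\<^bsub>S\<^esub> L) (K + ?i)"
      unfolding split using s x by (intro below_add) auto
    moreover have "c (\<Phi> ?x \<ominus>\<^bsub>S\<^esub> L) (K + ?i) = \<zero>\<^bsub>R\<^esub>"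
      unfolding split using \<Phi> x DS L by (simp add: c_add s y R.l_neg)
    ultimately have "below (\<Phi> ?x \<ominus>\<^bsub>S\<^esub> L) (K + ?i - 1)" by (rule below_strict)
    moreover have "below (?x \<ominus>\<^bsub>S\<^esub> x0) i0"
      unfolding x0' using x D by (intro below_add) (auto intro: below_mono)
    ultimately have "P (Suc t) ?x" using x DS by (simp add: P_def algebra_simps)
    moreover have "below (?x \<ominus>\<^bsub>S\<^esub> x) ?i" using xx D by simp
    ultimately show "\<exists>x'. P (Suc t) x' \<and> below (x' \<ominus>\<^bsub>S\<^esub> x) (i0 - int t)" by blast
  qed
  then obtain u where P: "\<And>t. P t (u t)" and u: "\<And>t. below (u (Suc t) \<ominus>\<^bsub>S\<^esub> u t) (i0 - int t)" by blast
  have XS: "u t \<in> carrier S" for t using P by (simp add: P_def)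
  have step_eq: "c (u (Suc t)) j = c (u t) j" if "j > i0 - int t" for t j
  proof -
    have "c (u (Suc t)) j \<ominus>\<^bsub>R\<^esub> c (u t) j = \<zero>\<^bsub>R\<^esub>"
      using u[of t] that XS by (simp add: below_def c_minus)
    then show ?thesis using XS R.r_right_minus_eq by simp
  qed
  have stable: "c (u (n + t)) j = c (u n) j" if "j > i0 - int n" for n t j
    using that by (induction t) (auto simp: step_eq)
  \<comment> \<open>the coefficient at \<open>j\<close> is final from step \<open>i0 - j + 1\<close> on, and from the start if \<open>j > i0\<close>\<close>
  define f where "f j = c (u (nat (i0 - j + 1))) j" for j
  obtain B where B: "\<forall>i>B. c (u 0) i = \<zero>\<^bsub>R\<^esub>" using c_bounded XS by blast
  have "\<forall>j > max B i0. f j = \<zero>\<^bsub>R\<^esub>" using B by (simp add: f_def)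
  then have "\<exists>x \<in> carrier S. \<forall>j. c x j = f j"
    by (rule c_surj[rotated]) (use XS in \<open>auto simp: f_def\<close>)
  then obtain x where x: "x \<in> carrier S" "\<And>j. c x j = f j" by blast
  have near: "below (x \<ominus>\<^bsub>S\<^esub> u t) (i0 - int t)" for t
  proof -
    have "c (x \<ominus>\<^bsub>S\<^esub> u t) j = \<zero>\<^bsub>R\<^esub>" if "j > i0 - int t" for j
    proof -
      let ?n = "nat (i0 - j + 1)"
      have "?n + (t - ?n) = t" "j > i0 - int ?n" using that by auto
      then have "c (u t) j = f j" using stable[of ?n j "t - ?n"] by (simp add: f_def)
      then show ?thesis using x XS by (simp add: c_minus) (metis R.minus_eq R.r_neg XS c_closed)
    qed
    then show ?thesis using x XS by (simp add: below_def)
  qed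
  have close: "below (\<Phi> x \<ominus>\<^bsub>S\<^esub> L) (K + (i0 - int t))" for t
  proof -
    have "x = u t \<oplus>\<^bsub>S\<^esub> (x \<ominus>\<^bsub>S\<^esub> u t)"
      using x XS by (simp add: S.add_minus_same)
    then have "below (\<Phi> x \<ominus>\<^bsub>S\<^esub> \<Phi> (u t)) (K + (i0 - int t))"
      using step[of "u t" "i0 - int t" "x \<ominus>\<^bsub>S\<^esub> u t"] P[of t] near[of t] by (simp add: P_def)
    then show ?thesis
      using P[of t] S.minus_trans[of "\<Phi> x" "\<Phi> (u t)" L] \<Phi> x L XS
      by (auto simp: P_def intro: below_add)
  qed
  have "\<Phi> x \<ominus>\<^bsub>S\<^esub> L = \<zero>\<^bsub>S\<^esub>"
  proof (rule c_eq_0)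
    fix j
    have "j > K + (i0 - int (nat (K + i0 - j + 1)))" by auto
    then show "c (\<Phi> x \<ominus>\<^bsub>S\<^esub> L) j = \<zero>\<^bsub>R\<^esub>" using close below_def by blast
  qed (use \<Phi> x L in auto)
  then have "\<Phi> x = L" using \<Phi> x L by simp
  moreover have "below (x \<ominus>\<^bsub>S\<^esub> x0) i0"
    using below_add[OF near[of 0]] P[of 0] S.minus_trans[of x "u 0" x0] x XS x0
    by (simp add: P_def)
  ultimately show ?thesis using x by blast
qed

lemma additive_surj:
  assumes \<Phi>: "additive_map S \<Phi>" and L: "L \<in> carrier S"
    and top: "\<And>D i. below D i \<Longrightarrow> below (\<Phi> D) (K + i) \<and> c (\<Phi> D) (K + i) = \<tau> (c D i)"
    and surj: "\<And>r. r \<in> carrier R \<Longrightarrow> \<exists>y \<in> carrier R. \<tau> y = r"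
    and "below L (K + i0)"
  shows "\<exists>x. below x i0 \<and> \<Phi> x = L"
proof -
  have closed: "\<And>x. x \<in> carrier S \<Longrightarrow> \<Phi> x \<in> carrier S" using \<Phi> by (simp add: additive_map_def)
  have "\<exists>x \<in> carrier S. below (x \<ominus>\<^bsub>S\<^esub> \<zero>\<^bsub>S\<^esub>) i0 \<and> \<Phi> x = L"
  proof (rule successive_approximation[where K = K and \<tau> = \<tau>])
    have "\<Phi> \<zero>\<^bsub>S\<^esub> = \<zero>\<^bsub>S\<^esub>" using \<Phi> by (rule S.additive_map_zero)
    then show "below (\<Phi> \<zero>\<^bsub>S\<^esub> \<ominus>\<^bsub>S\<^esub> L) (K + i0)" using below_minus[OF below_zero assms(5)] by simp
    fix x D i assume x: "x \<in> carrier S" and D: "below D i"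
    then have "D \<in> carrier S" by (simp add: below_def)
    then have "\<Phi> (x \<oplus>\<^bsub>S\<^esub> D) \<ominus>\<^bsub>S\<^esub> \<Phi> x = \<Phi> D"
      using \<Phi> x closed
      by (simp add: additive_map_def S.add_minus_cancel_left)
    then show "below (\<Phi> (x \<oplus>\<^bsub>S\<^esub> D) \<ominus>\<^bsub>S\<^esub> \<Phi> x) (K + i) \<and> c (\<Phi> (x \<oplus>\<^bsub>S\<^esub> D) \<ominus>\<^bsub>S\<^esub> \<Phi> x) (K + i) = \<tau> (c D i)"
      using top[OF D] by simp
  qed (use L surj closed in auto)
  then show ?thesis by (auto simp: S.minus_eq)
qed

text \<open>Approximation yields right inverses only. The right inverse of \<open>x\<close> has a unit as its leading
  coefficient as well, hence it has a right inverse itself, and this must be \<open>x\<close>.\<close>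

lemma unit_lift:
  assumes x: "below x N" and u: "c x N \<in> Units R"
  shows "x \<in> Units S"
proof -
  have right_inverse: "\<exists>y. below y (- N) \<and> x \<otimes>\<^bsub>S\<^esub> y = \<one>\<^bsub>S\<^esub>"
    if x: "below x N" and u: "c x N \<in> Units R" for x N
  proof (rule additive_surj[where K = N and \<tau> = "\<lambda>r. c x N \<otimes>\<^bsub>R\<^esub> r"])
    show "additive_map S ((\<otimes>\<^bsub>S\<^esub>) x)"
      using x by (auto intro: S.additive_map_lmult simp: below_def)
    show "below (x \<otimes>\<^bsub>S\<^esub> D) (N + i) \<and> c (x \<otimes>\<^bsub>S\<^esub> D) (N + i) = c x N \<otimes>\<^bsub>R\<^esub> c D i" if "below D i" for D i
      using x that by (simp add: below_mult c_mult_below)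
    show "\<exists>y \<in> carrier R. c x N \<otimes>\<^bsub>R\<^esub> y = r" if "r \<in> carrier R" for r
      using u that R.Units_r_inv[OF u] R.Units_closed[OF u]
      by (intro bexI[of _ "inv\<^bsub>R\<^esub> c x N \<otimes>\<^bsub>R\<^esub> r"]) (auto simp: R.m_assoc[symmetric])
  qed auto
  obtain y where y: "below y (- N)" "x \<otimes>\<^bsub>S\<^esub> y = \<one>\<^bsub>S\<^esub>" using right_inverse[OF x u] by blast
  have "c x N \<otimes>\<^bsub>R\<^esub> c y (- N) = \<one>\<^bsub>R\<^esub>"
    using c_mult_below[OF x y(1)] y(2) c_one[of 0] by simp
  then have "c y (- N) = inv\<^bsub>R\<^esub> c x N"
    using u y(1) by (metis R.Units_closed R.Units_inv_closed R.Units_l_inv R.l_one R.m_assoc R.r_one below_carrier c_closed)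
  then have "c y (- N) \<in> Units R" using u by simp
  then obtain z where z: "below z (- (- N))" "y \<otimes>\<^bsub>S\<^esub> z = \<one>\<^bsub>S\<^esub>" using right_inverse[OF y(1)] by blast
  have "x = z"
    using x y z by (metis S.l_one S.m_assoc S.r_one below_carrier)
  then show ?thesis
    using x y z unfolding Units_def below_def by blast
qed

lemma power_differential_surj_lift:
  assumes b: "below b N"
    and surj: "\<And>r. r \<in> carrier R \<Longrightarrow> \<exists>y \<in> carrier R. power_differential R m (c b N) y = r"
    and L: "L \<in> carrier S"
  shows "\<exists>y \<in> carrier S. power_differential S m b y = L"
proof -
  obtain B where B: "below L B" using L c_bounded unfolding below_def by blast
  have "\<exists>y. below y (B - (int m - 1) * N) \<and> power_differential S m b y = L"
  proof (rule additive_surj[where K = "(int m - 1) * N"])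
    show "additive_map S (power_differential S m b)"
      using b by (simp add: additive_map_def below_def S.power_differential_add)
    show "below (power_differential S m b D) ((int m - 1) * N + i) \<and>
        c (power_differential S m b D) ((int m - 1) * N + i) = power_differential R m (c b N) (c D i)"
      if "below D i" for D i
      using below_power_differential[OF b that] by blast
  qed (use surj L B in auto)
  then show ?thesis by (auto simp: below_def)
qed

text \<open>The root \<open>r\<close> of the leading coefficient of \<open>L\<close>, placed at order \<open>N\<close>, is the first approximation; the
  corrections are of order at most \<open>N - 1\<close> and so keep \<open>r\<close> as the leading coefficient.\<close>

lemma root_lift:
  assumes L: "below L (int m * N)" and r: "r \<in> carrier R" "r [^]\<^bsub>R\<^esub> m = c L (int m * N)"
    and surj: "\<And>q. q \<in> carrier R \<Longrightarrow> \<exists>y \<in> carrier R. power_differential R m r y = q"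
  shows "\<exists>M \<in> carrier S. M [^]\<^bsub>S\<^esub> m = L"
proof -
  obtain x0 where x0: "below x0 N" "c x0 N = r" using monomial_exists[OF r(1)] by blast
  have "\<exists>M \<in> carrier S. below (M \<ominus>\<^bsub>S\<^esub> x0) (N - 1) \<and> M [^]\<^bsub>S\<^esub> m = L"
  proof (rule successive_approximation[where K = "(int m - 1) * N" and \<tau> = "power_differential R m r"])
    have "below (x0 [^]\<^bsub>S\<^esub> m \<ominus>\<^bsub>S\<^esub> L) (int m * N - 1)"
    proof (rule below_strict)
      show "below (x0 [^]\<^bsub>S\<^esub> m \<ominus>\<^bsub>S\<^esub> L) (int m * N)"
        using below_pow(1)[OF x0(1)] L by (rule below_minus)
      have "c (x0 [^]\<^bsub>S\<^esub> m) (int m * N) = c L (int m * N)"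
        using below_pow(2)[OF x0(1)] x0 r by simp
      then show "c (x0 [^]\<^bsub>S\<^esub> m \<ominus>\<^bsub>S\<^esub> L) (int m * N) = \<zero>\<^bsub>R\<^esub>"
        using x0 L by (simp add: c_minus below_def R.minus_eq R.r_neg)
    qed
    then show "below (x0 [^]\<^bsub>S\<^esub> m \<ominus>\<^bsub>S\<^esub> L) ((int m - 1) * N + (N - 1))" by (simp add: algebra_simps)
    fix x D i assume x: "below (x \<ominus>\<^bsub>S\<^esub> x0) (N - 1)" "x \<in> carrier S" and i: "i \<le> N - 1" and D: "below D i"
    have xx: "x = x0 \<oplus>\<^bsub>S\<^esub> (x \<ominus>\<^bsub>S\<^esub> x0)"
      using x x0 by (simp add: below_def S.add_minus_same)
    have "below x N"
      by (subst xx, rule below_add) (use x0 x in \<open>auto intro: below_mono\<close>)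
    moreover have "c x N = r"
      by (subst xx) (use x x0 r in \<open>simp add: below_def c_add\<close>)
    ultimately show "below ((x \<oplus>\<^bsub>S\<^esub> D) [^]\<^bsub>S\<^esub> m \<ominus>\<^bsub>S\<^esub> x [^]\<^bsub>S\<^esub> m) ((int m - 1) * N + i) \<and>
        c ((x \<oplus>\<^bsub>S\<^esub> D) [^]\<^bsub>S\<^esub> m \<ominus>\<^bsub>S\<^esub> x [^]\<^bsub>S\<^esub> m) ((int m - 1) * N + i) = power_differential R m r (c D i)"
      using below_pow_perturbed[of x N D i m] D i by auto
  qed (use L x0 surj in \<open>auto simp: below_def\<close>)
  then show ?thesis by blast
qed

end

section \<open>Series rings as extensions of their coefficient rings\<close>

lemma (in psdo_coeffs) psdo_leading_coeff: "complete_leading_coeff R S cf"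
proof -
  interpret S: ring S by (rule psdo_ring)
  show ?thesis
  proof unfold_locales
    fix x y :: "'k ser" and i M N :: int
    assume x: "x \<in> carrier S"
    show "cf x i \<in> carrier R" using x by simp
    show "\<exists>N. \<forall>i>N. cf x i = \<zero>" using x unfolding psdo_carrier_iff by blast
    assume y: "y \<in> carrier S"
    show "cf (x \<oplus>\<^bsub>S\<^esub> y) i = cf x i \<oplus> cf y i" by (rule psdo_add_coeff)
    show "x = y" if "\<And>i. cf x i = cf y i" using x y that by (rule psdo_eqI)
    assume M: "\<forall>i>M. cf x i = \<zero>" and N: "\<forall>i>N. cf y i = \<zero>"
    show "cf (x \<otimes>\<^bsub>S\<^esub> y) i = \<zero>" if "i > M + N"
      using psdo_mult_bound[OF x y, of M N] M N that by blast
    show "cf (x \<otimes>\<^bsub>S\<^esub> y) (M + N) = cf x M \<otimes> cf y N"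
      using psdo_mult_top[OF x y, of M N] M N by blast
  next
    show "cf \<one>\<^bsub>S\<^esub> i = (if i = 0 then \<one> else \<zero>)" for i by (simp add: psdo_one const_series_def)
    fix f and N :: int
    assume "\<And>i. f i \<in> carrier R" "\<forall>i>N. f i = \<zero>"
    then have "Ser f \<in> carrier S" unfolding psdo_carrier_iff by auto
    then show "\<exists>x \<in> carrier S. \<forall>i. cf x i = f i" by (rule bexI[rotated]) simp
  qed
qed

lemma (in laurent_coeffs) laurent_leading_coeff:
  "complete_leading_coeff R L (\<lambda>a i. cf a (- i))"
proof -
  interpret L: ring L by (rule laurent_ring)
  show ?thesis
  proof unfold_locales
    fix x y :: "'k ser" and i M N :: int
    assume x: "x \<in> carrier L"
    show "cf x (- i) \<in> carrier R" using x by simp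
    show "\<exists>N. \<forall>i>N. cf x (- i) = \<zero>"
    proof -
      obtain N where "\<And>i. i < N \<Longrightarrow> cf x i = \<zero>" using x by (rule laurent_boundE) blast
      then have "\<forall>i > - N. cf x (- i) = \<zero>" by simp
      then show ?thesis by blast
    qed
    assume y: "y \<in> carrier L"
    show "cf (x \<oplus>\<^bsub>L\<^esub> y) (- i) = cf x (- i) \<oplus> cf y (- i)" by (rule laurent_add_coeff)
    show "x = y" if "\<And>i. cf x (- i) = cf y (- i)"
    proof (rule laurent_eqI[OF x y])
      show "cf x i = cf y i" for i using that[of "- i"] by simp
    qed
    assume M: "\<forall>i>M. cf x (- i) = \<zero>" and N: "\<forall>i>N. cf y (- i) = \<zero>"
    have M': "cf x i = \<zero>" if "i < - M" for i using M[rule_format, of "- i"] that by simp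
    have N': "cf y i = \<zero>" if "i < - N" for i using N[rule_format, of "- i"] that by simp
    show "cf (x \<otimes>\<^bsub>L\<^esub> y) (- i) = \<zero>" if "i > M + N"
      using laurent_mult_top(2)[where M = "- M" and N = "- N", OF x y M' N', of "- i"] that by simp
    show "cf (x \<otimes>\<^bsub>L\<^esub> y) (- (M + N)) = cf x (- M) \<otimes> cf y (- N)"
      using laurent_mult_top(1)[where M = "- M" and N = "- N", OF x y M' N'] by simp
  next
    show "cf \<one>\<^bsub>L\<^esub> (- i) = (if i = 0 then \<one> else \<zero>)" for i by (simp add: laurent_one const_series_def)
    fix f and N :: int
    assume f: "\<And>i. f i \<in> carrier R" "\<forall>i>N. f i = \<zero>"
    have "\<forall>i < - N. f (- i) = \<zero>" using f by simp
    then have "\<exists>N. \<forall>i<N. f (- i) = \<zero>" by blast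
    then have "Ser (\<lambda>i. f (- i)) \<in> carrier L" unfolding laurent_carrier_iff using f by simp
    then show "\<exists>x \<in> carrier L. \<forall>i. cf x (- i) = f i" by (rule bexI[rotated]) simp
  qed
qed

lemma (in laurent_coeffs) powser_leading_coeff:
  "leading_coeff R (powser R) (\<lambda>a i. cf a (- i))"
proof -
  interpret A: ring "powser R" by (rule powser_ring)
  interpret L: complete_leading_coeff R L "\<lambda>a i. cf a (- i)" by (rule laurent_leading_coeff)
  have eq: "x \<otimes>\<^bsub>powser R\<^esub> y = x \<otimes>\<^bsub>L\<^esub> y" "x \<oplus>\<^bsub>powser R\<^esub> y = x \<oplus>\<^bsub>L\<^esub> y" "\<one>\<^bsub>powser R\<^esub> = \<one>\<^bsub>L\<^esub>" for x y
    by (simp_all add: powser_def)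
  have sub: "x \<in> carrier L" if "x \<in> carrier (powser R)" for x using that powser_subset by blast
  show ?thesis
  proof unfold_locales
    fix x y and i M N :: int
    assume "x \<in> carrier (powser R)"
    then have x: "x \<in> carrier L" by (rule sub)
    then show "cf x (- i) \<in> carrier R" "\<exists>N. \<forall>i>N. cf x (- i) = \<zero>"
      by (rule L.c_closed L.c_bounded)+
    assume "y \<in> carrier (powser R)"
    then have y: "y \<in> carrier L" by (rule sub)
    show "cf (x \<oplus>\<^bsub>powser R\<^esub> y) (- i) = cf x (- i) \<oplus> cf y (- i)"
      unfolding eq by (rule L.c_add[OF x y])
    show "x = y" if "\<And>i. cf x (- i) = cf y (- i)" by (rule L.c_inject[OF x y that])
    assume M: "\<forall>i>M. cf x (- i) = \<zero>" and N: "\<forall>i>N. cf y (- i) = \<zero>"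
    show "cf (x \<otimes>\<^bsub>powser R\<^esub> y) (- i) = \<zero>" if "i > M + N"
      unfolding eq by (rule L.c_mult_bound[OF x y M N that])
    show "cf (x \<otimes>\<^bsub>powser R\<^esub> y) (- (M + N)) = cf x (- M) \<otimes> cf y (- N)"
      unfolding eq by (rule L.c_mult_top[OF x y M N])
  next
    show "cf \<one>\<^bsub>powser R\<^esub> (- i) = (if i = 0 then \<one> else \<zero>)" for i
      unfolding eq by (rule L.c_one)
  qed
qed

section \<open>Rings with unique roots\<close>

text \<open>The properties that pass together from a coefficient ring to its series.\<close>

definition unique_root_ring :: "nat \<Rightarrow> ('k :: field \<Rightarrow> 'a) \<Rightarrow> ('a, 'm) ring_scheme \<Rightarrow> bool" where
  "unique_root_ring m \<kappa> R \<longleftrightarrow> ring R \<and> zero_divisor_free R \<and> central_scalars \<kappa> R \<and>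
     power_differential_inj m R \<and> roots_unique m \<kappa> R"

lemma unique_root_ring_lift:
  assumes "leading_coeff R S c" "m > 0" and good: "unique_root_ring m \<kappa> R"
    and closed: "\<And>z. \<kappa>' z \<in> carrier S"
    and coeff: "\<And>z i. c (\<kappa>' z) i = (if i = 0 then \<kappa> z else \<zero>\<^bsub>R\<^esub>)"
    and mult: "\<And>z x i. x \<in> carrier S \<Longrightarrow> c (\<kappa>' z \<otimes>\<^bsub>S\<^esub> x) i = \<kappa> z \<otimes>\<^bsub>R\<^esub> c x i"
      "\<And>z x i. x \<in> carrier S \<Longrightarrow> c (x \<otimes>\<^bsub>S\<^esub> \<kappa>' z) i = c x i \<otimes>\<^bsub>R\<^esub> \<kappa> z"
  shows "unique_root_ring m \<kappa>' S"
proof -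
  interpret leading_coeff R S c by fact
  have \<kappa>': "central_scalars \<kappa>' S"
    by (rule central_scalars_lift[OF _ closed coeff mult]) (use good in \<open>simp_all add: unique_root_ring_def\<close>)
  have "roots_unique m \<kappa>' S"
    by (rule roots_unique_lift[OF \<open>m > 0\<close> _ _ \<kappa>' _ mult(1)]) (use good in \<open>simp_all add: unique_root_ring_def\<close>)
  then show ?thesis
    using good \<kappa>' zero_divisor_free_lift power_differential_inj_lift S.ring_axioms
    by (simp add: unique_root_ring_def)
qed

lemma roots_eq_scalar_multiples:
  assumes good: "unique_root_ring m \<kappa> R" and "m > 0" and M: "M \<in> carrier R" "M [^]\<^bsub>R\<^esub> m = L" and "L \<noteq> \<zero>\<^bsub>R\<^esub>"
  shows "{M' \<in> carrier R. M' [^]\<^bsub>R\<^esub> m = L} = {\<kappa> z \<otimes>\<^bsub>R\<^esub> M | z. z ^ m = 1}"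
proof -
  interpret ring R using good by (simp add: unique_root_ring_def)
  have \<kappa>: "central_scalars \<kappa> R" using good by (simp add: unique_root_ring_def)
  have uniq: "roots_unique m \<kappa> R" using good by (simp add: unique_root_ring_def)
  have "M \<noteq> \<zero>\<^bsub>R\<^esub>" using assms by (auto simp: nat_pow_zero)
  have L: "L \<in> carrier R" using M by (metis nat_pow_closed)
  then have "\<exists>z. z ^ m = 1 \<and> M' = \<kappa> z \<otimes>\<^bsub>R\<^esub> M" if "M' \<in> carrier R" "M' [^]\<^bsub>R\<^esub> m = L" for M'
    using uniq[unfolded roots_unique_def, THEN bspec, of M, THEN bspec, of M'] that M \<open>M \<noteq> \<zero>\<^bsub>R\<^esub>\<close>
    by simp
  moreover have "\<kappa> z \<otimes>\<^bsub>R\<^esub> M \<in> carrier R" "(\<kappa> z \<otimes>\<^bsub>R\<^esub> M) [^]\<^bsub>R\<^esub> m = L" if "z ^ m = 1" for z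
    using that M L scalar_mult_pow[OF \<kappa> M(1), of z m] central_scalarsD(1,2)[OF \<kappa>] by simp_all
  ultimately show ?thesis by blast
qed

lemma (in ring) power_differential_commutative:
  assumes comm: "\<And>x y. x \<in> carrier R \<Longrightarrow> y \<in> carrier R \<Longrightarrow> x \<otimes> y = y \<otimes> x"
    and \<kappa>: "central_scalars \<kappa> R" and b_y: "b \<in> carrier R" "y \<in> carrier R"
  shows "power_differential R (Suc m) b y = \<kappa> (of_nat (Suc m)) \<otimes> (b [^] m \<otimes> y)"
proof (induction m)
  case 0
  then show ?case using b_y central_scalarsD(2)[OF \<kappa>] by simp
next
  case (Suc m)
  note \<kappa>D = central_scalarsD[OF \<kappa>]
  \<comment> \<open>commutativity collects all factors \<open>b\<close> on the left\<close>
  have e: "b [^] m \<otimes> y \<otimes> b = b [^] Suc m \<otimes> y"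
    using b_y comm[of y b] by (simp add: m_assoc)
  have "power_differential R (Suc (Suc m)) b y
      = \<kappa> (of_nat (Suc m)) \<otimes> (b [^] m \<otimes> y) \<otimes> b \<oplus> b [^] Suc m \<otimes> y"
    by (simp only: power_differential.simps(2)[of R "Suc m"] Suc)
  also have "\<dots> = \<kappa> (of_nat (Suc m)) \<otimes> (b [^] Suc m \<otimes> y) \<oplus> \<kappa> 1 \<otimes> (b [^] Suc m \<otimes> y)"
    using b_y \<kappa>D(1,2) e by (simp add: m_assoc del: nat_pow_Suc of_nat_Suc)
  also have "\<dots> = \<kappa> (of_nat (Suc m) + 1) \<otimes> (b [^] Suc m \<otimes> y)"
    using b_y \<kappa>D(1,3) by (simp add: l_distr del: nat_pow_Suc of_nat_Suc)
  finally show ?case by (simp add: add.commute)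
qed

section \<open>Commuting derivations\<close>

text \<open>Derivations vanish on the scalars so that the scalars stay central in rings of pseudo-differential
  series.\<close>

definition commuting_derivations ::
  "'j set \<Rightarrow> ('j \<Rightarrow> 'a \<Rightarrow> 'a) \<Rightarrow> ('k \<Rightarrow> 'a) \<Rightarrow> ('a, 'm) ring_scheme \<Rightarrow> bool" where
  "commuting_derivations J \<delta> \<kappa> R \<longleftrightarrow>
     (\<forall>j \<in> J. derivation R (\<delta> j) \<and> (\<forall>z. \<delta> j (\<kappa> z) = \<zero>\<^bsub>R\<^esub>)) \<and>
     (\<forall>i \<in> J. \<forall>j \<in> J. \<forall>x \<in> carrier R. \<delta> i (\<delta> j x) = \<delta> j (\<delta> i x))"

lemma derivation_closed: "derivation R d \<Longrightarrow> x \<in> carrier R \<Longrightarrow> d x \<in> carrier R"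
  by (simp add: derivation_def additive_map_def)

lemma derivation_cong:
  assumes "ring R" "derivation R d" "\<And>x. x \<in> carrier R \<Longrightarrow> d' x = d x"
  shows "derivation R d'"
proof -
  interpret ring R by fact
  show ?thesis using assms(2,3) by (simp add: derivation_def additive_map_def)
qed

lemma coeffwise_const_series:
  assumes "D \<zero>\<^bsub>R\<^esub> = \<zero>\<^bsub>R\<^esub>" "D c = \<zero>\<^bsub>R\<^esub>"
  shows "coeffwise D (const_series R c) = Ser (\<lambda>i. \<zero>\<^bsub>R\<^esub>)"
  using assms by (auto simp: coeffwise_def const_series_def)

lemma coeffwise_commute:
  assumes "\<And>i. cf a i \<in> carrier R" "\<And>x. x \<in> carrier R \<Longrightarrow> D (D' x) = D' (D x)"
  shows "coeffwise D (coeffwise D' a) = coeffwise D' (coeffwise D a)"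
  using assms by (simp add: coeffwise_def)

lemma commuting_derivations_psdo:
  assumes "ring R" and \<delta>: "commuting_derivations J \<delta> \<kappa> R" and "i \<in> J"
  shows "commuting_derivations J (\<lambda>j. coeffwise (\<delta> j)) (\<lambda>z. const_series R (\<kappa> z)) (psdo R (\<delta> i))"
proof -
  interpret ring R by fact
  interpret psdo_coeffs R "\<delta> i"
    using \<delta> \<open>i \<in> J\<close> by unfold_locales (simp add: commuting_derivations_def)
  show ?thesis
    unfolding commuting_derivations_def
  proof (intro conjI ballI allI)
    fix j assume j: "j \<in> J"
    then have dj: "derivation R (\<delta> j)" "\<And>z. \<delta> j (\<kappa> z) = \<zero>\<^bsub>R\<^esub>"
      using \<delta> by (auto simp: commuting_derivations_def)
    show "derivation S (coeffwise (\<delta> j))"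
      using \<delta> j \<open>i \<in> J\<close> by (intro psdo_coeffwise_derivation) (auto simp: commuting_derivations_def)
    have "\<delta> j \<zero>\<^bsub>R\<^esub> = \<zero>\<^bsub>R\<^esub>" using dj by (auto simp: derivation_def intro: additive_map_zero)
    then show "coeffwise (\<delta> j) (const_series R (\<kappa> z)) = \<zero>\<^bsub>S\<^esub>" for z
      using dj(2) by (simp add: coeffwise_const_series) (simp add: psdo_def)
    fix l x assume "l \<in> J" "x \<in> carrier S"
    then show "coeffwise (\<delta> j) (coeffwise (\<delta> l) x) = coeffwise (\<delta> l) (coeffwise (\<delta> j) x)"
      using \<delta> j by (intro coeffwise_commute[of _ R]) (auto simp: commuting_derivations_def)
  qed
qed

section \<open>The coefficient rings\<close>

text \<open>The derivation with respect to the \<open>j\<close>-th variable on the ring of series in \<open>n\<close> variables, before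
  any \<open>\<partial>\<close> is adjoined.\<close>

definition base_deriv :: "nat \<Rightarrow> nat \<Rightarrow> 'k::field ser \<Rightarrow> 'k ser" where
  "base_deriv n j = (coeffwise ^^ (n - j)) (xderiv (laurent_field (j - 1)))"

lemma base_deriv_Suc: "j \<le> n \<Longrightarrow> base_deriv (Suc n) j = coeffwise (base_deriv n j)"
  by (simp add: base_deriv_def Suc_diff_le)

lemma base_deriv_top: "base_deriv (Suc n) (Suc n) = xderiv (laurent_field n)"
  by (simp add: base_deriv_def)

definition commutative_ring :: "('a, 'm) ring_scheme \<Rightarrow> bool" where
  "commutative_ring R \<longleftrightarrow> ring R \<and> (\<forall>x \<in> carrier R. \<forall>y \<in> carrier R. x \<otimes>\<^bsub>R\<^esub> y = y \<otimes>\<^bsub>R\<^esub> x)"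

lemma const_ring_commutative: "commutative_ring const_ring"
proof -
  have "ring (const_ring :: 'a ser ring)"
  proof (rule ringI)
    show "abelian_group (const_ring :: 'a ser ring)"
    proof (rule abelian_groupI)
      fix x assume "x \<in> carrier (const_ring :: 'a ser ring)"
      then obtain a where "x = Const a" by (auto simp: const_ring_def)
      then show "\<exists>y \<in> carrier const_ring. y \<oplus>\<^bsub>const_ring\<^esub> x = \<zero>\<^bsub>const_ring\<^esub>"
        by (intro bexI[of _ "Const (- a)"]) (auto simp: const_ring_def)
    qed (auto simp: const_ring_def)
    show "monoid (const_ring :: 'a ser ring)"
      by (rule monoidI) (auto simp: const_ring_def)
  qed (auto simp: const_ring_def algebra_simps)
  then show ?thesis by (auto simp: commutative_ring_def const_ring_def)
qed

lemma const_ring_pow: "Const a [^]\<^bsub>const_ring\<^esub> (m :: nat) = Const (a ^ m)"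
  by (induction m) (auto simp: const_ring_def nat_pow_def mult.commute)

lemma const_ring_zero_divisor_free: "zero_divisor_free (const_ring :: 'k::field ser ring)"
  by (auto simp: zero_divisor_free_def const_ring_def)

lemma const_ring_scalars: "central_scalars Const const_ring"
  by (auto simp: central_scalars_def const_ring_def)

lemma const_ring_roots_unique: "m > 0 \<Longrightarrow> roots_unique m Const (const_ring :: 'k::field ser ring)"
  unfolding roots_unique_def
proof (intro ballI impI)
  fix f g :: "'k ser"
  assume m: "m > 0" and f: "f \<in> carrier const_ring - {\<zero>\<^bsub>const_ring\<^esub>}" and g: "g \<in> carrier const_ring"
    and eq: "g [^]\<^bsub>const_ring\<^esub> m = f [^]\<^bsub>const_ring\<^esub> m"
  obtain a b where ab: "f = Const a" "g = Const b" "a \<noteq> 0"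
    using f g by (auto simp: const_ring_def)
  then have "b ^ m = a ^ m" using eq by (simp add: const_ring_pow)
  then have "(b / a) ^ m = 1" using ab by (simp add: power_divide)
  moreover have "g = Const (b / a) \<otimes>\<^bsub>const_ring\<^esub> f" using ab by (simp add: const_ring_def)
  ultimately show "\<exists>z. z ^ m = 1 \<and> g = Const z \<otimes>\<^bsub>const_ring\<^esub> f" by blast
qed

lemma commutative_power_differential_inj:
  assumes "commutative_ring R" "zero_divisor_free R" and \<kappa>: "central_scalars \<kappa> R"
    and m: "of_nat m \<noteq> (0 :: 'k :: field)" and inj: "\<kappa> (of_nat m :: 'k) \<noteq> \<zero>\<^bsub>R\<^esub>"
  shows "power_differential_inj m R"
proof -
  interpret ring R using assms by (simp add: commutative_ring_def)
  obtain k where k: "m = Suc k" using m by (cases m) auto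
  show ?thesis
    unfolding power_differential_inj_def
  proof (intro ballI)
    fix b y assume b: "b \<in> carrier R - {\<zero>\<^bsub>R\<^esub>}" and y: "y \<in> carrier R - {\<zero>\<^bsub>R\<^esub>}"
    have "power_differential R m b y = \<kappa> (of_nat m) \<otimes>\<^bsub>R\<^esub> (b [^]\<^bsub>R\<^esub> k \<otimes>\<^bsub>R\<^esub> y)"
      unfolding k using assms b y
      by (intro power_differential_commutative[OF _ \<kappa>]) (auto simp: commutative_ring_def)
    moreover have "b [^]\<^bsub>R\<^esub> k \<otimes>\<^bsub>R\<^esub> y \<noteq> \<zero>\<^bsub>R\<^esub>"
      using zero_divisor_free_pow[OF assms(2), of b k] assms(2) b y by (simp add: zero_divisor_free_def)
    ultimately show "power_differential R m b y \<noteq> \<zero>\<^bsub>R\<^esub>"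
      using assms(2) inj b y central_scalarsD(1)[OF \<kappa>] by (simp add: zero_divisor_free_def)
  qed
qed

lemma central_scalars_inverse:
  fixes z :: "'k :: field"
  assumes "central_scalars \<kappa> R" "z \<noteq> 0"
  shows "\<kappa> z \<otimes>\<^bsub>R\<^esub> \<kappa> (inverse z) = \<one>\<^bsub>R\<^esub>"
  using central_scalarsD(4)[OF assms(1), of z "inverse z"] central_scalarsD(2)[OF assms(1)] assms(2)
  by simp

lemma const_ring_unique_root_ring:
  assumes "of_nat m \<noteq> (0 :: 'k :: field)"
  shows "unique_root_ring m Const (const_ring :: 'k ser ring)"
proof -
  have "power_differential_inj m (const_ring :: 'k ser ring)"
    using assms const_ring_commutative const_ring_zero_divisor_free const_ring_scalars
    by (intro commutative_power_differential_inj[where \<kappa> = Const]) (auto simp: const_ring_def)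
  moreover have "m > 0" using assms by (cases m) auto
  ultimately show ?thesis
    using const_ring_commutative const_ring_zero_divisor_free const_ring_scalars const_ring_roots_unique
    by (auto simp: unique_root_ring_def commutative_ring_def)
qed

lemma (in laurent_coeffs) powser_commutative:
  assumes "commutative_ring R"
  shows "commutative_ring L" "commutative_ring (powser R)"
proof -
  have *: "a \<otimes>\<^bsub>L\<^esub> b = b \<otimes>\<^bsub>L\<^esub> a" if "a \<in> carrier L" "b \<in> carrier L" for a b
    using assms that by (intro laurent_commutative) (auto simp: commutative_ring_def)
  then show "commutative_ring L" using laurent_ring by (simp add: commutative_ring_def)
  have "a \<otimes>\<^bsub>powser R\<^esub> b = b \<otimes>\<^bsub>powser R\<^esub> a" if "a \<in> carrier (powser R)" "b \<in> carrier (powser R)" for a b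
    using *[of a b] that powser_subset by (auto simp: powser_def[of R])
  then show "commutative_ring (powser R)" using powser_ring by (simp add: commutative_ring_def)
qed

lemma (in laurent_coeffs) powser_mult: "a \<otimes>\<^bsub>powser R\<^esub> b = a \<otimes>\<^bsub>L\<^esub> b"
  by (simp add: powser_def)

lemma (in laurent_coeffs) const_series_powser:
  "x \<in> carrier R \<Longrightarrow> const_series R x \<in> carrier (powser R)"
  using laurent_const_series_closed[of x] by (simp add: powser_carrier_iff) (simp add: const_series_def)

lemma (in laurent_coeffs) series_unique_root_ring:
  assumes good: "unique_root_ring m \<kappa> R" and "m > 0"
  shows "unique_root_ring m (\<lambda>z. const_series R (\<kappa> z)) L"
    and "unique_root_ring m (\<lambda>z. const_series R (\<kappa> z)) (powser R)"
proof -
  have \<kappa>: "\<kappa> z \<in> carrier R" for z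
    using good central_scalarsD(1) unfolding unique_root_ring_def by blast
  show "unique_root_ring m (\<lambda>z. const_series R (\<kappa> z)) L"
  proof (rule unique_root_ring_lift[OF _ \<open>m > 0\<close> good])
    show "leading_coeff R L (\<lambda>a i. cf a (- i))"
      using laurent_leading_coeff by (rule complete_leading_coeff.axioms(1))
  qed (simp_all add: \<kappa> laurent_const_series_closed laurent_const_mult laurent_mult_const,
      simp add: const_series_def)
  show "unique_root_ring m (\<lambda>z. const_series R (\<kappa> z)) (powser R)"
  proof (rule unique_root_ring_lift[OF powser_leading_coeff \<open>m > 0\<close> good])
    fix z x i assume "x \<in> carrier (powser R)"
    then have "x \<in> carrier L" using powser_subset by blast
    then show "cf (const_series R (\<kappa> z) \<otimes>\<^bsub>powser R\<^esub> x) (- i) = \<kappa> z \<otimes> cf x (- i)"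
      "cf (x \<otimes>\<^bsub>powser R\<^esub> const_series R (\<kappa> z)) (- i) = cf x (- i) \<otimes> \<kappa> z"
      by (simp_all add: \<kappa> powser_mult laurent_const_mult laurent_mult_const)
  qed (simp_all add: \<kappa> const_series_powser, simp add: const_series_def)
qed

lemma (in laurent_coeffs) xderiv_const_series:
  "x \<in> carrier R \<Longrightarrow> xderiv R (const_series R x) = Ser (\<lambda>i. \<zero>)"
  by (auto simp: xderiv_def const_series_def add_pow_int_0)

lemma power_series_zero: "\<zero>\<^bsub>power_series_ring n\<^esub> = \<zero>\<^bsub>laurent_field n\<^esub>"
  by (induction n) (auto simp: powser_def laurent_def)

lemma power_series_add: "add (power_series_ring n) = add (laurent_field n)"
  by (induction n) (auto simp: powser_def laurent_def)

lemma const_series_cong: "\<zero>\<^bsub>R\<^esub> = \<zero>\<^bsub>R'\<^esub> \<Longrightarrow> const_series R x = const_series R' x"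
  unfolding const_series_def by (rule arg_cong[where f = Ser]) auto

text \<open>Integer multiples are computed in two different rings. Their additions are equal functions, which
  settles the nonnegative multiples; the negative ones are only applied to vanishing coefficients.\<close>

lemma xderiv_power_series:
  assumes "ring (laurent_field n :: 'k::field ser ring)" "ring (power_series_ring n :: 'k ser ring)"
    and a: "a \<in> carrier (powser (power_series_ring n))"
  shows "xderiv (laurent_field n) a = xderiv (power_series_ring n) (a :: 'k ser)"
proof -
  interpret F: ring "laurent_field n :: 'k ser ring" by fact
  interpret A: laurent_coeffs "power_series_ring n :: 'k ser ring" using assms(2) by (rule laurent_coeffs.intro)
  have nat: "add_pow (laurent_field n) k x = add_pow (power_series_ring n) k x" for k :: nat and x :: "'k ser"
    by (induction k) (simp_all add: add_pow_def nat_pow_def power_series_add power_series_zero)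
  have "add_pow (laurent_field n) (i + 1) (cf a (i + 1)) = add_pow (power_series_ring n) (i + 1) (cf a (i + 1))" for i
  proof (cases "i + 1 \<ge> 0")
    case True
    then show ?thesis by (simp only: add_pow_int_ge nat)
  next
    case False
    then have "cf a (i + 1) = \<zero>\<^bsub>power_series_ring n\<^esub>" using a by (simp add: A.powser_carrier_iff)
    then show ?thesis
      using F.add.int_pow_one[of "i + 1"] A.add.int_pow_one[of "i + 1"] by (simp add: power_series_zero)
  qed
  then show ?thesis by (simp add: xderiv_def)
qed

text \<open>What the tower of operators requires of its base. Orders, leading coefficients and scalars are
  defined by means of the zero of the Laurent series, so another base must share this zero.\<close>

definition coefficient_ring :: "nat \<Rightarrow> 'k::field ser ring \<Rightarrow> bool" where
  "coefficient_ring n B \<longleftrightarrow> commutative_ring B \<and> \<zero>\<^bsub>B\<^esub> = \<zero>\<^bsub>laurent_field n\<^esub> \<and>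
     (\<forall>m. of_nat m \<noteq> (0 :: 'k) \<longrightarrow> unique_root_ring m (laurent_const n) B) \<and>
     commuting_derivations {1..n} (base_deriv n) (laurent_const n) B"

lemma coefficient_ring_0: "coefficient_ring 0 (const_ring :: 'k::field ser ring)"
proof -
  have "laurent_const 0 = (Const :: 'k \<Rightarrow> 'k ser)" by (rule ext) simp
  then show ?thesis
    using const_ring_commutative[where 'a = 'k] const_ring_unique_root_ring[where 'k = 'k]
    by (simp add: coefficient_ring_def commuting_derivations_def)
qed

text \<open>One more variable: the old derivations act on coefficients, and the new one commutes with
  them because they are additive.\<close>

lemma commuting_derivations_extend:
  assumes R: "ring R" and \<delta>: "commuting_derivations {1..n} \<delta> \<kappa> R"
    and cf: "\<And>a i. a \<in> carrier S \<Longrightarrow> cf a i \<in> carrier R"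
    and zS: "\<zero>\<^bsub>S\<^esub> = Ser (\<lambda>i. \<zero>\<^bsub>R\<^esub>)"
    and lift: "\<And>j. j \<in> {1..n} \<Longrightarrow> derivation S (coeffwise (\<delta> j))"
    and x: "derivation S x" "\<And>z. x (const_series R (\<kappa> z)) = \<zero>\<^bsub>S\<^esub>"
      "\<And>j a. j \<in> {1..n} \<Longrightarrow> a \<in> carrier S \<Longrightarrow> x (coeffwise (\<delta> j) a) = coeffwise (\<delta> j) (x a)"
    and \<delta>': "\<And>j. j \<in> {1..n} \<Longrightarrow> \<delta>' j = coeffwise (\<delta> j)" "\<delta>' (Suc n) = x"
  shows "commuting_derivations {1..Suc n} \<delta>' (\<lambda>z. const_series R (\<kappa> z)) S"
  unfolding commuting_derivations_def
proof (intro conjI ballI allI)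
  have split: "j = Suc n \<or> j \<in> {1..n}" if "j \<in> {1..Suc n}" for j using that by auto
  interpret ring R by (rule R)
  have \<delta>R: "derivation R (\<delta> j)" "\<delta> j (\<kappa> z) = \<zero>\<^bsub>R\<^esub>" if "j \<in> {1..n}" for j z
    using that \<delta> by (auto simp: commuting_derivations_def)
  fix i assume i: "i \<in> {1..Suc n}"
  show "derivation S (\<delta>' i)" using split[OF i] lift x(1) \<delta>' by auto
  show "\<delta>' i (const_series R (\<kappa> z)) = \<zero>\<^bsub>S\<^esub>" for z
    using split[OF i]
  proof
    assume "i \<in> {1..n}"
    moreover from this have "\<delta> i \<zero>\<^bsub>R\<^esub> = \<zero>\<^bsub>R\<^esub>"
      using \<delta>R(1) by (auto simp: derivation_def intro: additive_map_zero)
    ultimately show ?thesis using \<delta>R(2) by (simp add: \<delta>'(1) coeffwise_const_series zS)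
  qed (simp add: \<delta>' x)
  fix j a assume j: "j \<in> {1..Suc n}" and a: "a \<in> carrier S"
  show "\<delta>' i (\<delta>' j a) = \<delta>' j (\<delta>' i a)"
  proof (cases "i = Suc n \<or> j = Suc n")
    case True
    then show ?thesis using split[OF i] split[OF j] x(3)[OF _ a] \<delta>' by auto
  next
    case False
    then have ij: "i \<in> {1..n}" "j \<in> {1..n}" using i j by auto
    then show ?thesis
      using coeffwise_commute[of a R "\<delta> i" "\<delta> j"] cf[OF a] \<delta>
      by (simp add: \<delta>'(1) commuting_derivations_def)
  qed
qed

lemma coefficient_ring_laurent:
  assumes B: "coefficient_ring n (laurent_field n :: 'k::field ser ring)"
  shows "coefficient_ring (Suc n) (laurent_field (Suc n) :: 'k ser ring)"
proof -
  let ?B = "laurent_field n :: 'k ser ring"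
  have ring: "ring ?B" using B by (simp add: coefficient_ring_def commutative_ring_def)
  interpret laurent_coeffs ?B using ring by (rule laurent_coeffs.intro)
  have \<kappa>: "laurent_const (Suc n) = (\<lambda>z. const_series ?B (laurent_const n z))" by (rule ext) simp
  have \<delta>: "commuting_derivations {1..n} (base_deriv n) (laurent_const n) ?B"
    and good: "\<And>m. of_nat m \<noteq> (0 :: 'k) \<Longrightarrow> unique_root_ring m (laurent_const n) ?B"
    using B by (simp_all add: coefficient_ring_def)
  have \<kappa>B: "laurent_const n z \<in> carrier ?B" for z :: 'k
    using good[of 1] central_scalarsD(1)[of "laurent_const n" ?B] by (simp add: unique_root_ring_def)
  have der: "derivation ?B (base_deriv n j)" if "j \<in> {1..n}" for j
    using \<delta> that by (auto simp: commuting_derivations_def)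
  have "commuting_derivations {1..Suc n} (base_deriv (Suc n)) (laurent_const (Suc n)) L"
    unfolding \<kappa>
  proof (rule commuting_derivations_extend[OF ring \<delta>])
    show "xderiv ?B (coeffwise (base_deriv n j) a) = coeffwise (base_deriv n j) (xderiv ?B a)"
      if "j \<in> {1..n}" "a \<in> carrier L" for j a
      using der[OF that(1)] that(2) by (intro xderiv_coeffwise_commute) (auto simp: derivation_def)
  qed (use \<kappa>B xderiv_const_series der laurent_coeffwise_derivation xderiv_derivation in
      \<open>auto simp: laurent_def base_deriv_Suc base_deriv_top laurent_cf_closed[unfolded laurent_def]\<close>)
  moreover have "unique_root_ring m (laurent_const (Suc n)) L" if "of_nat m \<noteq> (0 :: 'k)" for m
    unfolding \<kappa> using that good by (intro series_unique_root_ring(1)) (auto intro: gr0I)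
  moreover have "commutative_ring L"
    using B by (intro powser_commutative) (simp add: coefficient_ring_def)
  ultimately show ?thesis by (simp add: coefficient_ring_def)
qed

lemma coefficient_ring_powser:
  assumes F: "ring (laurent_field n :: 'k::field ser ring)"
    and B: "coefficient_ring n (power_series_ring n :: 'k ser ring)"
  shows "coefficient_ring (Suc n) (power_series_ring (Suc n) :: 'k ser ring)"
proof -
  let ?B = "power_series_ring n :: 'k ser ring"
  have ring: "ring ?B" using B by (simp add: coefficient_ring_def commutative_ring_def)
  interpret laurent_coeffs ?B using ring by (rule laurent_coeffs.intro)
  have \<kappa>: "laurent_const (Suc n) = (\<lambda>z. const_series ?B (laurent_const n z))"
    by (rule ext) (simp add: const_series_cong[of ?B "laurent_field n"] power_series_zero)
  have \<delta>: "commuting_derivations {1..n} (base_deriv n) (laurent_const n) ?B"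
    and good: "\<And>m. of_nat m \<noteq> (0 :: 'k) \<Longrightarrow> unique_root_ring m (laurent_const n) ?B"
    using B by (simp_all add: coefficient_ring_def)
  have \<kappa>B: "laurent_const n z \<in> carrier ?B" for z :: 'k
    using good[of 1] central_scalarsD(1)[of "laurent_const n" ?B] by (simp add: unique_root_ring_def)
  have der: "derivation ?B (base_deriv n j)" if "j \<in> {1..n}" for j
    using \<delta> that by (auto simp: commuting_derivations_def)
  have x: "xderiv (laurent_field n) a = xderiv ?B a" if "a \<in> carrier (powser ?B)" for a
    using F ring that by (rule xderiv_power_series)
  have lift: "derivation (powser ?B) (coeffwise (base_deriv n j))" if "j \<in> {1..n}" for j
    using der[OF that] by (rule powser_coeffwise_derivation)
  have "commuting_derivations {1..Suc n} (base_deriv (Suc n)) (laurent_const (Suc n)) (powser ?B)"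
    unfolding \<kappa>
  proof (rule commuting_derivations_extend[OF ring \<delta>])
    show "\<zero>\<^bsub>powser ?B\<^esub> = Ser (\<lambda>i. \<zero>\<^bsub>?B\<^esub>)" by (simp add: powser_def laurent_def)
    then show "xderiv (laurent_field n) (const_series ?B (laurent_const n z)) = \<zero>\<^bsub>powser ?B\<^esub>" for z
      using \<kappa>B by (simp add: x const_series_powser xderiv_const_series)
    show "derivation (powser ?B) (xderiv (laurent_field n))"
      using powser_ring powser_xderiv_derivation x by (rule derivation_cong)
    fix j a assume j: "j \<in> {1..n}" and a: "a \<in> carrier (powser ?B)"
    have "coeffwise (base_deriv n j) a \<in> carrier (powser ?B)"
      using lift[OF j] a by (rule derivation_closed)
    moreover have "xderiv ?B (coeffwise (base_deriv n j) a) = coeffwise (base_deriv n j) (xderiv ?B a)"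
      using der[OF j] a powser_subset by (intro xderiv_coeffwise_commute) (auto simp: derivation_def)
    ultimately show "xderiv (laurent_field n) (coeffwise (base_deriv n j) a)
        = coeffwise (base_deriv n j) (xderiv (laurent_field n) a)"
      using a by (simp add: x)
  next
    show "cf a i \<in> carrier ?B" if "a \<in> carrier (powser ?B)" for a i
      using that powser_subset laurent_cf_closed by blast
  qed (auto simp: lift base_deriv_Suc base_deriv_top)
  moreover have "unique_root_ring m (laurent_const (Suc n)) (powser ?B)" if "of_nat m \<noteq> (0 :: 'k)" for m
    unfolding \<kappa> using that good by (intro series_unique_root_ring(2)) (auto intro: gr0I)
  moreover have "commutative_ring (powser ?B)"
    using B by (intro powser_commutative) (simp add: coefficient_ring_def)
  moreover have "\<zero>\<^bsub>powser ?B\<^esub> = \<zero>\<^bsub>laurent_field (Suc n)\<^esub>"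
    using power_series_zero[of "Suc n"] by simp
  ultimately show ?thesis by (simp add: coefficient_ring_def)
qed

lemma coefficient_ring_laurent_field: "coefficient_ring n (laurent_field n)"
  by (induction n) (simp_all only: laurent_field.simps(1) coefficient_ring_0 coefficient_ring_laurent)

lemma coefficient_ring_power_series: "coefficient_ring n (power_series_ring n :: 'k::field ser ring)"
proof (induction n)
  case (Suc n)
  have "ring (laurent_field n :: 'k ser ring)"
    using coefficient_ring_laurent_field[of n, where 'a = 'k] by (simp add: coefficient_ring_def commutative_ring_def)
  then show ?case using Suc by (rule coefficient_ring_powser)
qed (simp add: coefficient_ring_0)

text \<open>The leading coefficient of a nonzero series is nonzero, hence a unit by induction, and
  \<open>unit_lift\<close> applies.\<close>

lemma laurent_field_Units:
  "x \<in> carrier (laurent_field n) \<Longrightarrow> x \<noteq> \<zero>\<^bsub>laurent_field n\<^esub> \<Longrightarrow> x \<in> Units (laurent_field n :: 'k::field ser ring)"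
proof (induction n arbitrary: x)
  case 0
  then obtain a where "x = Const a" "a \<noteq> 0" by (auto simp: const_ring_def)
  then show ?case
    by (auto simp: Units_def const_ring_def intro!: exI[of _ "inverse a"])
next
  case (Suc n)
  have "coefficient_ring n (laurent_field n :: 'k ser ring)" by (rule coefficient_ring_laurent_field)
  then have "ring (laurent_field n :: 'k ser ring)"
    by (simp add: coefficient_ring_def commutative_ring_def)
  then interpret laurent_coeffs "laurent_field n :: 'k ser ring" by (rule laurent_coeffs.intro)
  interpret L: complete_leading_coeff "laurent_field n" L "\<lambda>a i. cf a (- i)" by (rule laurent_leading_coeff)
  have x: "x \<in> carrier L" "x \<noteq> \<zero>\<^bsub>L\<^esub>" using Suc by simp_all
  have "cf x (- L.deg x) \<in> Units (laurent_field n)"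
    using L.deg[OF x] x by (intro Suc.IH) auto
  then show ?case using L.unit_lift[OF L.deg(1)[OF x]] by simp
qed

section \<open>Iterated rings of operators\<close>

locale operator_tower =
  fixes n :: nat and B :: "'k::field ser ring"
  assumes base: "coefficient_ring n B"
begin

abbreviation T where "T \<equiv> psdo_tower n B"

abbreviation lead where "lead \<equiv> lead_coeff_at n"

lemma T_zero: "\<zero>\<^bsub>psdo_tower n (laurent_field n) i\<^esub> = \<zero>\<^bsub>T i\<^esub>"
  using base by (induction i) (auto simp: psdo_def coefficient_ring_def)

lemma partial_deriv_eq: "partial_deriv n (Suc i) = (coeffwise ^^ i) (base_deriv n (Suc i))"
  by (simp add: partial_deriv_def base_deriv_def)

lemma T_Suc: "T (Suc i) = psdo (T i) ((coeffwise ^^ i) (base_deriv n (Suc i)))"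
  by (simp add: partial_deriv_eq)

lemma tower_const_Suc: "tower_const n (Suc i) = (\<lambda>z. const_series (T i) (tower_const n i z))"
  by (rule ext) (simp add: const_series_cong[OF T_zero])

lemma B_ring: "ring B"
  using base by (simp add: coefficient_ring_def commutative_ring_def)

lemma B_comm: "x \<in> carrier B \<Longrightarrow> y \<in> carrier B \<Longrightarrow> x \<otimes>\<^bsub>B\<^esub> y = y \<otimes>\<^bsub>B\<^esub> x"
  using base by (simp add: coefficient_ring_def commutative_ring_def)

lemma B_UnitsI:
  "x \<in> carrier B \<Longrightarrow> y \<in> carrier B \<Longrightarrow> x \<otimes>\<^bsub>B\<^esub> y = \<one>\<^bsub>B\<^esub> \<Longrightarrow> x \<in> Units B"
  using B_comm[of x y] unfolding Units_def by auto

lemma T_ring_derivations: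
  assumes "i \<le> n"
  shows "ring (T i) \<and> commuting_derivations {1..n} (\<lambda>j. (coeffwise ^^ i) (base_deriv n j)) (tower_const n i) (T i)"
  using assms
proof (induction i)
  case 0
  have "tower_const n 0 = laurent_const n" by (rule ext) simp
  then show ?case using base B_ring by (simp add: coefficient_ring_def)
next
  case (Suc i)
  let ?\<delta> = "\<lambda>j. (coeffwise ^^ i) (base_deriv n j)"
  have i: "ring (T i)" "commuting_derivations {1..n} ?\<delta> (tower_const n i) (T i)" "Suc i \<in> {1..n}"
    using Suc by auto
  have "psdo_coeffs (T i) (?\<delta> (Suc i))"
    using i by (auto simp: psdo_coeffs_def differential_ring_def differential_ring_axioms_def commuting_derivations_def)
  then have "ring (T (Suc i))" unfolding T_Suc by (rule psdo_coeffs.psdo_ring)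
  moreover have "commuting_derivations {1..n} (\<lambda>j. (coeffwise ^^ Suc i) (base_deriv n j)) (tower_const n (Suc i)) (T (Suc i))"
    using commuting_derivations_psdo[OF i] unfolding T_Suc tower_const_Suc by simp
  ultimately show ?case by blast
qed

lemma T_psdo_coeffs:
  assumes "i < n"
  shows "psdo_coeffs (T i) ((coeffwise ^^ i) (base_deriv n (Suc i)))"
  using T_ring_derivations[of i] assms
  by (auto simp: psdo_coeffs_def differential_ring_def differential_ring_axioms_def commuting_derivations_def)

lemma T_layer:
  assumes "i < n"
  shows "complete_leading_coeff (T i) (T (Suc i)) cf"
  unfolding T_Suc using T_psdo_coeffs[OF assms] by (rule psdo_coeffs.psdo_leading_coeff)

lemma T_unique_root_ring:
  assumes "i \<le> n" "of_nat m \<noteq> (0 :: 'k)"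
  shows "unique_root_ring m (tower_const n i) (T i)"
  using assms(1)
proof (induction i)
  case 0
  have "tower_const n 0 = laurent_const n" by (rule ext) simp
  then show ?case using base assms(2) by (simp add: coefficient_ring_def)
next
  case (Suc i)
  then have good: "unique_root_ring m (tower_const n i) (T i)" by simp
  let ?d = "(coeffwise ^^ i) (base_deriv n (Suc i))"
  interpret psdo_coeffs "T i" ?d using T_psdo_coeffs Suc by simp
  have d: "?d (tower_const n i z) = \<zero>\<^bsub>T i\<^esub>" for z
    using T_ring_derivations[of i] Suc by (auto simp: commuting_derivations_def)
  have \<kappa>: "tower_const n i z \<in> carrier (T i)" for z
    using good central_scalarsD(1)[of "tower_const n i" "T i"] by (simp add: unique_root_ring_def)
  show ?case
    unfolding tower_const_Suc T_Suc
  proof (rule unique_root_ring_lift[OF _ _ good])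
    show "leading_coeff (T i) S cf"
      using psdo_leading_coeff by (rule complete_leading_coeff.axioms(1))
    show "m > 0" using assms(2) by (cases m) auto
  qed (simp_all add: \<kappa> d psdo_const_series_closed psdo_const_mult psdo_mult_const, simp add: const_series_def)
qed

lemma T_zero_divisor_free: "i \<le> n \<Longrightarrow> zero_divisor_free (T i)"
  using T_unique_root_ring[of i 1] by (simp add: unique_root_ring_def)

end

(* From here on a layer is unfolded only by the rules of tower_layer. *)
declare psdo_tower.simps(2) [simp del] nu_at.simps(2) [simp del] lead_coeff_at.simps(2) [simp del]

locale tower_layer = operator_tower +
  fixes i
  assumes i_less: "i < n"
begin

sublocale layer: complete_leading_coeff "T i" "T (Suc i)" cf
  by (rule T_layer[OF i_less])

lemma ord_eq_deg: "ord_at n (Suc i) L = layer.deg L"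
  by (simp add: ord_at_def layer.deg_def T_zero)

lemma zdf: "zero_divisor_free (T i)"
  using T_zero_divisor_free i_less by simp

lemma lead_Suc: "lead (Suc i) L = lead i (cf L (layer.deg L))"
  by (simp add: ord_eq_deg lead_coeff_at.simps(2))

lemma nu_Suc: "nu_at n (Suc i) L = nu_at n i (cf L (layer.deg L)) @ [layer.deg L]"
  by (simp add: ord_eq_deg nu_at.simps(2))

lemma top_nonzero:
  assumes "L \<in> carrier (T (Suc i)) - {\<zero>\<^bsub>T (Suc i)\<^esub>}"
  shows "cf L (layer.deg L) \<in> carrier (T i) - {\<zero>\<^bsub>T i\<^esub>}"
  using assms layer.deg(2) layer.c_closed by blast

end

context operator_tower
begin

lemma layerI: "Suc i \<le> n \<Longrightarrow> tower_layer n B i"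
  by unfold_locales simp

lemma lead_nonzero:
  assumes "i \<le> n" "L \<in> carrier (T i) - {\<zero>\<^bsub>T i\<^esub>}"
  shows "lead i L \<in> carrier B - {\<zero>\<^bsub>B\<^esub>}"
  using assms
proof (induction i arbitrary: L)
  case (Suc i)
  interpret tower_layer n B i by (rule layerI[OF Suc.prems(1)])
  show ?case
    unfolding lead_Suc using Suc.prems top_nonzero[OF Suc.prems(2)] by (intro Suc.IH) auto
qed simp

lemma length_nu: "length (nu_at n i L) = i"
  by (induction i arbitrary: L) (simp_all add: nu_at.simps(2))

text \<open>The leading coefficient of a product is the product of the leading coefficients in the layer
  below, to which the induction hypothesis applies.\<close>

lemma lead_nu_mult:
  assumes "i \<le> n" "L \<in> carrier (T i) - {\<zero>\<^bsub>T i\<^esub>}" "M \<in> carrier (T i) - {\<zero>\<^bsub>T i\<^esub>}"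
  shows "lead i (L \<otimes>\<^bsub>T i\<^esub> M) = lead i L \<otimes>\<^bsub>B\<^esub> lead i M"
    and "nu_at n i (L \<otimes>\<^bsub>T i\<^esub> M) = map2 (+) (nu_at n i L) (nu_at n i M)"
proof -
  have "lead i (L \<otimes>\<^bsub>T i\<^esub> M) = lead i L \<otimes>\<^bsub>B\<^esub> lead i M \<and>
      nu_at n i (L \<otimes>\<^bsub>T i\<^esub> M) = map2 (+) (nu_at n i L) (nu_at n i M)"
    using assms
  proof (induction i arbitrary: L M)
    case (Suc i)
    interpret tower_layer n B i by (rule layerI[OF Suc.prems(1)])
    note LM = Suc.prems(2,3)
    have "lead i (cf L (layer.deg L) \<otimes>\<^bsub>T i\<^esub> cf M (layer.deg M))
          = lead i (cf L (layer.deg L)) \<otimes>\<^bsub>B\<^esub> lead i (cf M (layer.deg M)) \<and>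
        nu_at n i (cf L (layer.deg L) \<otimes>\<^bsub>T i\<^esub> cf M (layer.deg M))
          = map2 (+) (nu_at n i (cf L (layer.deg L))) (nu_at n i (cf M (layer.deg M)))"
      using Suc.prems(1) top_nonzero[OF LM(1)] top_nonzero[OF LM(2)] by (intro Suc.IH) auto
    then show ?case
      unfolding lead_Suc nu_Suc layer.deg_mult(1)[OF zdf LM] layer.deg_mult(2)[OF zdf LM]
      by (simp add: length_nu)
  qed simp
  then show "lead i (L \<otimes>\<^bsub>T i\<^esub> M) = lead i L \<otimes>\<^bsub>B\<^esub> lead i M"
    and "nu_at n i (L \<otimes>\<^bsub>T i\<^esub> M) = map2 (+) (nu_at n i L) (nu_at n i M)" by auto
qed

text \<open>Orders are compared first, which is the lexicographical order of the reversed lists. Only if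
  the orders are equal and the leading coefficients do not cancel does the comparison descend to the
  layer below.\<close>

lemma nu_add:
  assumes "i \<le> n" "L \<in> carrier (T i) - {\<zero>\<^bsub>T i\<^esub>}" "M \<in> carrier (T i) - {\<zero>\<^bsub>T i\<^esub>}"
    and "L \<oplus>\<^bsub>T i\<^esub> M \<noteq> \<zero>\<^bsub>T i\<^esub>"
  shows "rev (nu_at n i (L \<oplus>\<^bsub>T i\<^esub> M)) \<le> max (rev (nu_at n i L)) (rev (nu_at n i M))"
  using assms
proof (induction i arbitrary: L M)
  case (Suc i)
  interpret tower_layer n B i by (rule layerI[OF Suc.prems(1)])
  let ?N = "layer.deg"
  have LM: "L \<in> carrier (T (Suc i))" "M \<in> carrier (T (Suc i))" using Suc.prems by auto
  have L: "layer.below L (?N L)" and M: "layer.below M (?N M)" using Suc.prems layer.deg by auto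
  have add: "cf (L \<oplus>\<^bsub>T (Suc i)\<^esub> M) j = cf L j \<oplus>\<^bsub>T i\<^esub> cf M j" for j using LM by (rule layer.c_add)
  have tops: "cf L (?N L) \<in> carrier (T i) - {\<zero>\<^bsub>T i\<^esub>}" "cf M (?N M) \<in> carrier (T i) - {\<zero>\<^bsub>T i\<^esub>}"
    using top_nonzero Suc.prems(2,3) by auto
  consider "?N L < ?N M" | "?N M < ?N L" | "?N L = ?N M" "cf L (?N L) \<oplus>\<^bsub>T i\<^esub> cf M (?N M) = \<zero>\<^bsub>T i\<^esub>"
    | "?N L = ?N M" "cf L (?N L) \<oplus>\<^bsub>T i\<^esub> cf M (?N M) \<noteq> \<zero>\<^bsub>T i\<^esub>" by linarith
  then show ?case
  proof cases
    case 1
    have top: "cf (L \<oplus>\<^bsub>T (Suc i)\<^esub> M) (?N M) = cf M (?N M)"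
      using 1 L tops(2) by (simp add: add layer.below_def)
    have "?N (L \<oplus>\<^bsub>T (Suc i)\<^esub> M) = ?N M"
    proof (rule layer.deg_eq)
      show "layer.below (L \<oplus>\<^bsub>T (Suc i)\<^esub> M) (?N M)"
        using L M 1 by (intro layer.below_add) (auto intro: layer.below_mono)
    qed (use top tops in simp)
    then have "nu_at n (Suc i) (L \<oplus>\<^bsub>T (Suc i)\<^esub> M) = nu_at n (Suc i) M" by (simp add: nu_Suc top)
    then show ?thesis by simp
  next
    case 2
    have top: "cf (L \<oplus>\<^bsub>T (Suc i)\<^esub> M) (?N L) = cf L (?N L)"
      using 2 M tops(1) by (simp add: add layer.below_def)
    have "?N (L \<oplus>\<^bsub>T (Suc i)\<^esub> M) = ?N L"
    proof (rule layer.deg_eq)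
      show "layer.below (L \<oplus>\<^bsub>T (Suc i)\<^esub> M) (?N L)"
        using L M 2 by (intro layer.below_add) (auto intro: layer.below_mono)
    qed (use top tops in simp)
    then have "nu_at n (Suc i) (L \<oplus>\<^bsub>T (Suc i)\<^esub> M) = nu_at n (Suc i) L" by (simp add: nu_Suc top)
    then show ?thesis by simp
  next
    case 3
    have "layer.below (L \<oplus>\<^bsub>T (Suc i)\<^esub> M) (?N L - 1)"
      using layer.below_add[OF L, of M] M 3 add by (intro layer.below_strict) auto
    then have "?N (L \<oplus>\<^bsub>T (Suc i)\<^esub> M) < ?N L"
      using layer.deg_le Suc.prems(4) by fastforce
    then show ?thesis unfolding nu_Suc by (simp add: le_max_iff_disj)
  next
    case 4
    have deg: "?N (L \<oplus>\<^bsub>T (Suc i)\<^esub> M) = ?N L"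
      using layer.below_add[OF L, of M] M 4 add by (intro layer.deg_eq) auto
    have "rev (nu_at n i (cf L (?N L) \<oplus>\<^bsub>T i\<^esub> cf M (?N M)))
        \<le> max (rev (nu_at n i (cf L (?N L)))) (rev (nu_at n i (cf M (?N M))))"
      using tops 4 Suc.prems(1) by (intro Suc.IH) auto
    then show ?thesis
      unfolding nu_Suc deg add using 4 by (simp add: le_max_iff_disj)
  qed
qed simp

lemma unit_if_lead_unit:
  assumes "i \<le> n" "L \<in> carrier (T i) - {\<zero>\<^bsub>T i\<^esub>}" "lead i L \<in> Units B"
  shows "L \<in> Units (T i)"
  using assms
proof (induction i arbitrary: L)
  case (Suc i)
  interpret tower_layer n B i by (rule layerI[OF Suc.prems(1)])
  have "cf L (layer.deg L) \<in> Units (T i)"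
    using Suc.prems(1,3) top_nonzero[OF Suc.prems(2)] unfolding lead_Suc by (intro Suc.IH) auto
  then show ?case using layer.unit_lift layer.deg(1) Suc.prems(2) by blast
qed simp

lemma lead_one: "i \<le> n \<Longrightarrow> lead i \<one>\<^bsub>T i\<^esub> = \<one>\<^bsub>B\<^esub>"
proof (induction i)
  case (Suc i)
  interpret tower_layer n B i by (rule layerI[OF Suc.prems])
  have "\<one>\<^bsub>T i\<^esub> \<noteq> \<zero>\<^bsub>T i\<^esub>" using zdf by (simp add: zero_divisor_free_def)
  then have "layer.deg \<one>\<^bsub>T (Suc i)\<^esub> = 0"
    by (intro layer.deg_eq layer.below_one) (simp add: layer.c_one)
  then show ?case
    using Suc unfolding lead_Suc by (simp add: layer.c_one)
qed simp

text \<open>For the converse direction, the highest terms of \<open>L\<close> and its inverse multiply to \<open>1\<close>.\<close>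

lemma unit_iff_lead_unit:
  assumes "i \<le> n" "L \<in> carrier (T i) - {\<zero>\<^bsub>T i\<^esub>}"
  shows "L \<in> Units (T i) \<longleftrightarrow> lead i L \<in> Units B"
proof
  interpret T: ring "T i" using T_ring_derivations assms(1) by blast
  assume L: "L \<in> Units (T i)"
  define M where "M = inv\<^bsub>T i\<^esub> L"
  have M: "M \<in> carrier (T i)" "L \<otimes>\<^bsub>T i\<^esub> M = \<one>\<^bsub>T i\<^esub>" using L by (simp_all add: M_def)
  moreover have "M \<noteq> \<zero>\<^bsub>T i\<^esub>"
    using M T_zero_divisor_free[OF assms(1)] assms(2) by (auto simp: zero_divisor_free_def)
  ultimately have "lead i L \<otimes>\<^bsub>B\<^esub> lead i M = \<one>\<^bsub>B\<^esub>" "lead i M \<in> carrier B"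
    using lead_nu_mult(1)[OF assms, of M] lead_one[OF assms(1)] lead_nonzero[OF assms(1), of M] by auto
  then show "lead i L \<in> Units B"
    using lead_nonzero[OF assms] B_UnitsI by blast
qed (use unit_if_lead_unit[OF assms] in blast)

lemma lead_pow:
  assumes "i \<le> n" "L \<in> carrier (T i) - {\<zero>\<^bsub>T i\<^esub>}"
  shows "lead i (L [^]\<^bsub>T i\<^esub> (m :: nat)) = lead i L [^]\<^bsub>B\<^esub> m"
proof (induction m)
  case 0
  interpret T: ring "T i" using T_ring_derivations assms(1) by blast
  interpret B: ring B by (rule B_ring)
  show ?case using lead_one[OF assms(1)] by simp
next
  case (Suc m)
  interpret T: ring "T i" using T_ring_derivations assms(1) by blast
  interpret B: ring B by (rule B_ring)
  have "L [^]\<^bsub>T i\<^esub> m \<in> carrier (T i) - {\<zero>\<^bsub>T i\<^esub>}"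
    using assms T.zero_divisor_free_pow[OF T_zero_divisor_free[OF assms(1)]] by auto
  then show ?case using lead_nu_mult(1)[OF assms(1) _ assms(2)] Suc by simp
qed

text \<open>At the bottom the ring is commutative, and the equation \<open>m b\<^bsup>m-1\<^esup> y = r\<close> is solved by division;
  above, the surjectivity for leading coefficients is enough.\<close>

lemma power_differential_surj:
  assumes m: "of_nat m \<noteq> (0 :: 'k)" and "i \<le> n"
    and "b \<in> carrier (T i) - {\<zero>\<^bsub>T i\<^esub>}" "lead i b \<in> Units B" "r \<in> carrier (T i)"
  shows "\<exists>y \<in> carrier (T i). power_differential (T i) m b y = r"
  using assms(2-)
proof (induction i arbitrary: b r)
  case 0
  interpret B: ring B by (rule B_ring)
  have \<kappa>: "central_scalars (laurent_const n) B"
    using base m by (simp add: coefficient_ring_def unique_root_ring_def)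
  obtain k where k: "m = Suc k" using m by (cases m) auto
  let ?z = "of_nat m :: 'k"
  have b: "b \<in> Units B" "b \<in> carrier B" "r \<in> carrier B" using 0 by auto
  then have bk: "b [^]\<^bsub>B\<^esub> k \<in> Units B" by (intro B.Units_pow_closed)
  define y where "y = inv\<^bsub>B\<^esub> (b [^]\<^bsub>B\<^esub> k) \<otimes>\<^bsub>B\<^esub> (laurent_const n (inverse ?z) \<otimes>\<^bsub>B\<^esub> r)"
  have s: "laurent_const n (inverse ?z) \<otimes>\<^bsub>B\<^esub> r \<in> carrier B"
    using b central_scalarsD(1)[OF \<kappa>] by simp
  have y: "y \<in> carrier B" using bk s by (simp add: y_def)
  have "b [^]\<^bsub>B\<^esub> k \<otimes>\<^bsub>B\<^esub> y = laurent_const n (inverse ?z) \<otimes>\<^bsub>B\<^esub> r"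
    using bk s b by (simp add: y_def B.m_assoc[symmetric])
  moreover have "power_differential B m b y = laurent_const n ?z \<otimes>\<^bsub>B\<^esub> (b [^]\<^bsub>B\<^esub> k \<otimes>\<^bsub>B\<^esub> y)"
    unfolding k using b y B_comm by (intro B.power_differential_commutative[OF _ \<kappa>]) auto
  ultimately have "power_differential B m b y = r"
    using b central_scalars_inverse[OF \<kappa> m] central_scalarsD(1)[OF \<kappa>]
    by (simp add: B.m_assoc[symmetric])
  then show ?case using y by auto
next
  case (Suc i)
  interpret tower_layer n B i by (rule layerI[OF Suc.prems(1)])
  have "\<exists>y \<in> carrier (T i). power_differential (T i) m (cf b (layer.deg b)) y = q" if "q \<in> carrier (T i)" for q
    using Suc.prems(1,3) that top_nonzero[OF Suc.prems(2)] unfolding lead_Suc by (intro Suc.IH) auto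
  then show ?case
    using layer.power_differential_surj_lift layer.deg(1) Suc.prems(2,4) by blast
qed

text \<open>A root \<open>r\<close> of the leading coefficient of \<open>L\<close> exists by induction. The coefficient of its highest
  term divides that of \<open>L\<close> and is therefore a unit, so the differential of the power map at \<open>r\<close>
  is surjective and \<open>root_lift\<close> applies.\<close>

lemma root_exists:
  assumes m: "of_nat m \<noteq> (0 :: 'k)" and "i \<le> n"
    and "L \<in> carrier (T i) - {\<zero>\<^bsub>T i\<^esub>}" "lead i L \<in> Units B"
    and "\<forall>e \<in> set (nu_at n i L). int m dvd e" "\<exists>g \<in> carrier B. g [^]\<^bsub>B\<^esub> m = lead i L"
  shows "\<exists>M \<in> carrier (T i). M [^]\<^bsub>T i\<^esub> m = L"
  using assms(2-)
proof (induction i arbitrary: L)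
  case (Suc i)
  interpret tower_layer n B i by (rule layerI[OF Suc.prems(1)])
  interpret B: ring B by (rule B_ring)
  have m0: "m > 0" using m by (cases m) auto
  let ?a = "cf L (layer.deg L)"
  have a: "?a \<in> carrier (T i) - {\<zero>\<^bsub>T i\<^esub>}" using Suc.prems(2) by (rule top_nonzero)
  have u: "lead i ?a \<in> Units B" using Suc.prems(3) unfolding lead_Suc .
  have "\<exists>r \<in> carrier (T i). r [^]\<^bsub>T i\<^esub> m = ?a"
    using Suc.prems(1,4,5) a u unfolding lead_Suc nu_Suc by (intro Suc.IH) auto
  then obtain r where r: "r \<in> carrier (T i)" "r [^]\<^bsub>T i\<^esub> m = ?a" by blast
  have r0: "r \<noteq> \<zero>\<^bsub>T i\<^esub>" using r a m0 by (auto simp: layer.R.nat_pow_zero)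
  have lr: "lead i r \<in> carrier B" "lead i r [^]\<^bsub>B\<^esub> m = lead i ?a"
    using lead_nonzero[of i r] lead_pow[of i r m] r r0 Suc.prems(1) by auto
  have "lead i r \<in> Units B"
  proof -
    obtain k where k: "m = Suc k" using m0 by (cases m) auto
    define v where "v = lead i r [^]\<^bsub>B\<^esub> k \<otimes>\<^bsub>B\<^esub> inv\<^bsub>B\<^esub> (lead i ?a)"
    have v: "v \<in> carrier B" using lr u by (simp add: v_def)
    have "lead i r \<otimes>\<^bsub>B\<^esub> v = (lead i r \<otimes>\<^bsub>B\<^esub> lead i r [^]\<^bsub>B\<^esub> k) \<otimes>\<^bsub>B\<^esub> inv\<^bsub>B\<^esub> (lead i ?a)"
      using lr u by (simp add: v_def B.m_assoc)
    also have "lead i r \<otimes>\<^bsub>B\<^esub> lead i r [^]\<^bsub>B\<^esub> k = lead i ?a"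
      using lr B_comm[of "lead i r" "lead i r [^]\<^bsub>B\<^esub> k"] by (simp add: k)
    finally have "lead i r \<otimes>\<^bsub>B\<^esub> v = \<one>\<^bsub>B\<^esub>" using u by simp
    then show ?thesis by (rule B_UnitsI[OF lr(1) v])
  qed
  then have surj: "\<exists>y \<in> carrier (T i). power_differential (T i) m r y = q" if "q \<in> carrier (T i)" for q
    using that Suc.prems(1) r r0 by (intro power_differential_surj[OF m]) auto
  have "int m dvd layer.deg L" using Suc.prems(4) unfolding nu_Suc by simp
  then obtain N where N: "layer.deg L = int m * N" by (auto elim: dvdE)
  have "layer.below L (int m * N)" using layer.deg(1)[of L] Suc.prems(2) N by auto
  then show ?case using layer.root_lift r surj N by metis
qed simp

end

section \<open>Operators over Laurent and over power series\<close>

lemma laurent_field_tower: "operator_tower n (laurent_field n)"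
  by unfold_locales (rule coefficient_ring_laurent_field)

lemma power_series_tower: "operator_tower n (power_series_ring n)"
  by unfold_locales (rule coefficient_ring_power_series)

lemma of_nat_nonzero_if_coprime_CHAR:
  assumes "m > 0" "CHAR('k::field) = 0 \<or> coprime m CHAR('k)"
  shows "of_nat m \<noteq> (0 :: 'k)"
proof
  assume "of_nat m = (0 :: 'k)"
  then have dvd: "CHAR('k) dvd m" by (simp add: of_nat_eq_0_iff_char_dvd)
  then have "coprime m CHAR('k)" using assms by auto
  then have "CHAR('k) = 1" using dvd by (metis coprime_common_divisor_nat dvd_refl nat_dvd_1_iff_1)
  then show False by simp
qed

theorem proposition1:
  fixes n :: nat and F A P E :: "'k::field ser ring"
  assumes "n \<ge> 1"
    and "F = laurent_field n" and "A = power_series_ring n"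
    and "P = P_ring n" and "E = E_ring n"
  shows
    "skew_field P \<and>
     (\<forall>L \<in> carrier E - {\<zero>\<^bsub>E\<^esub>}. L \<in> Units E \<longleftrightarrow> op_lead n L \<in> Units A) \<and>
     (\<forall>L \<in> carrier P - {\<zero>\<^bsub>P\<^esub>}. \<forall>M \<in> carrier P - {\<zero>\<^bsub>P\<^esub>}.
        op_ord n (L \<otimes>\<^bsub>P\<^esub> M) = op_ord n L + op_ord n M \<and>
        (L \<oplus>\<^bsub>P\<^esub> M \<noteq> \<zero>\<^bsub>P\<^esub> \<longrightarrow> op_ord n (L \<oplus>\<^bsub>P\<^esub> M) \<le> max (op_ord n L) (op_ord n M))) \<and>
     (\<forall>L \<in> carrier P - {\<zero>\<^bsub>P\<^esub>}. \<forall>M \<in> carrier P - {\<zero>\<^bsub>P\<^esub>}.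
        op_nu n (L \<otimes>\<^bsub>P\<^esub> M) = map2 (+) (op_nu n L) (op_nu n M) \<and>
        (L \<oplus>\<^bsub>P\<^esub> M \<noteq> \<zero>\<^bsub>P\<^esub> \<longrightarrow>
           rev (op_nu n (L \<oplus>\<^bsub>P\<^esub> M)) \<le> max (rev (op_nu n L)) (rev (op_nu n M)))) \<and>
     (\<forall>m::nat. m > 0 \<and> (CHAR('k) = 0 \<or> coprime m CHAR('k)) \<longrightarrow>
        (\<forall>L \<in> carrier P - {\<zero>\<^bsub>P\<^esub>}.
           (\<forall>e \<in> set (op_nu n L). int m dvd e) \<and> (\<exists>g \<in> carrier F. g [^]\<^bsub>F\<^esub> m = op_lead n L) \<longrightarrow>
           (\<exists>M \<in> carrier P. M [^]\<^bsub>P\<^esub> m = L \<and>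
              {M' \<in> carrier P. M' [^]\<^bsub>P\<^esub> m = L} = {scalar n z \<otimes>\<^bsub>P\<^esub> M | z. z ^ m = 1})) \<and>
        (\<forall>L \<in> carrier E - {\<zero>\<^bsub>E\<^esub>}.
           (\<forall>e \<in> set (op_nu n L). int m dvd e) \<and> (\<exists>g \<in> carrier A. g [^]\<^bsub>A\<^esub> m = op_lead n L) \<longrightarrow>
           (op_lead n L \<in> Units A \<longrightarrow> (\<exists>M \<in> carrier E. M [^]\<^bsub>E\<^esub> m = L)) \<and>
           (\<forall>M \<in> carrier E. M [^]\<^bsub>E\<^esub> m = L \<longrightarrow>
              {M' \<in> carrier E. M' [^]\<^bsub>E\<^esub> m = L} = {scalar n z \<otimes>\<^bsub>E\<^esub> M | z. z ^ m = 1})))"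
proof -
  obtain n' where n': "n = Suc n'" using assms(1) by (cases n) auto
  interpret P: operator_tower n F unfolding assms(2) by (rule laurent_field_tower)
  interpret E: operator_tower n A unfolding assms(3) by (rule power_series_tower)
  interpret layer: tower_layer n F n' by (rule P.layerI) (simp add: n')
  have P: "P = P.T n" and E: "E = E.T n"
    using assms by (simp_all add: P_ring_def E_ring_def)
  have P_Suc: "P = P.T (Suc n')" using P n' by simp
  have field: "f \<in> Units F" if "f \<in> carrier F - {\<zero>\<^bsub>F\<^esub>}" for f
    using that laurent_field_Units[of f n] assms(2) by auto
  have lead_unit: "op_lead n L \<in> Units F" if "L \<in> carrier P - {\<zero>\<^bsub>P\<^esub>}" for L
    using P.lead_nonzero[of n L] that P field by (simp add: op_lead_def)
  have skew: "skew_field P"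
  proof -
    interpret ring P using P.T_ring_derivations[of n] P by simp
    have "L \<in> Units P" if "L \<in> carrier P - {\<zero>\<^bsub>P\<^esub>}" for L
      using P.unit_if_lead_unit[of n L] lead_unit[OF that] that P by (simp add: op_lead_def)
    moreover have "\<one>\<^bsub>P\<^esub> \<noteq> \<zero>\<^bsub>P\<^esub>"
      using P.T_zero_divisor_free[of n] P by (simp add: zero_divisor_free_def)
    then have "\<zero>\<^bsub>P\<^esub> \<notin> Units P" by (auto simp: Units_def)
    ultimately show ?thesis by unfold_locales (auto simp: Units_closed)
  qed
  have units: "\<forall>L \<in> carrier E - {\<zero>\<^bsub>E\<^esub>}. L \<in> Units E \<longleftrightarrow> op_lead n L \<in> Units A"
    using E.unit_iff_lead_unit[of n] E by (simp add: op_lead_def)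
  have ord: "op_ord n (L \<otimes>\<^bsub>P\<^esub> M) = op_ord n L + op_ord n M \<and>
      (L \<oplus>\<^bsub>P\<^esub> M \<noteq> \<zero>\<^bsub>P\<^esub> \<longrightarrow> op_ord n (L \<oplus>\<^bsub>P\<^esub> M) \<le> max (op_ord n L) (op_ord n M))"
    if L: "L \<in> carrier P - {\<zero>\<^bsub>P\<^esub>}" and M: "M \<in> carrier P - {\<zero>\<^bsub>P\<^esub>}" for L M
  proof -
    have deg: "op_ord n x = layer.layer.deg x" for x
      unfolding op_ord_def n' by (rule layer.ord_eq_deg[unfolded n'])
    have L': "L \<in> carrier (P.T (Suc n'))" "L \<noteq> \<zero>\<^bsub>P.T (Suc n')\<^esub>"
      and M': "M \<in> carrier (P.T (Suc n'))" "M \<noteq> \<zero>\<^bsub>P.T (Suc n')\<^esub>"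
      using L M unfolding P_Suc by auto
    have "layer.layer.below L (max (layer.layer.deg L) (layer.layer.deg M))"
      by (rule layer.layer.below_mono[OF layer.layer.deg(1)[OF L']]) simp
    moreover have "layer.layer.below M (max (layer.layer.deg L) (layer.layer.deg M))"
      by (rule layer.layer.below_mono[OF layer.layer.deg(1)[OF M']]) simp
    ultimately have sum: "layer.layer.below (L \<oplus>\<^bsub>P\<^esub> M) (max (layer.layer.deg L) (layer.layer.deg M))"
      unfolding P_Suc by (rule layer.layer.below_add)
    have "layer.layer.deg (L \<otimes>\<^bsub>P\<^esub> M) = layer.layer.deg L + layer.layer.deg M"
      using L M unfolding P_Suc by (rule layer.layer.deg_mult(1)[OF layer.zdf])
    then show ?thesis
      using layer.layer.deg_le[OF sum] unfolding deg P_Suc by simp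
  qed
  have nu: "op_nu n (L \<otimes>\<^bsub>P\<^esub> M) = map2 (+) (op_nu n L) (op_nu n M) \<and>
      (L \<oplus>\<^bsub>P\<^esub> M \<noteq> \<zero>\<^bsub>P\<^esub> \<longrightarrow>
         rev (op_nu n (L \<oplus>\<^bsub>P\<^esub> M)) \<le> max (rev (op_nu n L)) (rev (op_nu n M)))"
    if "L \<in> carrier P - {\<zero>\<^bsub>P\<^esub>}" "M \<in> carrier P - {\<zero>\<^bsub>P\<^esub>}" for L M
    using that P.lead_nu_mult(2)[of n L M] P.nu_add[of n L M] unfolding op_nu_def P by blast
  have rootP: "\<exists>M \<in> carrier P. M [^]\<^bsub>P\<^esub> m = L \<and>
      {M' \<in> carrier P. M' [^]\<^bsub>P\<^esub> m = L} = {scalar n z \<otimes>\<^bsub>P\<^esub> M | z. z ^ m = 1}"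
    if m: "m > 0 \<and> (CHAR('k) = 0 \<or> coprime m CHAR('k))" and L: "L \<in> carrier P - {\<zero>\<^bsub>P\<^esub>}"
      and root: "(\<forall>e \<in> set (op_nu n L). int m dvd e) \<and> (\<exists>g \<in> carrier F. g [^]\<^bsub>F\<^esub> m = op_lead n L)"
    for m L
  proof -
    have m': "of_nat m \<noteq> (0 :: 'k)" using m of_nat_nonzero_if_coprime_CHAR by blast
    obtain M where M: "M \<in> carrier P" "M [^]\<^bsub>P\<^esub> m = L"
      using P.root_exists[OF m', of n L] L root lead_unit[OF L] P by (auto simp: op_lead_def op_nu_def)
    have "unique_root_ring m (scalar n) P"
      using P.T_unique_root_ring[OF _ m', of n] P by (simp add: scalar_def)
    then show ?thesis using roots_eq_scalar_multiples[OF _ _ M] M m L by blast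
  qed
  have rootE: "(op_lead n L \<in> Units A \<longrightarrow> (\<exists>M \<in> carrier E. M [^]\<^bsub>E\<^esub> m = L)) \<and>
      (\<forall>M \<in> carrier E. M [^]\<^bsub>E\<^esub> m = L \<longrightarrow>
         {M' \<in> carrier E. M' [^]\<^bsub>E\<^esub> m = L} = {scalar n z \<otimes>\<^bsub>E\<^esub> M | z. z ^ m = 1})"
    if m: "m > 0 \<and> (CHAR('k) = 0 \<or> coprime m CHAR('k))" and L: "L \<in> carrier E - {\<zero>\<^bsub>E\<^esub>}"
      and root: "(\<forall>e \<in> set (op_nu n L). int m dvd e) \<and> (\<exists>g \<in> carrier A. g [^]\<^bsub>A\<^esub> m = op_lead n L)"
    for m L
  proof -
    have m': "of_nat m \<noteq> (0 :: 'k)" using m of_nat_nonzero_if_coprime_CHAR by blast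
    have "unique_root_ring m (scalar n) E"
      using E.T_unique_root_ring[OF _ m', of n] E by (simp add: scalar_def)
    then have "{M' \<in> carrier E. M' [^]\<^bsub>E\<^esub> m = L} = {scalar n z \<otimes>\<^bsub>E\<^esub> M | z. z ^ m = 1}"
      if "M \<in> carrier E" "M [^]\<^bsub>E\<^esub> m = L" for M
      using roots_eq_scalar_multiples[OF _ _ that] m L by blast
    moreover have "\<exists>M \<in> carrier E. M [^]\<^bsub>E\<^esub> m = L" if "op_lead n L \<in> Units A"
      using E.root_exists[OF m', of n L] L root that E by (auto simp: op_lead_def op_nu_def)
    ultimately show ?thesis by blast
  qed
  show ?thesis
    by (rule conjI[OF skew], rule conjI[OF units],
        rule conjI, intro ballI, rule ord, assumption+,
        rule conjI, intro ballI, rule nu, assumption+,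
        intro allI impI, rule conjI; intro ballI impI; (rule rootP | rule rootE); assumption)
qed

end
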